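(* Let $E,F$ be complex Banach spaces, $U$ an open subset of $E$, $1<p\leq\infty$ and $f\in\mathcal{H}^\infty(U,F)$. The following conditions are equivalent: (i) $f\colon U\to F$ is Cohen strongly $p$-summing holomorphic. (ii) There exist a regular Borel probability measure $\mu$ on $(B_{F^{**}},w^* )$, a closed subspace $S_{p^*}$ of $L_{p^*}(\mu)$ and a bounded holomorphic mapping $g\colon U\to(S_{p^*})^*$ such that the following diagram commutes: $U\xrightarrow{g}(S_{p^*})^*\xrightarrow{(j_{p^*})^*}(\iota_{F^*}(F^* ))^*\xrightarrow{(\iota_{F^*})^*}F^{**}$ along one side and $U\xrightarrow{f}F\xrightarrow{\kappa_F}F^{**}$ along the other, that is, $$\kappa_F\circ f=(\iota_{F^*})^*\circ(j_{p^*})^*\circ g.$$ In this case, $d_p^{\mathcal{H}^\infty}(f)=\|g\|_\infty$.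
   Context: $\mathcal{H}^\infty(U,F)$ is the Banach space of all bounded holomorphic mappings from $U$ to $F$ with the supremum norm $\|\cdot\|_\infty$. $B_X$ is the closed unit ball of a Banach space $X$, $w^*$ denotes the weak* topology, and $p^*$ is the conjugate index of $p$ (with $p^*=1$ if $p=\infty$). $\kappa_F\colon F\to F^{**}$ is the canonical isometric embedding, and $\iota_{F^*}\colon F^*\to C(B_{F^{**}})$ is the canonical isometric injection $\langle\iota_{F^*}(y^* ),y^{**}\rangle=y^{**}(y^* )$ for $y^*\in F^*$, $y^{**}\in B_{F^{**}}$. For a regular Borel measure $\mu$ on $(B_{F^{**}},w^* )$, $j_{p^*}\colon C(B_{F^{**}})\to L_{p^*}(\mu)$ is the canonical map. In the diagram, $(j_{p^*})^*$ and $(\iota_{F^*})^*$ are the adjoints of $j_{p^*}\colon\iota_{F^*}(F^* )\to S_{p^*}$ (the restriction of the canonical map, so that $j_{p^*}(\iota_{F^*}(F^* ))\subseteq S_{p^*}$ is understood) and of $\iota_{F^*}\colon F^*\to\iota_{F^*}(F^* )$. A holomorphic mapping $f\colon U\to F$ is Cohen strongly $p$-summing if there is a constant $C\geq0$ such that for all $n\in\mathbb{N}$, $\lambda_1,\dots,\lambda_n\in\mathbb{C}$, $x_1,\dots,x_n\in U$ and $y_1^*,\dots,y_n^*\in F^*$, $$\sum_{i=1}^n|\lambda_i||\langle y_i^*,f(x_i)\rangle|\leq C\,\|(\lambda_i)\|_{\ell_p^n}\sup_{y^{**}\in B_{F^{**}}}\left(\sum_{i=1}^n|y^{**}(y_i^*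 )|^{p^*}\right)^{\frac{1}{p^*}},$$ where $\|(\lambda_i)\|_{\ell_p^n}=(\sum_{i=1}^n|\lambda_i|^p)^{1/p}$ if $p<\infty$ and $\max_{1\le i\le n}|\lambda_i|$ if $p=\infty$; $d_p^{\mathcal{H}^\infty}(f)$ denotes the infimum of such constants $C$. *)

theory Defs
  imports "HOL-Probability.Probability"
begin

section \<open>Complex Banach spaces as types\<close>

class complex_vector = real_vector +
  fixes scaleC :: "complex \<Rightarrow> 'a \<Rightarrow> 'a" (infixr "*\<^sub>C" 75)
  assumes scaleC_add_right: "a *\<^sub>C (x + y) = a *\<^sub>C x + a *\<^sub>C y"
    and scaleC_add_left: "(a + b) *\<^sub>C x = a *\<^sub>C x + b *\<^sub>C x"
    and scaleC_scaleC: "a *\<^sub>C (b *\<^sub>C x) = (a * b) *\<^sub>C x"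
    and scaleC_one: "1 *\<^sub>C x = x"
    and scaleR_scaleC: "r *\<^sub>R x = complex_of_real r *\<^sub>C x"

class complex_normed_vector = complex_vector + real_normed_vector +
  assumes norm_scaleC: "norm (a *\<^sub>C x) = cmod a * norm x"

class complex_banach = complex_normed_vector + banach

section \<open>Complex normed spaces with a carrier\<close>

text \<open>
  The space \<open>L\<^sub>q(\<mu>)\<close>, its subspaces and their duals depend on the measure \<open>\<mu>\<close> and hence
  cannot be types. They are records consisting of a carrier and the operations; these are
  meaningful on the carrier only.
\<close>

record 'v cnspace =
  pts :: "'v set"
  vadd :: "'v \<Rightarrow> 'v \<Rightarrow> 'v"
  vscale :: "complex \<Rightarrow> 'v \<Rightarrow> 'v"
  vnorm :: "'v \<Rightarrow> real"

definition vsub :: "'v cnspace \<Rightarrow> 'v \<Rightarrow> 'v \<Rightarrow> 'v" where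
  "vsub V x y = vadd V x (vscale V (-1) y)"

definition unit_ball :: "'v cnspace \<Rightarrow> 'v set" where
  "unit_ball V = {x \<in> pts V. vnorm V x \<le> 1}"

definition tspace :: "'a::complex_normed_vector cnspace" where
  "tspace = \<lparr>pts = UNIV, vadd = (+), vscale = (*\<^sub>C), vnorm = norm\<rparr>"

definition subspace_on :: "'v cnspace \<Rightarrow> 'v set \<Rightarrow> 'v cnspace" where
  "subspace_on V S = V\<lparr>pts := S\<rparr>"

definition closed_subspace :: "'v set \<Rightarrow> 'v cnspace \<Rightarrow> bool" where
  "closed_subspace S V \<longleftrightarrow>
     S \<subseteq> pts V \<and> S \<noteq> {} \<and>
     (\<forall>x\<in>S. \<forall>y\<in>S. vadd V x y \<in> S) \<and> (\<forall>c. \<forall>x\<in>S. vscale V c x \<in> S) \<and>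
     (\<forall>x\<in>pts V. (\<forall>\<epsilon>>0. \<exists>y\<in>S. vnorm V (vsub V x y) < \<epsilon>) \<longrightarrow> x \<in> S)"

text \<open>
  Functionals on \<open>V\<close> are normalised to be \<open>0\<close> off the carrier of \<open>V\<close>, so that equality of
  functionals is equality of functions and the operations are pointwise.
\<close>

definition dual :: "'v cnspace \<Rightarrow> ('v \<Rightarrow> complex) cnspace" where
  "dual V =
     \<lparr>pts = {\<phi>. (\<forall>x\<in>pts V. \<forall>y\<in>pts V. \<phi> (vadd V x y) = \<phi> x + \<phi> y) \<and>
                (\<forall>c. \<forall>x\<in>pts V. \<phi> (vscale V c x) = c * \<phi> x) \<and>
                (\<exists>C. \<forall>x\<in>pts V. cmod (\<phi> x) \<le> C * vnorm V x) \<and>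
                (\<forall>x. x \<notin> pts V \<longrightarrow> \<phi> x = 0)},
      vadd = (\<lambda>\<phi> \<psi> x. \<phi> x + \<psi> x),
      vscale = (\<lambda>c \<phi> x. c * \<phi> x),
      vnorm = (\<lambda>\<phi>. SUP x\<in>unit_ball V. cmod (\<phi> x))\<rparr>"

text \<open>The adjoint of a map \<open>T\<close> with domain \<open>V\<close>.\<close>

definition adjoint_op :: "'v cnspace \<Rightarrow> ('v \<Rightarrow> 'w) \<Rightarrow> ('w \<Rightarrow> complex) \<Rightarrow> 'v \<Rightarrow> complex" where
  "adjoint_op V T \<psi> = (\<lambda>x. if x \<in> pts V then \<psi> (T x) else 0)"

definition kappa :: "'v cnspace \<Rightarrow> 'v \<Rightarrow> ('v \<Rightarrow> complex) \<Rightarrow> complex" where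
  "kappa V x = (\<lambda>\<phi>. if \<phi> \<in> pts (dual V) then \<phi> x else 0)"

section \<open>Bounded holomorphic mappings\<close>

text \<open>Holomorphic means complex Frechet differentiable at every point of the (open) domain.\<close>

definition holomorphic_into ::
  "'e::complex_normed_vector set \<Rightarrow> 'v cnspace \<Rightarrow> ('e \<Rightarrow> 'v) \<Rightarrow> bool" where
  "holomorphic_into U V g \<longleftrightarrow>
     (\<forall>x\<in>U. g x \<in> pts V) \<and>
     (\<forall>x\<in>U. \<exists>D. (\<forall>h. D h \<in> pts V) \<and>
        (\<forall>h k. D (h + k) = vadd V (D h) (D k)) \<and>
        (\<forall>c h. D (c *\<^sub>C h) = vscale V c (D h)) \<and>
        (\<exists>C. \<forall>h. vnorm V (D h) \<le> C * norm h) \<and>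
        (\<forall>\<epsilon>>0. \<exists>\<delta>>0. \<forall>y\<in>U. norm (y - x) < \<delta> \<longrightarrow>
           vnorm V (vsub V (vsub V (g y) (g x)) (D (y - x))) \<le> \<epsilon> * norm (y - x)))"

definition Hinf :: "'e::complex_normed_vector set \<Rightarrow> 'v cnspace \<Rightarrow> ('e \<Rightarrow> 'v) set" where
  "Hinf U V = {g. holomorphic_into U V g \<and> (\<exists>M. \<forall>x\<in>U. vnorm V (g x) \<le> M)}"

text \<open>Inserting \<open>0\<close> only matters for \<open>U = {}\<close>, since \<open>Sup {}\<close> is unspecified on the reals.\<close>

definition sup_norm :: "'e set \<Rightarrow> 'v cnspace \<Rightarrow> ('e \<Rightarrow> 'v) \<Rightarrow> real" where
  "sup_norm U V g = Sup (insert 0 ((\<lambda>x. vnorm V (g x)) ` U))"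

text \<open>
  On \<open>tspace\<close>, the elements of the dual and the holomorphic mappings are those given by the
  library's \<open>bounded_linear\<close> and \<open>has_derivative\<close>, together with complex homogeneity.
\<close>

lemma pts_dual_tspace:
  "pts (dual (tspace :: 'a::complex_normed_vector cnspace)) =
     {\<phi>. bounded_linear \<phi> \<and> (\<forall>c x. \<phi> (c *\<^sub>C x) = c * \<phi> x)}"
proof -
  have "bounded_linear \<phi>" if "\<forall>x y. \<phi> (x + y) = \<phi> x + \<phi> y" "\<forall>c x. \<phi> (c *\<^sub>C x) = c * \<phi> x"
    "\<forall>x. cmod (\<phi> x) \<le> C * norm x" for \<phi> :: "'a \<Rightarrow> complex" and C
    using that by (intro bounded_linear_intro[where K = C])
      (auto simp: scaleR_scaleC scaleR_conv_of_real mult.commute)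
  moreover have "\<exists>C. \<forall>x. cmod (\<phi> x) \<le> C * norm x" if "bounded_linear \<phi>"
    for \<phi> :: "'a \<Rightarrow> complex"
    using bounded_linear.bounded[OF that] by (metis mult.commute)
  ultimately show ?thesis
    by (auto simp: dual_def tspace_def bounded_linear.linear linear_add)
qed

lemma holomorphic_into_tspace:
  fixes f :: "'e::complex_normed_vector \<Rightarrow> 'f::complex_normed_vector"
  assumes "open U"
  shows "holomorphic_into U tspace f \<longleftrightarrow>
    (\<forall>x\<in>U. \<exists>D. (f has_derivative D) (at x) \<and> (\<forall>c h. D (c *\<^sub>C h) = c *\<^sub>C D h))"
proof -
  have m1: "(-1) *\<^sub>C v = - v" for v :: 'f
    using scaleR_scaleC[of "-1" v] by simp
  have bl: "bounded_linear D \<longleftrightarrow> (\<forall>h k. D (h + k) = D h + D k) \<and>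
      (\<exists>C. \<forall>h. norm (D h) \<le> C * norm h)"
    if "\<forall>c h. D (c *\<^sub>C h) = c *\<^sub>C D h" for D :: "'e \<Rightarrow> 'f"
  proof
    assume b: "bounded_linear D"
    show "(\<forall>h k. D (h + k) = D h + D k) \<and> (\<exists>C. \<forall>h. norm (D h) \<le> C * norm h)"
      using bounded_linear.bounded[OF b] b
      by (metis bounded_linear.linear linear_add mult.commute)
  next
    assume "(\<forall>h k. D (h + k) = D h + D k) \<and> (\<exists>C. \<forall>h. norm (D h) \<le> C * norm h)"
    then obtain C where "\<forall>h k. D (h + k) = D h + D k" "\<forall>h. norm (D h) \<le> C * norm h" by blast
    with that show "bounded_linear D"
      by (intro bounded_linear_intro[where K = C]) (auto simp: scaleR_scaleC mult.commute)
  qed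
  have hd: "(f has_derivative D) (at x) \<longleftrightarrow> bounded_linear D \<and>
      (\<forall>\<epsilon>>0. \<exists>\<delta>>0. \<forall>y\<in>U. norm (y - x) < \<delta> \<longrightarrow>
         norm (f y - f x - D (y - x)) \<le> \<epsilon> * norm (y - x))" if "x \<in> U" for x D
    using at_within_open[OF that assms] has_derivative_within_alt[of f D x U] by simp
  let ?R = "\<lambda>D x. \<forall>\<epsilon>>0. \<exists>\<delta>>0. \<forall>y\<in>U. norm (y - x) < \<delta> \<longrightarrow>
         norm (f y - f x - D (y - x)) \<le> \<epsilon> * norm (y - x)"
  have "holomorphic_into U tspace f \<longleftrightarrow>
    (\<forall>x\<in>U. \<exists>D. (\<forall>h k. D (h + k) = D h + D k) \<and> (\<forall>c h. D (c *\<^sub>C h) = c *\<^sub>C D h) \<and>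
       (\<exists>C. \<forall>h. norm (D h) \<le> C * norm h) \<and> ?R D x)"
    by (simp add: holomorphic_into_def vsub_def tspace_def m1)
  also have "\<dots> \<longleftrightarrow> (\<forall>x\<in>U. \<exists>D. (f has_derivative D) (at x) \<and>
      (\<forall>c h. D (c *\<^sub>C h) = c *\<^sub>C D h))"
    by (intro ball_cong refl ex_cong1) (use hd bl in blast)
  finally show ?thesis .
qed

section \<open>Weak* topology, continuous functions and regular Borel measures\<close>

text \<open>The weak* topology on the dual of \<open>V\<close>.\<close>

definition weak_star :: "'v cnspace \<Rightarrow> ('v \<Rightarrow> complex) topology" where
  "weak_star V = topology_generated_by
     {{\<phi> \<in> pts (dual V). \<phi> x \<in> W} | x W. x \<in> pts V \<and> open W}"

definition ball_wstar :: "'v cnspace \<Rightarrow> ('v \<Rightarrow> complex) topology" where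
  "ball_wstar V = subtopology (weak_star V) (unit_ball (dual V))"

definition C_space :: "'k topology \<Rightarrow> ('k \<Rightarrow> complex) cnspace" where
  "C_space T =
     \<lparr>pts = {h. continuous_map T euclidean h \<and> (\<forall>t. t \<notin> topspace T \<longrightarrow> h t = 0)},
      vadd = (\<lambda>h k t. h t + k t),
      vscale = (\<lambda>c h t. c * h t),
      vnorm = (\<lambda>h. SUP t\<in>topspace T. cmod (h t))\<rparr>"

text \<open>The embedding of \<open>V\<close> into the continuous functions on the dual unit ball.\<close>

definition iota :: "'v cnspace \<Rightarrow> 'v \<Rightarrow> ('v \<Rightarrow> complex) \<Rightarrow> complex" where
  "iota V x = (\<lambda>\<phi>. if \<phi> \<in> unit_ball (dual V) then \<phi> x else 0)"

definition regular_borel_prob :: "'k topology \<Rightarrow> 'k measure \<Rightarrow> bool" where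
  "regular_borel_prob T \<mu> \<longleftrightarrow>
     prob_space \<mu> \<and> space \<mu> = topspace T \<and>
     sets \<mu> = sigma_sets (topspace T) {W. openin T W} \<and>
     (\<forall>A\<in>sets \<mu>.
        emeasure \<mu> A = (INF W\<in>{W. openin T W \<and> A \<subseteq> W}. emeasure \<mu> W) \<and>
        emeasure \<mu> A = (SUP K\<in>{K. K \<in> sets \<mu> \<and> compactin T K \<and> K \<subseteq> A}. emeasure \<mu> K))"

section \<open>Lebesgue spaces\<close>

text \<open>
  The points are equivalence classes modulo equality almost everywhere; the operations are
  computed on chosen representatives, on which they do not depend.
\<close>

definition ae_class :: "'k measure \<Rightarrow> ('k \<Rightarrow> complex) \<Rightarrow> ('k \<Rightarrow> complex) set" where
  "ae_class \<mu> h = {k \<in> borel_measurable \<mu>. AE t in \<mu>. k t = h t}"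

definition ae_rep :: "('k \<Rightarrow> complex) set \<Rightarrow> 'k \<Rightarrow> complex" where
  "ae_rep A = (SOME h. h \<in> A)"

definition Lq_space :: "real \<Rightarrow> 'k measure \<Rightarrow> ('k \<Rightarrow> complex) set cnspace" where
  "Lq_space q \<mu> =
     \<lparr>pts = ae_class \<mu> ` {h \<in> borel_measurable \<mu>. integrable \<mu> (\<lambda>t. cmod (h t) powr q)},
      vadd = (\<lambda>A B. ae_class \<mu> (\<lambda>t. ae_rep A t + ae_rep B t)),
      vscale = (\<lambda>c A. ae_class \<mu> (\<lambda>t. c * ae_rep A t)),
      vnorm = (\<lambda>A. (\<integral>t. cmod (ae_rep A t) powr q \<partial>\<mu>) powr (1 / q))\<rparr>"

text \<open>The canonical map from the continuous functions to \<open>L\<^sub>q(\<mu>)\<close> is \<open>ae_class \<mu>\<close>.\<close>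

section \<open>Cohen strongly summing holomorphic mappings\<close>

definition conj_index :: "ereal \<Rightarrow> real" where
  "conj_index p = (if p = \<infinity> then 1 else real_of_ereal p / (real_of_ereal p - 1))"

definition lp_norm :: "ereal \<Rightarrow> nat \<Rightarrow> (nat \<Rightarrow> complex) \<Rightarrow> real" where
  "lp_norm p n \<alpha> =
     (if p = \<infinity> then Max ((\<lambda>i. cmod (\<alpha> i)) ` {1..n})
      else (\<Sum>i=1..n. cmod (\<alpha> i) powr real_of_ereal p) powr (1 / real_of_ereal p))"

abbreviation Fstar :: "('f::complex_banach \<Rightarrow> complex) cnspace" where
  "Fstar \<equiv> dual tspace"

definition cohen_const ::
  "ereal \<Rightarrow> 'e::complex_banach set \<Rightarrow> ('e \<Rightarrow> 'f::complex_banach) \<Rightarrow> real \<Rightarrow> bool" where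
  "cohen_const p U f C \<longleftrightarrow>
     C \<ge> 0 \<and>
     (\<forall>n\<ge>1. \<forall>\<alpha> x y. (\<forall>i\<in>{1..n}. x i \<in> U \<and> y i \<in> pts Fstar) \<longrightarrow>
        (\<Sum>i=1..n. cmod (\<alpha> i) * cmod (y i (f (x i))))
          \<le> C * lp_norm p n \<alpha> *
            (SUP \<Phi>\<in>unit_ball (dual Fstar).
               (\<Sum>i=1..n. cmod (\<Phi> (y i)) powr conj_index p) powr (1 / conj_index p)))"

definition cohen_summing ::
  "ereal \<Rightarrow> 'e::complex_banach set \<Rightarrow> ('e \<Rightarrow> 'f::complex_banach) \<Rightarrow> bool" where
  "cohen_summing p U f \<longleftrightarrow> holomorphic_into U tspace f \<and> (\<exists>C. cohen_const p U f C)"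

definition cohen_norm ::
  "ereal \<Rightarrow> 'e::complex_banach set \<Rightarrow> ('e \<Rightarrow> 'f::complex_banach) \<Rightarrow> real" where
  "cohen_norm p U f = Inf {C. cohen_const p U f C}"

text \<open>
  The factorization of \<open>f\<close> through the dual of a closed subspace \<open>S\<close> of the \<open>L\<close>-space of
  \<open>\<mu>\<close> over the bidual unit ball. The condition \<open>ae_class \<mu> ` iota Fstar ` pts Fstar \<subseteq> S\<close>
  is the one under which the adjoint \<open>(j)\<^sup>*\<close> is defined on the dual of \<open>S\<close>.
\<close>

definition cohen_factorization ::
  "ereal \<Rightarrow> 'e::complex_banach set \<Rightarrow> ('e \<Rightarrow> 'f::complex_banach) \<Rightarrow>
   (('f \<Rightarrow> complex) \<Rightarrow> complex) measure \<Rightarrow>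
   ((('f \<Rightarrow> complex) \<Rightarrow> complex) \<Rightarrow> complex) set set \<Rightarrow>
   ('e \<Rightarrow> ((('f \<Rightarrow> complex) \<Rightarrow> complex) \<Rightarrow> complex) set \<Rightarrow> complex) \<Rightarrow> bool" where
  "cohen_factorization p U f \<mu> S g \<longleftrightarrow>
     regular_borel_prob (ball_wstar Fstar) \<mu> \<and>
     closed_subspace S (Lq_space (conj_index p) \<mu>) \<and>
     ae_class \<mu> ` iota Fstar ` pts Fstar \<subseteq> S \<and>
     g \<in> Hinf U (dual (subspace_on (Lq_space (conj_index p) \<mu>) S)) \<and>
     (\<forall>x\<in>U. kappa tspace (f x) =
        adjoint_op Fstar (iota Fstar)
          (adjoint_op (subspace_on (C_space (ball_wstar Fstar)) (iota Fstar ` pts Fstar))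
             (ae_class \<mu>) (g x)))"

end

theory Submission
  imports Defs "HOL-Complex_Analysis.Complex_Analysis"
begin

text \<open>
Write \<open>q\<close> for the conjugate index of \<open>p\<close>, and let \<open>K\<close> be the unit ball of the bidual of \<open>F\<close> with the
weak* topology, which is compact and Hausdorff. Everything turns on a domination property of a
regular Borel probability \<open>\<mu>\<close> on \<open>K\<close> with constant \<open>C\<close>: for all \<open>x\<close> in \<open>U\<close> and \<open>y\<close> in the dual of \<open>F\<close>,
the modulus of \<open>y (f x)\<close> is at most \<open>C\<close> times the \<open>L\<^sub>q(\<mu>)\<close>-norm of \<open>\<iota> y\<close>, the evaluation of
bidual elements at \<open>y\<close>.

A factorization gives it with \<open>C = \<parallel>g\<parallel>\<close>, because \<open>y (f x)\<close> is the value of the functional \<open>g x\<close> at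
the class of \<open>\<iota> y\<close>. Hoelder's inequality for finite sums then turns it into the Cohen inequality with
the same constant (\<open>factorization_imp_cohen_const\<close>).

Conversely, suppose the Cohen inequality holds with constant \<open>C\<close>. Choosing the scalars for equality
in Hoelder's inequality shows that every finite sum of functions
\<open>\<lambda>\<Phi>. C powr q * cmod (\<Phi> y) powr q - cmod (y (f x)) powr q\<close> has a nonnegative supremum on \<open>K\<close>. These
sums form a convex cone, and a convex cone of bounded functions with nonnegative suprema admits a
normalised positive functional that is nonnegative on it: enlarge the cone by Zorn's lemma to a
maximal one, and read the functional off as a Dedekind cut (\<open>positive_functional_on_cone\<close>). The
functional is defined on all bounded functions, so its values on indicators form a finitely additive
probability \<open>\<nu>\<close> on all subsets of \<open>K\<close>. Compactness and the Caratheodory construction produce a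
regular Borel probability \<open>\<mu>\<close> with \<open>\<nu> A \<le> \<mu> A\<close> for closed \<open>A\<close>, and slicing a nonnegative continuous
function into closed level sets shows that the functional is at most the integral against \<open>\<mu>\<close>
(\<open>positive_functional_le_integral\<close>). This one inequality yields the domination property
(\<open>Pietsch_domination\<close>).

Now take for \<open>S\<close> the closure of the image of the dual of \<open>F\<close> in \<open>L\<^sub>q(\<mu>)\<close>. By domination, evaluation at
\<open>f x\<close> is bounded by \<open>C\<close> for the \<open>L\<^sub>q(\<mu>)\<close>-norm, so it extends uniquely to \<open>S\<close>; the extension is \<open>g x\<close>,
and \<open>\<parallel>g\<parallel> \<le> C\<close>. The mapping \<open>g\<close> is holomorphic although the \<open>L\<^sub>q(\<mu>)\<close>-norm is weaker than the norm of
the dual of \<open>F\<close>: along every complex line in \<open>U\<close> the scalar function \<open>y \<circ> f\<close> is bounded by \<open>C\<close> times the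
\<open>L\<^sub>q(\<mu>)\<close>-norm of \<open>\<iota> y\<close>, so Cauchy's estimates bound its derivative and its second order remainder by
multiples of that same norm, with constants independent of \<open>y\<close> (\<open>weak_cauchy_estimates\<close>). The infimum
that defines the Cohen norm is attained, so \<open>C\<close> can be the Cohen norm itself, and the first
implication gives the reverse inequality between the norms.
\<close>

section \<open>Positive functionals from convex cones of bounded functions\<close>

definition bounded_fun_on :: "'k set \<Rightarrow> ('k \<Rightarrow> real) \<Rightarrow> bool" where
  "bounded_fun_on K h \<longleftrightarrow> (\<exists>M. \<forall>t\<in>K. \<bar>h t\<bar> \<le> M)"

lemma bounded_fun_onI: "(\<And>t. t \<in> K \<Longrightarrow> \<bar>h t\<bar> \<le> M) \<Longrightarrow> bounded_fun_on K h"
  by (auto simp: bounded_fun_on_def)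

lemma bounded_fun_on_const [simp]: "bounded_fun_on K (\<lambda>_. c)"
  by (auto simp: bounded_fun_on_def)

lemma bounded_fun_on_add:
  assumes "bounded_fun_on K h" "bounded_fun_on K k"
  shows "bounded_fun_on K (\<lambda>t. h t + k t)"
proof -
  obtain M N where "\<forall>t\<in>K. \<bar>h t\<bar> \<le> M" "\<forall>t\<in>K. \<bar>k t\<bar> \<le> N"
    using assms by (auto simp: bounded_fun_on_def)
  then show ?thesis by (intro bounded_fun_onI[where M = "M + N"]) force
qed

lemma bounded_fun_on_cmult:
  assumes "bounded_fun_on K h" shows "bounded_fun_on K (\<lambda>t. c * h t)"
proof -
  obtain M where "\<forall>t\<in>K. \<bar>h t\<bar> \<le> M"
    using assms by (auto simp: bounded_fun_on_def)
  then show ?thesis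
    by (intro bounded_fun_onI[where M = "\<bar>c\<bar> * M"]) (simp add: abs_mult mult_left_mono)
qed

lemma bounded_fun_on_minus_const:
  assumes "bounded_fun_on K h" shows "bounded_fun_on K (\<lambda>t. h t - c)"
  using bounded_fun_on_add[OF assms bounded_fun_on_const[of K "-c"]] by simp

lemma bounded_fun_on_sum:
  assumes "\<And>i. i \<in> I \<Longrightarrow> bounded_fun_on K (h i)"
  shows "bounded_fun_on K (\<lambda>t. \<Sum>i\<in>I. h i t)"
  using assms by (induction I rule: infinite_finite_induct) (auto intro: bounded_fun_on_add)

text \<open>
The condition on suprema is written with \<open>e\<close> to avoid suprema of possibly empty sets; it
entails that \<open>K\<close> is nonempty, since the zero function belongs to the cone.
\<close>
definition sup_nonneg_cone :: "'k set \<Rightarrow> ('k \<Rightarrow> real) set \<Rightarrow> bool" where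
  "sup_nonneg_cone K Q \<longleftrightarrow>
     (\<lambda>_. 0) \<in> Q \<and> (\<forall>h\<in>Q. bounded_fun_on K h) \<and>
     (\<forall>h\<in>Q. \<forall>k\<in>Q. (\<lambda>t. h t + k t) \<in> Q) \<and> (\<forall>c>0. \<forall>h\<in>Q. (\<lambda>t. c * h t) \<in> Q) \<and>
     (\<forall>h\<in>Q. \<forall>e>0. \<exists>t\<in>K. - e < h t)"

lemma sup_nonneg_coneD:
  assumes "sup_nonneg_cone K Q"
  shows "(\<lambda>_. 0) \<in> Q" "h \<in> Q \<Longrightarrow> bounded_fun_on K h"
    "h \<in> Q \<Longrightarrow> k \<in> Q \<Longrightarrow> (\<lambda>t. h t + k t) \<in> Q"
    "0 < c \<Longrightarrow> h \<in> Q \<Longrightarrow> (\<lambda>t. c * h t) \<in> Q"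
    "h \<in> Q \<Longrightarrow> 0 < e \<Longrightarrow> \<exists>t\<in>K. - e < h t"
  using assms unfolding sup_nonneg_cone_def by blast+

lemma maximal_sup_nonneg_cone:
  assumes "sup_nonneg_cone K Q0"
  obtains Q where "sup_nonneg_cone K Q" "Q0 \<subseteq> Q"
    "\<And>Q'. sup_nonneg_cone K Q' \<Longrightarrow> Q \<subseteq> Q' \<Longrightarrow> Q' = Q"
proof -
  let ?A = "{Q. sup_nonneg_cone K Q \<and> Q0 \<subseteq> Q}"
  have "\<exists>M\<in>?A. \<forall>X\<in>?A. M \<subseteq> X \<longrightarrow> X = M"
  proof (rule subset_Zorn_nonempty)
    show "?A \<noteq> {}" using assms by blast
    fix C assume "C \<noteq> {}" and ch: "subset.chain ?A C"
    then have C: "\<And>Q. Q \<in> C \<Longrightarrow> sup_nonneg_cone K Q" "\<And>Q. Q \<in> C \<Longrightarrow> Q0 \<subseteq> Q"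
      by (auto simp: subset.chain_def)
    have lin: "P \<subseteq> Q \<or> Q \<subseteq> P" if "P \<in> C" "Q \<in> C" for P Q
      using ch that unfolding subset_chain_def by blast
    have add: "(\<lambda>t. h t + k t) \<in> \<Union>C" if "h \<in> P" "P \<in> C" "k \<in> Q" "Q \<in> C" for h k P Q
    proof (cases "P \<subseteq> Q")
      case True
      then show ?thesis using sup_nonneg_coneD(3)[OF C(1)[OF that(4)], of h k] that by blast
    next
      case False
      then have "Q \<subseteq> P" using lin[OF that(2,4)] by blast
      then show ?thesis using sup_nonneg_coneD(3)[OF C(1)[OF that(2)], of h k] that by blast
    qed
    obtain P where P: "P \<in> C" using \<open>C \<noteq> {}\<close> by blast
    have "sup_nonneg_cone K (\<Union>C)"
      unfolding sup_nonneg_cone_def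
    proof (intro conjI ballI allI impI)
      show "(\<lambda>_. 0) \<in> \<Union>C" using P sup_nonneg_coneD(1)[OF C(1)] by blast
      show "bounded_fun_on K h" if "h \<in> \<Union>C" for h
        using that sup_nonneg_coneD(2)[OF C(1)] by blast
      show "(\<lambda>t. h t + k t) \<in> \<Union>C" if "h \<in> \<Union>C" "k \<in> \<Union>C" for h k
        using that add by blast
      show "(\<lambda>t. c * h t) \<in> \<Union>C" if "0 < c" "h \<in> \<Union>C" for c h
        using that sup_nonneg_coneD(4)[OF C(1)] by blast
      show "\<exists>t\<in>K. - e < h t" if "h \<in> \<Union>C" "0 < e" for h e
        using that sup_nonneg_coneD(5)[OF C(1)] by blast
    qed
    then show "\<Union>C \<in> ?A" using P C(2) by blast
  qed
  then obtain M where "sup_nonneg_cone K M" "Q0 \<subseteq> M"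
    "\<And>X. sup_nonneg_cone K X \<and> Q0 \<subseteq> X \<Longrightarrow> M \<subseteq> X \<Longrightarrow> X = M" by auto
  then show ?thesis by (intro that[of M]) auto
qed

text \<open>
The cone generated by \<open>Q\<close>, the function \<open>h\<close> and the functions that are nonnegative on \<open>K\<close>
still has nonnegative suprema: for a combination with a positive multiple of \<open>h\<close> divide by that
multiple and use \<open>compat\<close>. By maximality it is \<open>Q\<close> itself. The case \<open>h = 0\<close> says that \<open>Q\<close> is upward
closed.
\<close>
lemma maximal_cone_upward_closed:
  assumes Q: "sup_nonneg_cone K Q"
    and max: "\<And>Q'. sup_nonneg_cone K Q' \<Longrightarrow> Q \<subseteq> Q' \<Longrightarrow> Q' = Q"
    and h: "bounded_fun_on K h"
    and compat: "\<And>u e. u \<in> Q \<Longrightarrow> 0 < e \<Longrightarrow> \<exists>t\<in>K. - e < u t + h t"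
    and k: "bounded_fun_on K k" "u \<in> Q" "0 \<le> s" "\<And>t. t \<in> K \<Longrightarrow> u t + s * h t \<le> k t"
  shows "k \<in> Q"
proof -
  note D = sup_nonneg_coneD[OF Q]
  define Q' where "Q' = {k. bounded_fun_on K k \<and> (\<exists>u\<in>Q. \<exists>s\<ge>0. \<forall>t\<in>K. u t + s * h t \<le> k t)}"
  have sub: "Q \<subseteq> Q'"
  proof
    fix u assume "u \<in> Q"
    then show "u \<in> Q'" unfolding Q'_def using D(2) by (auto intro!: bexI[of _ u] exI[of _ 0])
  qed
  have "sup_nonneg_cone K Q'"
    unfolding sup_nonneg_cone_def
  proof (intro conjI ballI allI impI)
    show "(\<lambda>_. 0) \<in> Q'" using sub D(1) by blast
    show "bounded_fun_on K k" if "k \<in> Q'" for k using that by (simp add: Q'_def)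
    show "(\<lambda>t. k t + l t) \<in> Q'" if kl: "k \<in> Q'" "l \<in> Q'" for k l
    proof -
      from kl obtain u v r s where *: "u \<in> Q" "v \<in> Q" "0 \<le> r" "0 \<le> s"
        "\<forall>t\<in>K. u t + r * h t \<le> k t" "\<forall>t\<in>K. v t + s * h t \<le> l t"
        by (auto simp: Q'_def)
      have "\<forall>t\<in>K. (u t + v t) + (r + s) * h t \<le> k t + l t"
        using *(5,6) by (fastforce simp: algebra_simps)
      then show ?thesis
        using kl *(1-4) D(3)[OF *(1,2)] bounded_fun_on_add unfolding Q'_def
        by (auto intro!: bexI[of _ "\<lambda>t. u t + v t"] exI[of _ "r + s"])
    qed
    show "(\<lambda>t. c * k t) \<in> Q'" if "0 < c" "k \<in> Q'" for c k
    proof -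
      from that obtain u r where *: "u \<in> Q" "0 \<le> r" "\<forall>t\<in>K. u t + r * h t \<le> k t"
        by (auto simp: Q'_def)
      have "\<forall>t\<in>K. c * u t + (c * r) * h t \<le> c * k t"
      proof
        fix t assume "t \<in> K"
        then have "c * (u t + r * h t) \<le> c * k t" using * that by (intro mult_left_mono) auto
        then show "c * u t + (c * r) * h t \<le> c * k t" by (simp add: algebra_simps)
      qed
      then show ?thesis
        using that * D(4)[OF that(1) *(1)] bounded_fun_on_cmult unfolding Q'_def
        by (auto intro!: bexI[of _ "\<lambda>t. c * u t"] exI[of _ "c * r"])
    qed
    show "\<exists>t\<in>K. - e < k t" if "k \<in> Q'" and e: "0 < e" for k e
    proof -
      from that obtain u r where *: "u \<in> Q" "0 \<le> r" "\<forall>t\<in>K. u t + r * h t \<le> k t"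
        by (auto simp: Q'_def)
      show ?thesis
      proof (cases "r = 0")
        case True
        then show ?thesis using * D(5)[OF *(1) that(2)] by force
      next
        case False
        with * have r: "0 < r" by simp
        obtain t where t: "t \<in> K" "- (e / r) < inverse r * u t + h t"
          using compat[OF D(4)[OF _ *(1), of "inverse r"], of "e / r"] positive_imp_inverse_positive[OF r]
            divide_pos_pos[OF e r] by blast
        then have "r * (- (e / r)) < r * (inverse r * u t + h t)"
          using r by (intro mult_strict_left_mono) auto
        then have "- e < u t + r * h t" using r by (simp add: distrib_left mult.assoc[symmetric])
        then show ?thesis using * t by force
      qed
    qed
  qed
  then have "Q' = Q" using max sub by blast
  moreover have "k \<in> Q'" using k by (auto simp: Q'_def)
  ultimately show ?thesis by simp
qed

text \<open>
For a maximal cone \<open>Q\<close>, every bounded function \<open>h\<close> lies in \<open>Q\<close> or has \<open>- h - e\<close> in \<open>Q\<close> for some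
\<open>e > 0\<close>. Hence \<open>{c. h - c \<in> Q}\<close> is the lower part of a Dedekind cut of the reals, and its supremum
\<open>L h\<close> is superadditive because \<open>Q\<close> is closed under sums, and subadditive by the dichotomy.
\<close>
theorem positive_functional_on_cone:
  fixes K :: "'k set"
  assumes Q0: "sup_nonneg_cone K Q0"
  obtains L :: "('k \<Rightarrow> real) \<Rightarrow> real" where
    "\<And>h k. bounded_fun_on K h \<Longrightarrow> bounded_fun_on K k \<Longrightarrow> L (\<lambda>t. h t + k t) = L h + L k"
    "\<And>c h. 0 \<le> c \<Longrightarrow> bounded_fun_on K h \<Longrightarrow> L (\<lambda>t. c * h t) = c * L h"
    "\<And>h k. bounded_fun_on K h \<Longrightarrow> bounded_fun_on K k \<Longrightarrow> (\<And>t. t \<in> K \<Longrightarrow> h t \<le> k t) \<Longrightarrow> L h \<le> L k"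
    "L (\<lambda>_. 1) = 1"
    "\<And>h. h \<in> Q0 \<Longrightarrow> 0 \<le> L h"
proof -
  obtain Q where Q: "sup_nonneg_cone K Q" and sub: "Q0 \<subseteq> Q"
    and max: "\<And>Q'. sup_nonneg_cone K Q' \<Longrightarrow> Q \<subseteq> Q' \<Longrightarrow> Q' = Q"
    using maximal_sup_nonneg_cone[OF Q0] by blast
  note D = sup_nonneg_coneD[OF Q]
  have up: "k \<in> Q" if "u \<in> Q" "bounded_fun_on K k" "\<And>t. t \<in> K \<Longrightarrow> u t \<le> k t" for u k
    using that D(5) by (intro maximal_cone_upward_closed[OF Q max, of "\<lambda>_. 0" k u 0]) auto
  have dich: "\<exists>e>0. (\<lambda>t. - h t - e) \<in> Q" if h: "bounded_fun_on K h" "h \<notin> Q" for h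
  proof -
    have "\<exists>u\<in>Q. \<exists>e>0. \<forall>t\<in>K. u t + h t \<le> - e"
    proof (rule ccontr)
      assume "\<not> ?thesis"
      then have "\<exists>t\<in>K. - e < u t + h t" if "u \<in> Q" "0 < e" for u e
        using that by (meson not_less)
      then have "h \<in> Q"
        using h D(1) by (intro maximal_cone_upward_closed[OF Q max h(1), of h "\<lambda>_. 0" 1]) auto
      with h show False by simp
    qed
    then obtain u e where "u \<in> Q" "0 < e" and *: "\<And>t. t \<in> K \<Longrightarrow> u t + h t \<le> - e" by blast
    have "bounded_fun_on K (\<lambda>t. - h t - e)"
      using bounded_fun_on_minus_const[OF bounded_fun_on_cmult[OF h(1), of "-1"], of e] by simp
    moreover have "u t \<le> - h t - e" if "t \<in> K" for t using *[OF that] by simp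
    ultimately have "(\<lambda>t. - h t - e) \<in> Q" by (rule up[OF \<open>u \<in> Q\<close>])
    with \<open>0 < e\<close> show ?thesis by blast
  qed
  have neg: "(\<lambda>_. - e) \<notin> Q" if "0 < e" for e
    using D(5)[of "\<lambda>_. - e" e] that by auto
  define L where "L h = Sup {c. (\<lambda>t. h t - c) \<in> Q}" for h
  have bdd: "bdd_above {c. (\<lambda>t. h t - c) \<in> Q}" and ne: "{c. (\<lambda>t. h t - c) \<in> Q} \<noteq> {}"
    if h: "bounded_fun_on K h" for h
  proof -
    obtain M where M: "\<forall>t\<in>K. \<bar>h t\<bar> \<le> M" using h by (auto simp: bounded_fun_on_def)
    have "c \<le> M + 1" if "(\<lambda>t. h t - c) \<in> Q" for c
      using D(5)[OF that, of 1] M by force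
    then show "bdd_above {c. (\<lambda>t. h t - c) \<in> Q}" by (auto simp: bdd_above_def)
    have "(\<lambda>t. h t - (- M)) \<in> Q"
      by (rule up[OF D(1) bounded_fun_on_minus_const[OF h]]) (use M in force)
    then show "{c. (\<lambda>t. h t - c) \<in> Q} \<noteq> {}" by blast
  qed
  have L_ge: "c \<le> L h" if "bounded_fun_on K h" "(\<lambda>t. h t - c) \<in> Q" for c h
    unfolding L_def using bdd that by (intro cSup_upper) auto
  have L_mem: "(\<lambda>t. h t - c) \<in> Q" if h: "bounded_fun_on K h" and c: "c < L h" for c h
  proof -
    obtain d where "c < d" "(\<lambda>t. h t - d) \<in> Q"
      using less_cSup_iff[OF ne[OF h] bdd[OF h], of c] c unfolding L_def by blast
    then show ?thesis
      using up[of "\<lambda>t. h t - d" "\<lambda>t. h t - c"] bounded_fun_on_minus_const[OF h] by simp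
  qed
  have mono: "L h \<le> L k" if "bounded_fun_on K h" "bounded_fun_on K k" "\<And>t. t \<in> K \<Longrightarrow> h t \<le> k t"
    for h k
  proof (rule dense_le)
    fix c assume "c < L h"
    then show "c \<le> L k"
      using that up[OF L_mem[OF that(1), of c], of "\<lambda>t. k t - c"] bounded_fun_on_minus_const[OF that(2)]
      by (intro L_ge) auto
  qed
  have super: "L h + L k \<le> L (\<lambda>t. h t + k t)"
    if hk: "bounded_fun_on K h" "bounded_fun_on K k" for h k
  proof -
    have *: "c + d \<le> L (\<lambda>t. h t + k t)" if "c < L h" "d < L k" for c d
      using D(3)[OF L_mem[OF hk(1) that(1)] L_mem[OF hk(2) that(2)]]
      by (intro L_ge bounded_fun_on_add hk) (simp add: algebra_simps)
    have "c \<le> L (\<lambda>t. h t + k t) - L k" if "c < L h" for c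
    proof -
      have "L k \<le> L (\<lambda>t. h t + k t) - c"
      proof (rule dense_le)
        show "d \<le> L (\<lambda>t. h t + k t) - c" if "d < L k" for d
          using *[OF \<open>c < L h\<close> that] by simp
      qed
      then show ?thesis by simp
    qed
    then have "L h \<le> L (\<lambda>t. h t + k t) - L k" by (rule dense_le)
    then show ?thesis by simp
  qed
  have L_add: "L (\<lambda>t. h t + k t) = L h + L k"
    if hk: "bounded_fun_on K h" "bounded_fun_on K k" for h k
  proof (rule antisym[OF _ super[OF hk]], rule ccontr)
    assume gt: "\<not> L (\<lambda>t. h t + k t) \<le> L h + L k"
    \<comment> \<open>If additivity fails by \<open>3 * r\<close>, then three members of \<open>Q\<close> add up to a negative constant.\<close>
    define r where "r = (L (\<lambda>t. h t + k t) - L h - L k) / 3"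
    have "3 * r = L (\<lambda>t. h t + k t) - L h - L k" unfolding r_def by simp
    then have r: "0 < r" "L (\<lambda>t. h t + k t) = L h + L k + 3 * r"
      using gt by linarith+
    have "(\<lambda>t. h t - (L h + r)) \<notin> Q" "(\<lambda>t. k t - (L k + r)) \<notin> Q"
      using L_ge hk r by force+
    then obtain a b where ab: "0 < a" "0 < b"
      and *: "(\<lambda>t. - (h t - (L h + r)) - a) \<in> Q" "(\<lambda>t. - (k t - (L k + r)) - b) \<in> Q"
      using dich[OF bounded_fun_on_minus_const[OF hk(1)]] dich[OF bounded_fun_on_minus_const[OF hk(2)]]
      by blast
    have "(\<lambda>t. (h t + k t) - (L h + L k + 2 * r)) \<in> Q"
      using r by (intro L_mem bounded_fun_on_add hk) auto
    from D(3)[OF this D(3)[OF *]] have "(\<lambda>t. - (a + b)) \<in> Q"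
      by (simp add: algebra_simps)
    with neg[of "a + b"] ab show False by simp
  qed
  have hom_le: "c * L h \<le> L (\<lambda>t. c * h t)" if "0 < c" "bounded_fun_on K h" for c h
  proof (rule dense_le)
    fix d assume "d < c * L h"
    then have "d / c < L h" using that by (simp add: field_simps)
    from D(4)[OF that(1) L_mem[OF that(2) this]] show "d \<le> L (\<lambda>t. c * h t)"
      using that by (intro L_ge bounded_fun_on_cmult) (auto simp: right_diff_distrib)
  qed
  have L_hom: "L (\<lambda>t. c * h t) = c * L h" if "0 \<le> c" "bounded_fun_on K h" for c h
  proof (cases "c = 0")
    case True
    then show ?thesis using L_add[of "\<lambda>_. 0" "\<lambda>_. 0"] by simp
  next
    case False
    with that have c: "0 < c" by simp
    have "inverse c * L (\<lambda>t. c * h t) \<le> L (\<lambda>t. inverse c * (c * h t))"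
      using c that by (intro hom_le bounded_fun_on_cmult) auto
    also have "(\<lambda>t. inverse c * (c * h t)) = h" using c by auto
    finally have "L (\<lambda>t. c * h t) \<le> c * L h" using c by (simp add: field_simps)
    with hom_le[OF c that(2)] show ?thesis by simp
  qed
  have "L (\<lambda>_. 1) = 1"
  proof (rule antisym)
    show "1 \<le> L (\<lambda>_. 1)" using L_ge[of "\<lambda>_. 1" 1] D(1) by simp
    show "L (\<lambda>_. 1) \<le> 1"
    proof (rule ccontr)
      assume "\<not> L (\<lambda>_. 1) \<le> 1"
      then obtain c where "1 < c" "c < L (\<lambda>_. 1)" using dense[of 1 "L (\<lambda>_. 1)"] by auto
      then have "(\<lambda>_. 1 - c) \<in> Q" "0 < c - 1" using L_mem[of "\<lambda>_. 1" c] by auto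
      then show False using neg[of "c - 1"] by (metis minus_diff_eq)
    qed
  qed
  moreover have "0 \<le> L h" if "h \<in> Q0" for h
    using sub that D(2) by (intro L_ge) auto
  ultimately show ?thesis using that[of L] L_add L_hom mono by blast
qed

section \<open>Regular measures above finitely additive probabilities\<close>

locale finitely_additive_prob =
  fixes T :: "'k topology" and \<nu> :: "'k set \<Rightarrow> real"
  assumes compact: "compact_space T" and Hausdorff: "Hausdorff_space T"
    and nonneg: "A \<subseteq> topspace T \<Longrightarrow> 0 \<le> \<nu> A"
    and additive: "A \<subseteq> topspace T \<Longrightarrow> B \<subseteq> topspace T \<Longrightarrow> A \<inter> B = {} \<Longrightarrow> \<nu> (A \<union> B) = \<nu> A + \<nu> B"
    and total: "\<nu> (topspace T) = 1"
begin

lemma empty: "\<nu> {} = 0"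
  using additive[of "{}" "{}"] by simp

lemma mono:
  assumes "A \<subseteq> B" "B \<subseteq> topspace T" shows "\<nu> A \<le> \<nu> B"
proof -
  have "\<nu> (A \<union> (B - A)) = \<nu> A + \<nu> (B - A)" using assms by (intro additive) auto
  moreover have "A \<union> (B - A) = B" using assms by blast
  ultimately show ?thesis using nonneg[of "B - A"] assms by force
qed

lemma subadditive:
  assumes "A \<subseteq> topspace T" "B \<subseteq> topspace T" shows "\<nu> (A \<union> B) \<le> \<nu> A + \<nu> B"
proof -
  have "\<nu> (A \<union> (B - A)) = \<nu> A + \<nu> (B - A)" using assms by (intro additive) auto
  then show ?thesis using mono[of "B - A" B] assms by simp
qed

text \<open>
The measure is obtained as for Riesz representation, with closed sets and \<open>\<nu>\<close> in the place of
continuous functions and a functional: open sets are measured from inside by closed sets, arbitrary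
sets from outside by open sets.
\<close>
definition inner_content :: "'k set \<Rightarrow> ennreal" where
  "inner_content W = (SUP A\<in>{A. closedin T A \<and> A \<subseteq> W}. ennreal (\<nu> A))"

definition outer :: "'k set \<Rightarrow> ennreal" where
  "outer E = (INF W\<in>{W. openin T W \<and> E \<subseteq> W}. inner_content W)"

lemma inner_content_upper: "closedin T A \<Longrightarrow> A \<subseteq> W \<Longrightarrow> ennreal (\<nu> A) \<le> inner_content W"
  unfolding inner_content_def by (intro SUP_upper) auto

lemma inner_content_least:
  "(\<And>A. closedin T A \<Longrightarrow> A \<subseteq> W \<Longrightarrow> ennreal (\<nu> A) \<le> c) \<Longrightarrow> inner_content W \<le> c"
  unfolding inner_content_def by (intro SUP_least) auto

lemma inner_content_mono: "V \<subseteq> W \<Longrightarrow> inner_content V \<le> inner_content W"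
  by (intro inner_content_least inner_content_upper) auto

lemma inner_content_empty: "inner_content {} = 0"
proof -
  have "inner_content {} \<le> 0" by (rule inner_content_least) (simp add: empty)
  then show ?thesis by simp
qed

text \<open>
By normality, a closed subset of the union splits into a closed subset of each of the two
open sets.
\<close>
lemma inner_content_Un:
  assumes "openin T V" "openin T W"
  shows "inner_content (V \<union> W) \<le> inner_content V + inner_content W"
proof (rule inner_content_least)
  fix A assume A: "closedin T A" "A \<subseteq> V \<union> W"
  then have AT: "A \<subseteq> topspace T" by (simp add: closedin_subset)
  have "normal_space T"
    using compact Hausdorff compact_Hausdorff_or_regular_imp_normal_space by blast
  moreover have "closedin T (A - V)" "closedin T (A - W)" using A assms by auto
  moreover have "disjnt (A - V) (A - W)" using A by (auto simp: disjnt_def)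
  ultimately obtain G H where GH: "openin T G" "openin T H" "A - V \<subseteq> G" "A - W \<subseteq> H" "disjnt G H"
    unfolding normal_space_def by meson
  have cl: "closedin T (A - G)" "closedin T (A - H)" using A GH by auto
  have "A = (A - G) \<union> (A - H)" using GH by (auto simp: disjnt_def)
  then have "\<nu> A \<le> \<nu> (A - G) + \<nu> (A - H)" using subadditive[of "A - G" "A - H"] AT by auto
  then have "ennreal (\<nu> A) \<le> ennreal (\<nu> (A - G)) + ennreal (\<nu> (A - H))"
    using AT nonneg[of "A - G"] nonneg[of "A - H"]
    by (metis Diff_subset ennreal_leI ennreal_plus subset_trans)
  also have "\<dots> \<le> inner_content V + inner_content W"
    using GH cl by (intro add_mono inner_content_upper) auto
  finally show "ennreal (\<nu> A) \<le> inner_content V + inner_content W" .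
qed

lemma inner_content_finite_UN:
  assumes "finite I" "\<And>i. i \<in> I \<Longrightarrow> openin T (W i)"
  shows "inner_content (\<Union>i\<in>I. W i) \<le> (\<Sum>i\<in>I. inner_content (W i))"
  using assms
proof (induction I rule: finite_induct)
  case empty
  then show ?case by (simp add: inner_content_empty)
next
  case (insert i I)
  have "inner_content (W i \<union> (\<Union>i\<in>I. W i)) \<le> inner_content (W i) + inner_content (\<Union>i\<in>I. W i)"
    using insert by (intro inner_content_Un) auto
  also have "\<dots> \<le> inner_content (W i) + (\<Sum>i\<in>I. inner_content (W i))"
    using insert by (intro add_left_mono) auto
  finally show ?case using insert by simp
qed

text \<open>
A closed subset of the union is compact, so it is covered by finitely many of the sets.
\<close>
lemma inner_content_UN:
  fixes W :: "nat \<Rightarrow> 'k set"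
  assumes W: "\<And>i. openin T (W i)"
  shows "inner_content (\<Union>i. W i) \<le> (\<Sum>i. inner_content (W i))"
proof (rule inner_content_least)
  fix A assume A: "closedin T A" "A \<subseteq> (\<Union>i. W i)"
  have "compactin T A" using A compact closedin_compact_space by blast
  then obtain \<F> where \<F>: "finite \<F>" "\<F> \<subseteq> range W" "A \<subseteq> \<Union>\<F>"
    using A W unfolding compactin_def by (metis (no_types, lifting) imageE)
  then obtain I where I: "finite I" "\<F> = W ` I" by (meson finite_subset_image)
  have "ennreal (\<nu> A) \<le> inner_content (\<Union>i\<in>I. W i)"
    using A \<F> I by (intro inner_content_upper) auto
  also have "\<dots> \<le> (\<Sum>i\<in>I. inner_content (W i))"
    using I W by (intro inner_content_finite_UN) auto
  also have "\<dots> \<le> (\<Sum>i. inner_content (W i))"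
    using I by (intro sum_le_suminf) auto
  finally show "ennreal (\<nu> A) \<le> (\<Sum>i. inner_content (W i))" .
qed

lemma outer_lower: "openin T W \<Longrightarrow> E \<subseteq> W \<Longrightarrow> outer E \<le> inner_content W"
  unfolding outer_def by (intro INF_lower) auto

lemma outer_greatest:
  "(\<And>W. openin T W \<Longrightarrow> E \<subseteq> W \<Longrightarrow> c \<le> inner_content W) \<Longrightarrow> c \<le> outer E"
  unfolding outer_def by (intro INF_greatest) auto

lemma outer_open: "openin T W \<Longrightarrow> outer W = inner_content W"
  by (intro antisym outer_lower outer_greatest inner_content_mono) auto

lemma outer_mono: "D \<subseteq> E \<Longrightarrow> outer D \<le> outer E"
  by (intro outer_greatest outer_lower) auto

lemma outer_top: "outer (topspace T) = 1"
proof -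
  have "inner_content (topspace T) \<le> 1"
  proof (rule inner_content_least)
    fix A assume "closedin T A" "A \<subseteq> topspace T"
    then show "ennreal (\<nu> A) \<le> 1" using mono[of A "topspace T"] total by simp
  qed
  moreover have "1 \<le> inner_content (topspace T)"
    using inner_content_upper[of "topspace T"] total by simp
  ultimately show ?thesis by (simp add: outer_open antisym)
qed

lemma outer_countably_subadditive:
  fixes E :: "nat \<Rightarrow> 'k set"
  assumes "\<And>i. E i \<subseteq> topspace T"
  shows "outer (\<Union>i. E i) \<le> (\<Sum>i. outer (E i))"
proof (rule ennreal_le_epsilon)
  fix e :: real assume e: "0 < e"
  have fin: "outer (E i) < \<top>" for i
    using outer_mono[OF assms[of i]] outer_top by (metis ennreal_one_less_top order_le_less_trans)
  have "\<exists>W. openin T W \<and> E i \<subseteq> W \<and> inner_content W \<le> outer (E i) + e * (1/2) ^ Suc i" for i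
  proof -
    have "outer (E i) < outer (E i) + ennreal (e * (1/2) ^ Suc i)"
      using fin[of i] e
      by (cases "outer (E i)") (auto simp: ennreal_less_iff simp del: power_Suc simp flip: ennreal_plus)
    then show ?thesis
      by (metis (no_types, lifting) not_le less_imp_le outer_greatest)
  qed
  then obtain W where W: "\<And>i. openin T (W i)" "\<And>i. E i \<subseteq> W i"
    "\<And>i. inner_content (W i) \<le> outer (E i) + ennreal (e * (1/2) ^ Suc i)" by metis
  have "outer (\<Union>i. E i) \<le> inner_content (\<Union>i. W i)" using W by (intro outer_lower) auto
  also have "\<dots> \<le> (\<Sum>i. inner_content (W i))" by (intro inner_content_UN W)
  also have "\<dots> \<le> (\<Sum>i. outer (E i) + ennreal (e * (1/2) ^ Suc i))"
    using W by (intro suminf_le) auto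
  also have "\<dots> = (\<Sum>i. outer (E i)) + (\<Sum>i. ennreal e * ennreal ((1/2) ^ Suc i))"
    using e by (subst suminf_add[symmetric]) (auto simp: ennreal_mult simp del: power_Suc)
  also have "\<dots> = (\<Sum>i. outer (E i)) + ennreal e"
    unfolding ennreal_suminf_cmult by (subst suminf_ennreal_eq[OF zero_le_power power_half_series]) auto
  finally show "outer (\<Union>i. E i) \<le> (\<Sum>i. outer (E i)) + ennreal e" .
qed

lemma outer_measure_space: "outer_measure_space (Pow (topspace T)) outer"
  unfolding outer_measure_space_def positive_def increasing_def countably_subadditive_def
  using outer_mono outer_countably_subadditive outer_open[of "{}"]
  by (auto simp: inner_content_empty UN_subset_iff image_subset_iff)

text \<open>
This is Caratheodory's condition for an open set \<open>W\<close>. Inside an open \<open>G\<close> containing \<open>E\<close>, exhaust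
\<open>G \<inter> W\<close> by a closed set \<open>A\<close>, and then the open set \<open>G - A\<close>, which contains \<open>E - W\<close>, by a closed
set \<open>B\<close>; these are disjoint, so \<open>\<nu>\<close> is additive on them.
\<close>
lemma outer_split_open:
  assumes W: "openin T W" and E: "E \<subseteq> topspace T"
  shows "outer (E \<inter> W) + outer (E - W) \<le> outer E"
proof (rule outer_greatest)
  fix G assume G: "openin T G" "E \<subseteq> G"
  have *: "ennreal (\<nu> A) + outer (E - W) \<le> inner_content G"
    if A: "closedin T A" "A \<subseteq> G \<inter> W" for A
  proof -
    have AT: "A \<subseteq> topspace T" using A closedin_subset by blast
    have "ennreal (\<nu> A) + outer (E - W) \<le> ennreal (\<nu> A) + inner_content (G - A)"
      using A G by (intro add_left_mono outer_lower) auto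
    also have "\<dots> = (SUP B\<in>{B. closedin T B \<and> B \<subseteq> G - A}. ennreal (\<nu> A) + ennreal (\<nu> B))"
      unfolding inner_content_def by (subst ennreal_SUP_add_right) auto
    also have "\<dots> \<le> inner_content G"
    proof (intro SUP_least)
      fix B assume "B \<in> {B. closedin T B \<and> B \<subseteq> G - A}"
      then have B: "closedin T B" "B \<subseteq> G - A" by auto
      have BT: "B \<subseteq> topspace T" using B closedin_subset by blast
      have disj: "A \<inter> B = {}" using B by blast
      have "ennreal (\<nu> A) + ennreal (\<nu> B) = ennreal (\<nu> (A \<union> B))"
        using additive[OF AT BT disj] nonneg[OF AT] nonneg[OF BT] by simp
      also have "\<dots> \<le> inner_content G" using A B by (intro inner_content_upper) auto
      finally show "ennreal (\<nu> A) + ennreal (\<nu> B) \<le> inner_content G" .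
    qed
    finally show ?thesis .
  qed
  have "outer (E \<inter> W) + outer (E - W) \<le> inner_content (G \<inter> W) + outer (E - W)"
    using G W by (intro add_right_mono outer_lower) auto
  also have "\<dots> = (SUP A\<in>{A. closedin T A \<and> A \<subseteq> G \<inter> W}. ennreal (\<nu> A) + outer (E - W))"
    unfolding inner_content_def by (subst ennreal_SUP_add_left) auto
  also have "\<dots> \<le> inner_content G" using * by (intro SUP_least) auto
  finally show "outer (E \<inter> W) + outer (E - W) \<le> inner_content G" .
qed

definition \<mu> :: "'k measure" where
  "\<mu> = measure_of (topspace T) {W. openin T W} outer"

lemma space_\<mu> [simp]: "space \<mu> = topspace T"
  unfolding \<mu>_def by (rule space_measure_of) (auto dest: openin_subset)

lemma sets_\<mu>: "sets \<mu> = sigma_sets (topspace T) {W. openin T W}"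
  unfolding \<mu>_def by (rule sets_measure_of) (auto dest: openin_subset)

lemma emeasure_\<mu>:
  assumes "A \<in> sets \<mu>" shows "emeasure \<mu> A = outer A"
proof -
  let ?X = "topspace T" and ?L = "lambda_system (topspace T) (Pow (topspace T)) outer"
  interpret P: sigma_algebra ?X "Pow ?X" by (rule sigma_algebra_Pow)
  have ms: "measure_space ?X ?L outer" by (rule P.caratheodory_lemma[OF outer_measure_space])
  have "{W. openin T W} \<subseteq> ?L"
  proof
    fix W assume "W \<in> {W. openin T W}"
    then have W: "openin T W" by simp
    have "outer (E \<inter> W) + outer (E - W) = outer E" if E: "E \<subseteq> ?X" for E
    proof (rule antisym[OF outer_split_open[OF W E]])
      have "outer E \<le> outer (\<Union>i. (\<lambda>i. if i = 0 then E \<inter> W else if i = 1 then E - W else {}) (i::nat))"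
        by (intro outer_mono) force
      also have "\<dots> \<le> (\<Sum>i::nat. outer (if i = 0 then E \<inter> W else if i = 1 then E - W else {}))"
        using E by (intro outer_countably_subadditive) auto
      also have "\<dots> = (\<Sum>i\<in>{0,1::nat}. outer (if i = 0 then E \<inter> W else if i = 1 then E - W else {}))"
        by (intro suminf_finite) (auto simp: outer_open inner_content_empty)
      also have "\<dots> = outer (E \<inter> W) + outer (E - W)" by simp
      finally show "outer E \<le> outer (E \<inter> W) + outer (E - W)" .
    qed
    then show "W \<in> ?L"
      using openin_subset[OF W] by (simp add: P.lambda_system_eq)
  qed
  moreover have "sigma_algebra ?X ?L" using ms by (simp add: measure_space_def)
  ultimately have sub: "sets \<mu> \<subseteq> ?L"
    unfolding sets_\<mu> by (rule sigma_algebra.sigma_sets_subset[rotated])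
  have "positive (sets \<mu>) outer"
    using outer_open[of "{}"] by (simp add: positive_def inner_content_empty)
  moreover have "countably_additive (sets \<mu>) outer"
    using ms sub unfolding measure_space_def countably_additive_def by (meson subset_trans subsetD)
  ultimately show ?thesis
    using assms by (intro emeasure_measure_of[OF \<mu>_def]) (auto dest: openin_subset)
qed

lemma prob_space_\<mu>: "prob_space \<mu>"
  by (rule prob_spaceI) (use emeasure_\<mu>[OF sets.top] in \<open>simp add: outer_top\<close>)

lemma openin_in_sets_\<mu>: "openin T W \<Longrightarrow> W \<in> sets \<mu>"
  by (simp add: sets_\<mu>)

lemma closedin_in_sets_\<mu>: "closedin T A \<Longrightarrow> A \<in> sets \<mu>"
  using sets.compl_sets[of "topspace T - A" \<mu>] openin_in_sets_\<mu>[of "topspace T - A"]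
  by (simp add: double_diff closedin_def)

lemma outer_regular_\<mu>:
  assumes "A \<in> sets \<mu>"
  shows "emeasure \<mu> A = (INF W\<in>{W. openin T W \<and> A \<subseteq> W}. emeasure \<mu> W)"
proof -
  have "emeasure \<mu> W = inner_content W" if "W \<in> {W. openin T W \<and> A \<subseteq> W}" for W
    using that by (simp add: emeasure_\<mu> openin_in_sets_\<mu> outer_open)
  then show ?thesis using assms by (simp add: emeasure_\<mu> outer_def)
qed

text \<open>
Inner regularity is outer regularity of the complement, since closed sets are compact.
\<close>
lemma inner_regular_\<mu>:
  assumes A: "A \<in> sets \<mu>"
  shows "emeasure \<mu> A = (SUP K\<in>{K. K \<in> sets \<mu> \<and> compactin T K \<and> K \<subseteq> A}. emeasure \<mu> K)"
proof (rule antisym)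
  interpret prob_space \<mu> by (rule prob_space_\<mu>)
  show "(SUP K\<in>{K. K \<in> sets \<mu> \<and> compactin T K \<and> K \<subseteq> A}. emeasure \<mu> K) \<le> emeasure \<mu> A"
    using A by (intro SUP_least emeasure_mono) auto
  show "emeasure \<mu> A \<le> (SUP K\<in>{K. K \<in> sets \<mu> \<and> compactin T K \<and> K \<subseteq> A}. emeasure \<mu> K)"
  proof (rule ennreal_le_epsilon)
    fix e :: real assume e: "0 < e"
    let ?B = "topspace T - A"
    have AT: "A \<subseteq> topspace T" using sets.sets_into_space[OF A] by simp
    have B: "?B \<in> sets \<mu>" using sets.compl_sets[OF A] by simp
    have "emeasure \<mu> ?B < emeasure \<mu> ?B + ennreal e"
      using e by (simp add: emeasure_eq_measure ennreal_less_iff flip: ennreal_plus)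
    then obtain W where W: "openin T W" "?B \<subseteq> W" "emeasure \<mu> W < emeasure \<mu> ?B + ennreal e"
      using INF_less_iff[of "emeasure \<mu>" "{W. openin T W \<and> ?B \<subseteq> W}"] outer_regular_\<mu>[OF B] by auto
    let ?K = "topspace T - W"
    have K: "closedin T ?K" using W by auto
    have "measure \<mu> W < measure \<mu> ?B + e"
      using W(3) e by (simp add: emeasure_eq_measure ennreal_less_iff flip: ennreal_plus)
    moreover have "measure \<mu> ?B = 1 - measure \<mu> A" using prob_compl[OF A] by simp
    moreover have "measure \<mu> ?K = 1 - measure \<mu> W"
      using prob_compl[OF openin_in_sets_\<mu>[OF W(1)]] by simp
    ultimately have "measure \<mu> A \<le> measure \<mu> ?K + e" by linarith
    then have "emeasure \<mu> A \<le> emeasure \<mu> ?K + ennreal e"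
      using e by (simp add: emeasure_eq_measure flip: ennreal_plus)
    also have "\<dots> \<le> (SUP K\<in>{K. K \<in> sets \<mu> \<and> compactin T K \<and> K \<subseteq> A}. emeasure \<mu> K) + ennreal e"
    proof (intro add_right_mono SUP_upper)
      show "?K \<in> {K. K \<in> sets \<mu> \<and> compactin T K \<and> K \<subseteq> A}"
        using K W(2) compact closedin_compact_space[of T ?K] closedin_in_sets_\<mu>[of ?K] by blast
    qed
    finally show "emeasure \<mu> A \<le> \<dots>" .
  qed
qed

lemma regular_\<mu>: "regular_borel_prob T \<mu>"
  unfolding regular_borel_prob_def
  using prob_space_\<mu> space_\<mu> sets_\<mu> outer_regular_\<mu> inner_regular_\<mu> by blast

lemma \<nu>_le_\<mu>:
  assumes "closedin T A" shows "\<nu> A \<le> measure \<mu> A"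
proof -
  interpret prob_space \<mu> by (rule prob_space_\<mu>)
  have "ennreal (\<nu> A) \<le> outer A"
    by (intro outer_greatest inner_content_upper assms)
  also have "\<dots> = ennreal (measure \<mu> A)"
    using emeasure_\<mu>[OF closedin_in_sets_\<mu>[OF assms]] by (simp add: emeasure_eq_measure)
  finally show ?thesis by simp
qed

end

text \<open>
The sum counts the multiples of \<open>d\<close> up to \<open>a\<close>, so it is \<open>a\<close> rounded down to a multiple of \<open>d\<close>.
\<close>
lemma layer_sum_bounds:
  fixes a M :: real
  assumes "0 \<le> a" "a \<le> M" "0 < N" and d_def: "d = M / real N"
  shows "(\<Sum>k=1..N. d * indicator {t. real k * d \<le> t} a) \<le> a"
    and "a \<le> (\<Sum>k=1..N. d * indicator {t. real k * d \<le> t} a) + d"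
proof -
  consider "d = 0" | "0 < d" using assms by (cases "M = 0") (auto simp: d_def)
  then have "(\<Sum>k=1..N. d * indicator {t. real k * d \<le> t} a) \<le> a \<and>
    a \<le> (\<Sum>k=1..N. d * indicator {t. real k * d \<le> t} a) + d"
  proof cases
    case 1
    then have "M = 0" using assms(3) by (simp add: d_def)
    with 1 assms(1,2) show ?thesis by simp
  next
    case 2
    define m where "m = nat \<lfloor>a / d\<rfloor>"
    have m: "real m * d \<le> a" "a \<le> (real m + 1) * d"
    proof -
      have "real m = of_int \<lfloor>a / d\<rfloor>" using 2 assms by (simp add: m_def)
      then have "real m \<le> a / d" "a / d \<le> real m + 1" by linarith+
      then show "real m * d \<le> a" "a \<le> (real m + 1) * d"
        using 2 by (simp_all add: pos_le_divide_eq pos_divide_le_eq)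
    qed
    have iff: "real k * d \<le> a \<longleftrightarrow> k \<le> m" for k
      using 2 assms(1) by (simp add: m_def le_nat_iff le_floor_iff pos_le_divide_eq)
    have "m \<le> N"
    proof (rule ccontr)
      assume "\<not> m \<le> N"
      then have "real (Suc N) * d \<le> a" using iff[of "Suc N"] by simp
      moreover have "real N * d = M" using assms(3) by (simp add: d_def)
      ultimately show False using 2 assms(2) by (simp add: distrib_right)
    qed
    have "(\<Sum>k=1..N. d * indicator {t. real k * d \<le> t} a) = (\<Sum>k=1..m. d)"
      using \<open>m \<le> N\<close> by (intro sum.mono_neutral_cong_right) (auto simp: iff)
    also have "\<dots> = real m * d" by simp
    finally have eq: "(\<Sum>k=1..N. d * indicator {t. real k * d \<le> t} a) = real m * d" .
    show ?thesis unfolding eq using m by (simp add: distrib_right)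
  qed
  then show "(\<Sum>k=1..N. d * indicator {t. real k * d \<le> t} a) \<le> a"
    "a \<le> (\<Sum>k=1..N. d * indicator {t. real k * d \<le> t} a) + d" by blast+
qed

text \<open>
The regularity equations make the simplifier loop when the definition is unfolded; these parts are
safe as rewrite rules.
\<close>
lemma regular_borel_probD:
  assumes "regular_borel_prob T \<mu>"
  shows "prob_space \<mu>" "space \<mu> = topspace T" "sets \<mu> = sigma_sets (topspace T) {W. openin T W}"
  using assms by (auto simp only: regular_borel_prob_def)

lemma continuous_map_borel_measurable:
  fixes h :: "'k \<Rightarrow> 'b::topological_space"
  assumes "regular_borel_prob T \<mu>" "continuous_map T euclidean h"
  shows "h \<in> borel_measurable \<mu>"
proof (rule borel_measurableI)
  fix S :: "'b set" assume "open S"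
  then have "openin T {x \<in> topspace T. h x \<in> S}"
    using openin_continuous_map_preimage[OF assms(2), of S] by simp
  moreover have "h -` S \<inter> space \<mu> = {x \<in> topspace T. h x \<in> S}"
    using regular_borel_probD(2)[OF assms(1)] by auto
  ultimately show "h -` S \<inter> space \<mu> \<in> sets \<mu>"
    using regular_borel_probD(3)[OF assms(1)] by simp
qed

text \<open>
One half of the Riesz representation theorem. For continuous \<open>h\<close> with values in \<open>[0, M]\<close>, the level
sets \<open>{t. k * d \<le> h t}\<close> are closed, so the functional is at most \<open>\<mu>\<close> on them; summing over the
levels bounds \<open>L h\<close> by the integral up to the step width \<open>d = M / n\<close>.
\<close>
theorem positive_functional_le_integral:
  fixes T :: "'k topology" and L :: "('k \<Rightarrow> real) \<Rightarrow> real"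
  assumes T: "compact_space T" "Hausdorff_space T"
    and add: "\<And>h k. bounded_fun_on (topspace T) h \<Longrightarrow> bounded_fun_on (topspace T) k \<Longrightarrow>
      L (\<lambda>t. h t + k t) = L h + L k"
    and hom: "\<And>c h. 0 \<le> c \<Longrightarrow> bounded_fun_on (topspace T) h \<Longrightarrow> L (\<lambda>t. c * h t) = c * L h"
    and mono: "\<And>h k. bounded_fun_on (topspace T) h \<Longrightarrow> bounded_fun_on (topspace T) k \<Longrightarrow>
      (\<And>t. t \<in> topspace T \<Longrightarrow> h t \<le> k t) \<Longrightarrow> L h \<le> L k"
    and one: "L (\<lambda>_. 1) = 1"
  shows "\<exists>\<mu>. regular_borel_prob T \<mu> \<and>
    (\<forall>h. continuous_map T euclidean h \<longrightarrow> (\<forall>t\<in>topspace T. 0 \<le> h t) \<longrightarrow>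
       bounded_fun_on (topspace T) h \<longrightarrow> L h \<le> (\<integral>t. h t \<partial>\<mu>))"
proof -
  let ?X = "topspace T"
  have bi: "bounded_fun_on ?X (indicator A)" for A
    by (intro bounded_fun_onI[where M = 1]) (simp add: indicator_def)
  have L0: "L (\<lambda>_. 0) = 0" using hom[of 0 "\<lambda>_. 1"] by simp
  interpret N: finitely_additive_prob T "\<lambda>A. L (indicator A)"
  proof
    show "0 \<le> L (indicator A)" for A
      using mono[of "\<lambda>_. 0" "indicator A"] bi L0 by simp
    show "L (indicator (A \<union> B)) = L (indicator A) + L (indicator B)" if "A \<inter> B = {}" for A B
    proof -
      have "indicator (A \<union> B) = (\<lambda>t. indicator A t + indicator B t :: real)"
        using that by (auto simp: indicator_def fun_eq_iff)
      then show ?thesis using add[OF bi bi, of A B] by simp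
    qed
    have "L (indicator ?X) \<le> L (\<lambda>_. 1)" "L (\<lambda>_. 1) \<le> L (indicator ?X)"
      by (intro mono bi bounded_fun_on_const; simp)+
    then show "L (indicator ?X) = 1" using one by simp
  qed (use T in auto)
  have L_sum: "L (\<lambda>t. \<Sum>i\<in>I. g i t) = (\<Sum>i\<in>I. L (g i))"
    if "finite I" "\<And>i. i \<in> I \<Longrightarrow> bounded_fun_on ?X (g i)" for I :: "nat set" and g
    using that
  proof (induction I rule: finite_induct)
    case empty
    then show ?case by (simp add: L0)
  next
    case (insert i I)
    then show ?case using add[of "g i" "\<lambda>t. \<Sum>i\<in>I. g i t"] bounded_fun_on_sum[of I ?X g] by simp
  qed
  have "L h \<le> (\<integral>t. h t \<partial>N.\<mu>)"
    if h: "continuous_map T euclidean h" "\<forall>t\<in>?X. 0 \<le> h t" "bounded_fun_on ?X h" for h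
  proof -
    interpret prob_space N.\<mu> by (rule N.prob_space_\<mu>)
    obtain M where M: "\<And>t. t \<in> ?X \<Longrightarrow> h t \<le> M" and M0: "0 \<le> M"
      using h(3) unfolding bounded_fun_on_def by (metis abs_ge_self abs_ge_zero linorder_le_cases order_trans)
    have meas: "h \<in> borel_measurable N.\<mu>"
      by (rule continuous_map_borel_measurable[OF N.regular_\<mu> h(1)])
    have int: "integrable N.\<mu> h"
      using h(2) M by (intro integrable_const_bound[OF _ meas, of M]) (auto intro!: AE_I2)
    have bound: "L h \<le> (\<integral>t. h t \<partial>N.\<mu>) + M / real n" if n: "0 < n" for n
    proof -
      define d where "d = M / real n"
      define A where "A k = {t \<in> ?X. real k * d \<le> h t}" for k
      have d0: "0 \<le> d" using M0 by (simp add: d_def)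
      have A: "closedin T (A k)" for k
        using closedin_continuous_map_preimage[OF h(1), of "{real k * d..}"] by (simp add: A_def)
      have As: "A k \<in> sets N.\<mu>" for k by (rule N.closedin_in_sets_\<mu>[OF A])
      have ii: "integrable N.\<mu> (\<lambda>t. d * indicator (A k) t)" for k
        using As by (simp add: emeasure_eq_measure)
      have lo: "(\<Sum>k=1..n. d * indicator (A k) t) \<le> h t"
        and up: "h t \<le> (\<Sum>k=1..n. d * indicator (A k) t) + d" if t: "t \<in> ?X" for t
      proof -
        have "indicator (A k) t = (indicator {s. real k * d \<le> s} (h t) :: real)" for k
          using t by (simp add: A_def indicator_def)
        then show "(\<Sum>k=1..n. d * indicator (A k) t) \<le> h t"
          "h t \<le> (\<Sum>k=1..n. d * indicator (A k) t) + d"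
          using layer_sum_bounds[OF bspec[OF h(2) t] M[OF t] n] unfolding d_def by presburger+
      qed
      have bs: "bounded_fun_on ?X (\<lambda>t. \<Sum>k=1..n. d * indicator (A k) t)"
        by (intro bounded_fun_on_sum bounded_fun_on_cmult bi)
      have "L h \<le> L (\<lambda>t. (\<Sum>k=1..n. d * indicator (A k) t) + d)"
        using up by (intro mono h(3) bounded_fun_on_add bs bounded_fun_on_const)
      also have "\<dots> = (\<Sum>k=1..n. d * L (indicator (A k))) + d"
        using add[OF bs, of "\<lambda>_. d"] L_sum[of "{1..n}" "\<lambda>k t. d * indicator (A k) t"]
          hom[OF d0 bi] hom[OF d0, of "\<lambda>_. 1"] one bounded_fun_on_cmult[OF bi] by simp
      also have "\<dots> \<le> (\<Sum>k=1..n. d * measure N.\<mu> (A k)) + d"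
        using d0 A by (intro add_right_mono sum_mono mult_left_mono N.\<nu>_le_\<mu>)
      also have "(\<Sum>k=1..n. d * measure N.\<mu> (A k)) = (\<integral>t. (\<Sum>k=1..n. d * indicator (A k) t) \<partial>N.\<mu>)"
        by (subst Bochner_Integration.integral_sum[OF ii]) (use As sets.sets_into_space[OF As] in \<open>simp add: Int_absorb2\<close>)
      also have "\<dots> \<le> (\<integral>t. h t \<partial>N.\<mu>)"
        using lo by (intro integral_mono int Bochner_Integration.integrable_sum ii) simp
      finally show ?thesis by (simp add: d_def)
    qed
    have lim: "(\<lambda>n. (\<integral>t. h t \<partial>N.\<mu>) + M / real n) \<longlonglongrightarrow> (\<integral>t. h t \<partial>N.\<mu>)"
      using tendsto_add[OF tendsto_const lim_const_over_n[of M]] by simp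
    show ?thesis
      by (rule LIMSEQ_le_const[OF lim]) (use bound in \<open>auto intro!: exI[of _ 1]\<close>)
  qed
  then show ?thesis using N.regular_\<mu> by (intro exI[of _ N.\<mu>]) simp
qed

section \<open>Seminorms and dual norms on carriers\<close>

text \<open>
Only the laws by which a functional is bounded by its dual norm: nonnegativity and homogeneity.
\<close>
definition seminormed_space :: "'v cnspace \<Rightarrow> bool" where
  "seminormed_space V \<longleftrightarrow> pts V \<noteq> {} \<and>
     (\<forall>x\<in>pts V. 0 \<le> vnorm V x) \<and>
     (\<forall>c. \<forall>x\<in>pts V. vscale V c x \<in> pts V \<and> vnorm V (vscale V c x) = cmod c * vnorm V x)"

lemma seminormed_spaceD:
  assumes "seminormed_space V"
  shows "pts V \<noteq> {}" "x \<in> pts V \<Longrightarrow> 0 \<le> vnorm V x" "x \<in> pts V \<Longrightarrow> vscale V c x \<in> pts V"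
    "x \<in> pts V \<Longrightarrow> vnorm V (vscale V c x) = cmod c * vnorm V x"
  using assms by (auto simp: seminormed_space_def)

lemma dualD:
  assumes "\<phi> \<in> pts (dual V)"
  shows "x \<in> pts V \<Longrightarrow> y \<in> pts V \<Longrightarrow> \<phi> (vadd V x y) = \<phi> x + \<phi> y"
    "x \<in> pts V \<Longrightarrow> \<phi> (vscale V c x) = c * \<phi> x"
    "\<exists>C. \<forall>x\<in>pts V. cmod (\<phi> x) \<le> C * vnorm V x"
    "x \<notin> pts V \<Longrightarrow> \<phi> x = 0"
  using assms by (auto simp: dual_def)

lemma vnorm_dual: "vnorm (dual V) \<phi> = (SUP x\<in>unit_ball V. cmod (\<phi> x))"
  by (simp add: dual_def)

lemma vadd_dual [simp]: "vadd (dual V) \<phi> \<psi> = (\<lambda>x. \<phi> x + \<psi> x)"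
  by (simp add: dual_def)

lemma vscale_dual [simp]: "vscale (dual V) c \<phi> = (\<lambda>x. c * \<phi> x)"
  by (simp add: dual_def)

lemma vsub_dual [simp]: "vsub (dual V) \<phi> \<psi> = (\<lambda>x. \<phi> x - \<psi> x)"
  by (simp add: vsub_def)

lemma unit_ball_nonempty:
  assumes "seminormed_space V" shows "unit_ball V \<noteq> {}"
proof -
  obtain x where "x \<in> pts V" using seminormed_spaceD(1)[OF assms] by blast
  then have "vscale V 0 x \<in> unit_ball V"
    using seminormed_spaceD(3,4)[OF assms, of x 0] by (simp add: unit_ball_def)
  then show ?thesis by blast
qed

lemma dual_norm_bdd:
  assumes V: "seminormed_space V" and \<phi>: "\<phi> \<in> pts (dual V)"
  shows "bdd_above ((\<lambda>x. cmod (\<phi> x)) ` unit_ball V)"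
proof -
  obtain C where C: "\<forall>x\<in>pts V. cmod (\<phi> x) \<le> C * vnorm V x" using dualD(3)[OF \<phi>] by blast
  have "cmod (\<phi> x) \<le> \<bar>C\<bar>" if "x \<in> unit_ball V" for x
  proof -
    have x: "x \<in> pts V" "vnorm V x \<le> 1" using that by (auto simp: unit_ball_def)
    then have "cmod (\<phi> x) \<le> \<bar>C\<bar> * vnorm V x"
      using C seminormed_spaceD(2)[OF V x(1)] by (meson abs_ge_self mult_right_mono order_trans)
    also have "\<dots> \<le> \<bar>C\<bar>" using x by (simp add: mult_left_le)
    finally show ?thesis .
  qed
  then show ?thesis by (auto simp: bdd_above_def)
qed

lemma dual_norm_nonneg:
  assumes V: "seminormed_space V" and \<phi>: "\<phi> \<in> pts (dual V)"
  shows "0 \<le> vnorm (dual V) \<phi>"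
proof -
  obtain x where "x \<in> unit_ball V" using unit_ball_nonempty[OF V] by blast
  then show ?thesis
    unfolding vnorm_dual by (intro cSUP_upper2[OF dual_norm_bdd[OF V \<phi>]]) auto
qed

lemma dual_norm_bound:
  assumes V: "seminormed_space V" and \<phi>: "\<phi> \<in> pts (dual V)" and x: "x \<in> pts V"
  shows "cmod (\<phi> x) \<le> vnorm (dual V) \<phi> * vnorm V x"
proof (cases "vnorm V x = 0")
  case True
  then show ?thesis using dualD(3)[OF \<phi>] x by force
next
  case False
  then have n: "0 < vnorm V x" using seminormed_spaceD(2)[OF V x] by simp
  let ?c = "complex_of_real (inverse (vnorm V x))"
  have "vscale V ?c x \<in> unit_ball V"
    using seminormed_spaceD(3,4)[OF V x, of ?c] n by (simp add: unit_ball_def norm_inverse)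
  then have "cmod (\<phi> (vscale V ?c x)) \<le> vnorm (dual V) \<phi>"
    unfolding vnorm_dual by (intro cSUP_upper dual_norm_bdd[OF V \<phi>])
  then show ?thesis
    using n by (simp add: dualD(2)[OF \<phi> x] norm_mult norm_inverse norm_divide field_simps)
qed

lemma dual_norm_le:
  assumes V: "seminormed_space V" and "0 \<le> C" "\<And>x. x \<in> pts V \<Longrightarrow> cmod (\<phi> x) \<le> C * vnorm V x"
  shows "vnorm (dual V) \<phi> \<le> C"
  unfolding vnorm_dual
proof (rule cSUP_least[OF unit_ball_nonempty[OF V]])
  fix x assume "x \<in> unit_ball V"
  then have x: "x \<in> pts V" "vnorm V x \<le> 1" by (auto simp: unit_ball_def)
  have "cmod (\<phi> x) \<le> C * vnorm V x" using assms(3) x(1) .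
  also have "\<dots> \<le> C" using assms(2) x(2) by (simp add: mult_left_le)
  finally show "cmod (\<phi> x) \<le> C" .
qed

lemma unit_ball_dual_iff:
  assumes V: "seminormed_space V"
  shows "\<phi> \<in> unit_ball (dual V) \<longleftrightarrow>
    \<phi> \<in> pts (dual V) \<and> (\<forall>x\<in>pts V. cmod (\<phi> x) \<le> vnorm V x)"
proof
  assume "\<phi> \<in> unit_ball (dual V)"
  then have \<phi>: "\<phi> \<in> pts (dual V)" "vnorm (dual V) \<phi> \<le> 1" by (auto simp: unit_ball_def)
  have "cmod (\<phi> x) \<le> vnorm V x" if x: "x \<in> pts V" for x
  proof -
    have "cmod (\<phi> x) \<le> vnorm (dual V) \<phi> * vnorm V x" by (rule dual_norm_bound[OF V \<phi>(1) x])
    also have "\<dots> \<le> 1 * vnorm V x"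
      using \<phi>(2) seminormed_spaceD(2)[OF V x] by (rule mult_right_mono)
    finally show ?thesis by simp
  qed
  with \<phi> show "\<phi> \<in> pts (dual V) \<and> (\<forall>x\<in>pts V. cmod (\<phi> x) \<le> vnorm V x)" by blast
next
  assume "\<phi> \<in> pts (dual V) \<and> (\<forall>x\<in>pts V. cmod (\<phi> x) \<le> vnorm V x)"
  then show "\<phi> \<in> unit_ball (dual V)"
    using dual_norm_le[OF V, of 1 \<phi>] by (simp add: unit_ball_def)
qed

lemma seminormed_space_dual:
  assumes V: "seminormed_space V"
  shows "seminormed_space (dual V)"
proof -
  have scale: "(\<lambda>x. c * \<phi> x) \<in> pts (dual V)" if \<phi>: "\<phi> \<in> pts (dual V)" for c \<phi>
  proof -
    obtain C where C: "\<forall>x\<in>pts V. cmod (\<phi> x) \<le> C * vnorm V x" using dualD(3)[OF \<phi>] by blast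
    then have "\<forall>x\<in>pts V. cmod (c * \<phi> x) \<le> (cmod c * C) * vnorm V x"
      by (simp add: norm_mult mult.assoc mult_left_mono)
    then have "\<exists>C. \<forall>x\<in>pts V. cmod (c * \<phi> x) \<le> C * vnorm V x" by blast
    then show ?thesis using \<phi> by (simp add: dual_def distrib_left)
  qed
  have le: "vnorm (dual V) (\<lambda>x. c * \<phi> x) \<le> cmod c * vnorm (dual V) \<phi>"
    if \<phi>: "\<phi> \<in> pts (dual V)" for c \<phi>
  proof (rule dual_norm_le[OF V])
    show "0 \<le> cmod c * vnorm (dual V) \<phi>" using dual_norm_nonneg[OF V \<phi>] by simp
    show "cmod (c * \<phi> x) \<le> cmod c * vnorm (dual V) \<phi> * vnorm V x" if "x \<in> pts V" for x
      using mult_left_mono[OF dual_norm_bound[OF V \<phi> that], of "cmod c"]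
      by (simp add: norm_mult mult.assoc)
  qed
  have eq: "vnorm (dual V) (\<lambda>x. c * \<phi> x) = cmod c * vnorm (dual V) \<phi>"
    if \<phi>: "\<phi> \<in> pts (dual V)" for c \<phi>
  proof (rule antisym[OF le[OF \<phi>]])
    show "cmod c * vnorm (dual V) \<phi> \<le> vnorm (dual V) (\<lambda>x. c * \<phi> x)"
    proof (cases "c = 0")
      case True
      then show ?thesis using dual_norm_nonneg[OF V scale[OF \<phi>, of 0]] by simp
    next
      case False
      have "vnorm (dual V) (\<lambda>x. inverse c * (c * \<phi> x)) \<le>
          cmod (inverse c) * vnorm (dual V) (\<lambda>x. c * \<phi> x)"
        by (rule le[OF scale[OF \<phi>]])
      moreover have "(\<lambda>x. inverse c * (c * \<phi> x)) = \<phi>" using False by auto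
      ultimately show ?thesis using False by (simp add: norm_inverse norm_divide field_simps)
    qed
  qed
  have "(\<lambda>x. 0) \<in> pts (dual V)" by (auto simp: dual_def intro!: exI[of _ 0])
  then show ?thesis
    using scale eq dual_norm_nonneg[OF V] unfolding seminormed_space_def by auto
qed

lemma seminormed_space_tspace: "seminormed_space tspace"
  by (auto simp: seminormed_space_def tspace_def norm_scaleC)

section \<open>Lebesgue spaces of functions and of classes\<close>

definition Lq_fun :: "real \<Rightarrow> 'k measure \<Rightarrow> ('k \<Rightarrow> complex) set" where
  "Lq_fun q \<mu> = {h \<in> borel_measurable \<mu>. integrable \<mu> (\<lambda>t. cmod (h t) powr q)}"

definition Lq_norm :: "real \<Rightarrow> 'k measure \<Rightarrow> ('k \<Rightarrow> complex) \<Rightarrow> real" where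
  "Lq_norm q \<mu> h = (\<integral>t. cmod (h t) powr q \<partial>\<mu>) powr (1 / q)"

lemma Lq_norm_nonneg [simp]: "0 \<le> Lq_norm q \<mu> h"
  by (simp add: Lq_norm_def)

lemma Lq_norm_powr:
  assumes "1 \<le> q" shows "Lq_norm q \<mu> h powr q = (\<integral>t. cmod (h t) powr q \<partial>\<mu>)"
  using assms by (simp add: Lq_norm_def powr_powr)

lemma Lq_norm_zero [simp]: "Lq_norm q \<mu> (\<lambda>_. 0) = 0"
  by (simp add: Lq_norm_def)

lemma convex_powr:
  fixes a b \<theta> q :: real
  assumes q: "1 \<le> q" and "0 \<le> a" "0 \<le> b" and \<theta>: "0 \<le> \<theta>" "\<theta> \<le> 1"
  shows "(\<theta> * a + (1 - \<theta>) * b) powr q \<le> \<theta> * a powr q + (1 - \<theta>) * b powr q"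
proof -
  have le: "s powr q \<le> s" if "0 \<le> s" "s \<le> 1" for s :: real
    using powr_mono'[OF q that] that by (cases "s = 0") auto
  consider "a = 0" | "b = 0" | "0 < a" "0 < b" using assms by linarith
  then show ?thesis
  proof cases
    case 1
    then show ?thesis
      using le[of "1 - \<theta>"] assms by (simp add: powr_mult mult_right_mono)
  next
    case 2
    then show ?thesis
      using le[of \<theta>] assms by (simp add: powr_mult mult_right_mono)
  next
    case 3
    then show ?thesis
      using convex_onD[OF powr_convex[OF q], of \<theta> b a] \<theta> by (simp add: add.commute)
  qed
qed

lemma integral_powr_nonneg [simp]: "0 \<le> (\<integral>t. cmod (h t) powr q \<partial>\<mu>)"
  by (intro integral_nonneg_AE) auto

lemma Lq_norm_le_iff:
  assumes "1 \<le> q" "0 \<le> A"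
  shows "Lq_norm q \<mu> h \<le> A \<longleftrightarrow> (\<integral>t. cmod (h t) powr q \<partial>\<mu>) \<le> A powr q"
proof -
  have "Lq_norm q \<mu> h \<le> A \<longleftrightarrow> Lq_norm q \<mu> h powr q \<le> A powr q"
    using assms powr_mono2[of q "Lq_norm q \<mu> h" A] powr_less_mono2[of q A "Lq_norm q \<mu> h"] by fastforce
  then show ?thesis using assms by (simp add: Lq_norm_powr)
qed

lemma Lq_fun_scale:
  assumes "h \<in> Lq_fun q \<mu>" shows "(\<lambda>t. c * h t) \<in> Lq_fun q \<mu>"
  using assms by (auto simp: Lq_fun_def norm_mult powr_mult)

lemma Lq_norm_scale:
  assumes "1 \<le> q" shows "Lq_norm q \<mu> (\<lambda>t. c * h t) = cmod c * Lq_norm q \<mu> h"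
  using assms by (simp add: Lq_norm_def norm_mult powr_mult powr_powr)

lemma Lq_fun_add:
  assumes q: "1 \<le> q" and h: "h \<in> Lq_fun q \<mu>" and k: "k \<in> Lq_fun q \<mu>"
  shows "(\<lambda>t. h t + k t) \<in> Lq_fun q \<mu>"
proof -
  have "integrable \<mu> (\<lambda>t. cmod (h t + k t) powr q)"
  proof (rule Bochner_Integration.integrable_bound)
    show "integrable \<mu> (\<lambda>t. 2 powr q * (cmod (h t) powr q + cmod (k t) powr q))"
      using h k by (auto simp: Lq_fun_def)
    show "(\<lambda>t. cmod (h t + k t) powr q) \<in> borel_measurable \<mu>"
      using h k by (auto simp: Lq_fun_def)
    show "AE t in \<mu>. norm (cmod (h t + k t) powr q) \<le>
        norm (2 powr q * (cmod (h t) powr q + cmod (k t) powr q))"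
    proof (rule AE_I2)
      fix t
      let ?m = "max (cmod (h t)) (cmod (k t))"
      have "cmod (h t + k t) powr q \<le> (2 * ?m) powr q"
        using q norm_triangle_ineq[of "h t" "k t"] by (intro powr_mono2) auto
      also have "\<dots> = 2 powr q * ?m powr q" by (simp add: powr_mult)
      also have "\<dots> \<le> 2 powr q * (cmod (h t) powr q + cmod (k t) powr q)"
        by (intro mult_left_mono) (auto simp: max_def)
      finally show "norm (cmod (h t + k t) powr q) \<le>
        norm (2 powr q * (cmod (h t) powr q + cmod (k t) powr q))" by simp
    qed
  qed
  then show ?thesis using h k by (auto simp: Lq_fun_def)
qed

lemma Lq_fun_diff:
  assumes "1 \<le> q" "h \<in> Lq_fun q \<mu>" "k \<in> Lq_fun q \<mu>"
  shows "(\<lambda>t. h t - k t) \<in> Lq_fun q \<mu>"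
  using Lq_fun_add[OF assms(1,2) Lq_fun_scale[OF assms(3), of "-1"]] by simp

text \<open>
Minkowski's inequality by convexity. For \<open>A > \<parallel>h\<parallel>\<close> and \<open>B > \<parallel>k\<parallel>\<close>, the function \<open>\<bar>h\<bar> + \<bar>k\<bar>\<close> is \<open>A + B\<close>
times a convex combination of \<open>\<bar>h\<bar> / A\<close> and \<open>\<bar>k\<bar> / B\<close>, each of norm at most one. The strict
inequalities, obtained by adding \<open>e / 2\<close>, keep the denominators positive.
\<close>
lemma Lq_norm_triangle:
  assumes q: "1 \<le> q" and h: "h \<in> Lq_fun q \<mu>" and k: "k \<in> Lq_fun q \<mu>"
  shows "Lq_norm q \<mu> (\<lambda>t. h t + k t) \<le> Lq_norm q \<mu> h + Lq_norm q \<mu> k"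
proof (rule field_le_epsilon)
  fix e :: real assume e: "0 < e"
  define A where "A = Lq_norm q \<mu> h + e / 2"
  define B where "B = Lq_norm q \<mu> k + e / 2"
  define \<theta> where "\<theta> = A / (A + B)"
  have AB: "0 < A" "0 < B"
    using e Lq_norm_nonneg[of q \<mu> h] Lq_norm_nonneg[of q \<mu> k] unfolding A_def B_def by linarith+
  have \<theta>: "0 \<le> \<theta>" "\<theta> \<le> 1" "(A + B) * \<theta> = A" "(A + B) * (1 - \<theta>) = B"
    using AB by (auto simp: \<theta>_def field_simps)
  have int: "integrable \<mu> (\<lambda>t. cmod (h t) powr q)" "integrable \<mu> (\<lambda>t. cmod (k t) powr q)"
    using h k by (auto simp: Lq_fun_def)
  have pt: "cmod (h t + k t) powr q \<le> (A + B) powr q *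
      (\<theta> * (cmod (h t) powr q / A powr q) + (1 - \<theta>) * (cmod (k t) powr q / B powr q))" for t
  proof -
    have "cmod (h t) + cmod (k t) = (A + B) * (\<theta> * (cmod (h t) / A) + (1 - \<theta>) * (cmod (k t) / B))"
      using AB by (simp add: distrib_left mult.assoc[symmetric] \<theta>)
    then have "cmod (h t + k t) powr q \<le>
        ((A + B) * (\<theta> * (cmod (h t) / A) + (1 - \<theta>) * (cmod (k t) / B))) powr q"
      using q norm_triangle_ineq[of "h t" "k t"] by (intro powr_mono2) auto
    also have "\<dots> = (A + B) powr q * (\<theta> * (cmod (h t) / A) + (1 - \<theta>) * (cmod (k t) / B)) powr q"
      using AB \<theta> by (subst powr_mult) auto
    also have "\<dots> \<le> (A + B) powr q *
        (\<theta> * (cmod (h t) / A) powr q + (1 - \<theta>) * (cmod (k t) / B) powr q)"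
      using AB \<theta> by (intro mult_left_mono convex_powr q) auto
    finally show ?thesis using AB by (simp add: powr_divide)
  qed
  have le: "(\<integral>t. cmod (h t) powr q \<partial>\<mu>) \<le> A powr q" "(\<integral>t. cmod (k t) powr q \<partial>\<mu>) \<le> B powr q"
    using Lq_norm_le_iff[OF q, of A \<mu> h] Lq_norm_le_iff[OF q, of B \<mu> k] AB e
    by (auto simp: A_def B_def)
  have "(\<integral>t. cmod (h t + k t) powr q \<partial>\<mu>) \<le> (\<integral>t. (A + B) powr q *
      (\<theta> * (cmod (h t) powr q / A powr q) + (1 - \<theta>) * (cmod (k t) powr q / B powr q)) \<partial>\<mu>)"
    using Lq_fun_add[OF q h k] int pt by (intro integral_mono) (auto simp: Lq_fun_def)
  also have "\<dots> = (A + B) powr q * (\<theta> * ((\<integral>t. cmod (h t) powr q \<partial>\<mu>) / A powr q) +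
      (1 - \<theta>) * ((\<integral>t. cmod (k t) powr q \<partial>\<mu>) / B powr q))"
    using int by simp
  also have "\<dots> \<le> (A + B) powr q * (\<theta> * 1 + (1 - \<theta>) * 1)"
    using le \<theta> AB by (intro mult_left_mono add_mono) (auto simp: divide_le_eq_1)
  finally have "(\<integral>t. cmod (h t + k t) powr q \<partial>\<mu>) \<le> (A + B) powr q" by simp
  then have "Lq_norm q \<mu> (\<lambda>t. h t + k t) \<le> A + B" using iffD2[OF Lq_norm_le_iff[OF q, of "A + B"]] AB by simp
  then show "Lq_norm q \<mu> (\<lambda>t. h t + k t) \<le> Lq_norm q \<mu> h + Lq_norm q \<mu> k + e"
    by (simp add: A_def B_def)
qed

lemma Lq_norm_minus_commute: "Lq_norm q \<mu> (\<lambda>t. h t - k t) = Lq_norm q \<mu> (\<lambda>t. k t - h t)"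
  by (simp add: Lq_norm_def norm_minus_commute)

lemma Lq_norm_diff_triangle:
  assumes "1 \<le> q" "h \<in> Lq_fun q \<mu>" "k \<in> Lq_fun q \<mu>" "l \<in> Lq_fun q \<mu>"
  shows "Lq_norm q \<mu> (\<lambda>t. h t - l t) \<le> Lq_norm q \<mu> (\<lambda>t. h t - k t) + Lq_norm q \<mu> (\<lambda>t. k t - l t)"
  using Lq_norm_triangle[OF assms(1) Lq_fun_diff[OF assms(1,2,3)] Lq_fun_diff[OF assms(1,3,4)]] by simp

lemma Lq_norm_cong_AE:
  assumes "h \<in> borel_measurable \<mu>" "k \<in> borel_measurable \<mu>" "AE t in \<mu>. h t = k t"
  shows "Lq_norm q \<mu> h = Lq_norm q \<mu> k"
proof -
  have "(\<integral>t. cmod (h t) powr q \<partial>\<mu>) = (\<integral>t. cmod (k t) powr q \<partial>\<mu>)"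
    using assms by (intro integral_cong_AE) auto
  then show ?thesis by (simp add: Lq_norm_def)
qed

lemma ae_rep_ae_class:
  assumes "h \<in> borel_measurable \<mu>"
  shows "ae_rep (ae_class \<mu> h) \<in> borel_measurable \<mu>" "AE t in \<mu>. ae_rep (ae_class \<mu> h) t = h t"
proof -
  have "h \<in> ae_class \<mu> h" using assms by (simp add: ae_class_def)
  then have "ae_rep (ae_class \<mu> h) \<in> ae_class \<mu> h" unfolding ae_rep_def by (rule someI[where P = "\<lambda>k. k \<in> ae_class \<mu> h"])
  then show "ae_rep (ae_class \<mu> h) \<in> borel_measurable \<mu>" "AE t in \<mu>. ae_rep (ae_class \<mu> h) t = h t"
    by (auto simp: ae_class_def)
qed

lemma ae_class_cong_AE:
  assumes "AE t in \<mu>. h t = k t" shows "ae_class \<mu> h = ae_class \<mu> k"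
proof -
  have "AE t in \<mu>. l t = k t" if "AE t in \<mu>. l t = h t" for l :: "'a \<Rightarrow> complex"
    using that assms by eventually_elim simp
  moreover have "AE t in \<mu>. l t = h t" if "AE t in \<mu>. l t = k t" for l :: "'a \<Rightarrow> complex"
    using that assms by eventually_elim simp
  ultimately show ?thesis unfolding ae_class_def by blast
qed

lemma pts_Lq_space: "pts (Lq_space q \<mu>) = ae_class \<mu> ` Lq_fun q \<mu>"
  by (simp add: Lq_space_def Lq_fun_def)

lemma vnorm_Lq_space: "vnorm (Lq_space q \<mu>) A = Lq_norm q \<mu> (ae_rep A)"
  by (simp add: Lq_space_def Lq_norm_def)

lemma Lq_fun_cong_AE:
  assumes "h \<in> Lq_fun q \<mu>" "k \<in> borel_measurable \<mu>" "AE t in \<mu>. k t = h t"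
  shows "k \<in> Lq_fun q \<mu>"
proof -
  have "integrable \<mu> (\<lambda>t. cmod (k t) powr q)"
    using assms by (subst integrable_cong_AE[where g = "\<lambda>t. cmod (h t) powr q"]) (auto simp: Lq_fun_def)
  then show ?thesis using assms by (simp add: Lq_fun_def)
qed

lemma Lq_fun_measurable: "h \<in> Lq_fun q \<mu> \<Longrightarrow> h \<in> borel_measurable \<mu>"
  by (simp add: Lq_fun_def)

lemma ae_rep_Lq_space:
  assumes "A \<in> pts (Lq_space q \<mu>)"
  shows "ae_rep A \<in> Lq_fun q \<mu>" "ae_class \<mu> (ae_rep A) = A"
proof -
  obtain h where h: "h \<in> Lq_fun q \<mu>" "A = ae_class \<mu> h" using assms by (auto simp: pts_Lq_space)
  note r = ae_rep_ae_class[OF Lq_fun_measurable[OF h(1)]]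
  show "ae_rep A \<in> Lq_fun q \<mu>" using Lq_fun_cong_AE[OF h(1) r] h(2) by simp
  show "ae_class \<mu> (ae_rep A) = A" using ae_class_cong_AE[OF r(2)] h(2) by simp
qed

lemma vnorm_ae_class:
  "h \<in> borel_measurable \<mu> \<Longrightarrow> vnorm (Lq_space q \<mu>) (ae_class \<mu> h) = Lq_norm q \<mu> h"
  unfolding vnorm_Lq_space by (intro Lq_norm_cong_AE ae_rep_ae_class)

lemma vadd_Lq_space: "vadd (Lq_space q \<mu>) A B = ae_class \<mu> (\<lambda>t. ae_rep A t + ae_rep B t)"
  by (simp add: Lq_space_def)

lemma vscale_Lq_space: "vscale (Lq_space q \<mu>) c A = ae_class \<mu> (\<lambda>t. c * ae_rep A t)"
  by (simp add: Lq_space_def)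

lemma vsub_Lq_space:
  assumes "A \<in> pts (Lq_space q \<mu>)" "B \<in> pts (Lq_space q \<mu>)"
  shows "vsub (Lq_space q \<mu>) A B = ae_class \<mu> (\<lambda>t. ae_rep A t - ae_rep B t)"
proof -
  have "(\<lambda>t. - 1 * ae_rep B t) \<in> borel_measurable \<mu>"
    using Lq_fun_measurable[OF Lq_fun_scale[OF ae_rep_Lq_space(1)[OF assms(2)]]] .
  from ae_rep_ae_class(2)[OF this]
  have "AE t in \<mu>. ae_rep A t + ae_rep (vscale (Lq_space q \<mu>) (-1) B) t = ae_rep A t - ae_rep B t"
    unfolding vscale_Lq_space by eventually_elim simp
  then show ?thesis unfolding vsub_def vadd_Lq_space by (rule ae_class_cong_AE)
qed

lemma vnorm_vsub_Lq_space:
  assumes q: "1 \<le> q" and "A \<in> pts (Lq_space q \<mu>)" "B \<in> pts (Lq_space q \<mu>)"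
  shows "vnorm (Lq_space q \<mu>) (vsub (Lq_space q \<mu>) A B) = Lq_norm q \<mu> (\<lambda>t. ae_rep A t - ae_rep B t)"
  unfolding vsub_Lq_space[OF assms(2,3)]
  using assms by (intro vnorm_ae_class Lq_fun_measurable[of _ q] Lq_fun_diff ae_rep_Lq_space)

lemma subspace_on_simps [simp]:
  "pts (subspace_on V S) = S" "vadd (subspace_on V S) = vadd V"
  "vscale (subspace_on V S) = vscale V" "vnorm (subspace_on V S) = vnorm V"
  by (simp_all add: subspace_on_def)

lemma seminormed_space_Lq_subspace:
  assumes q: "1 \<le> q" and S: "closed_subspace S (Lq_space q \<mu>)"
  shows "seminormed_space (subspace_on (Lq_space q \<mu>) S)"
proof -
  have "vnorm (Lq_space q \<mu>) (vscale (Lq_space q \<mu>) c A) = cmod c * vnorm (Lq_space q \<mu>) A"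
    if "A \<in> S" for c A
  proof -
    have "A \<in> pts (Lq_space q \<mu>)" using S that by (auto simp: closed_subspace_def)
    then have "(\<lambda>t. c * ae_rep A t) \<in> borel_measurable \<mu>"
      by (intro Lq_fun_measurable[of _ q] Lq_fun_scale ae_rep_Lq_space)
    then show ?thesis
      unfolding vscale_Lq_space by (simp only: vnorm_ae_class Lq_norm_scale[OF q] vnorm_Lq_space[of q \<mu> A])
  qed
  then show ?thesis
    using S unfolding seminormed_space_def closed_subspace_def by (auto simp: vnorm_Lq_space)
qed

section \<open>Extending functionals to the closure of a dense subspace\<close>

text \<open>
A linear map \<open>J\<close> from a space \<open>Y\<close> of functions to \<open>L\<^sub>q(\<mu>)\<close>. It stands for \<open>\<iota>\<close> on the dual of \<open>F\<close>.
Functionals that are bounded for the \<open>L\<^sub>q\<close>-norm of \<open>J y\<close> are extended to the closure of the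
image of \<open>J\<close>.
\<close>
locale Lq_embedding =
  fixes q :: real and \<mu> :: "'k measure" and Y :: "('a \<Rightarrow> complex) set"
    and J :: "('a \<Rightarrow> complex) \<Rightarrow> 'k \<Rightarrow> complex"
  assumes q: "1 \<le> q" and Y_nonempty: "Y \<noteq> {}"
    and Y_add: "y \<in> Y \<Longrightarrow> z \<in> Y \<Longrightarrow> (\<lambda>v. y v + z v) \<in> Y"
    and Y_scale: "y \<in> Y \<Longrightarrow> (\<lambda>v. c * y v) \<in> Y"
    and J_Lq: "y \<in> Y \<Longrightarrow> J y \<in> Lq_fun q \<mu>"
    and J_add: "y \<in> Y \<Longrightarrow> z \<in> Y \<Longrightarrow> J (\<lambda>v. y v + z v) = (\<lambda>t. J y t + J z t)"
    and J_scale: "y \<in> Y \<Longrightarrow> J (\<lambda>v. c * y v) = (\<lambda>t. c * J y t)"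
begin

definition gap :: "('k \<Rightarrow> complex) set \<Rightarrow> ('a \<Rightarrow> complex) \<Rightarrow> real" where
  "gap A y = Lq_norm q \<mu> (\<lambda>t. ae_rep A t - J y t)"

definition image_closure :: "('k \<Rightarrow> complex) set set" where
  "image_closure = {A \<in> pts (Lq_space q \<mu>). \<forall>e>0. \<exists>y\<in>Y. gap A y < e}"

lemma image_closure_sub: "A \<in> image_closure \<Longrightarrow> A \<in> pts (Lq_space q \<mu>)"
  by (simp add: image_closure_def)

lemma rep_Lq: "A \<in> pts (Lq_space q \<mu>) \<Longrightarrow> ae_rep A \<in> Lq_fun q \<mu>"
  by (rule ae_rep_Lq_space)

lemma vadd_in: "A \<in> pts (Lq_space q \<mu>) \<Longrightarrow> B \<in> pts (Lq_space q \<mu>) \<Longrightarrow>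
    vadd (Lq_space q \<mu>) A B \<in> pts (Lq_space q \<mu>)"
  using Lq_fun_add[OF q rep_Lq rep_Lq] by (auto simp: vadd_Lq_space pts_Lq_space)

lemma vscale_in: "A \<in> pts (Lq_space q \<mu>) \<Longrightarrow> vscale (Lq_space q \<mu>) c A \<in> pts (Lq_space q \<mu>)"
  using Lq_fun_scale[OF rep_Lq] by (auto simp: vscale_Lq_space pts_Lq_space)

lemma gap_ae_class:
  assumes "h \<in> Lq_fun q \<mu>" "y \<in> Y"
  shows "gap (ae_class \<mu> h) y = Lq_norm q \<mu> (\<lambda>t. h t - J y t)"
proof -
  note r = ae_rep_ae_class[OF Lq_fun_measurable[OF assms(1)]]
  have [measurable]: "h \<in> borel_measurable \<mu>" "J y \<in> borel_measurable \<mu>" "ae_rep (ae_class \<mu> h) \<in> borel_measurable \<mu>"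
    using Lq_fun_measurable[OF assms(1)] Lq_fun_measurable[OF J_Lq[OF assms(2)]] r(1) by auto
  have "AE t in \<mu>. ae_rep (ae_class \<mu> h) t - J y t = h t - J y t"
    using r(2) by eventually_elim simp
  then show ?thesis unfolding gap_def by (intro Lq_norm_cong_AE) measurable
qed

lemma gap_add:
  assumes "A \<in> pts (Lq_space q \<mu>)" "B \<in> pts (Lq_space q \<mu>)" "y \<in> Y" "z \<in> Y"
  shows "gap (vadd (Lq_space q \<mu>) A B) (\<lambda>v. y v + z v) \<le> gap A y + gap B z"
proof -
  have "gap (vadd (Lq_space q \<mu>) A B) (\<lambda>v. y v + z v) =
      Lq_norm q \<mu> (\<lambda>t. (ae_rep A t + ae_rep B t) - (J y t + J z t))"
    unfolding vadd_Lq_space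
    using gap_ae_class[OF Lq_fun_add[OF q rep_Lq[OF assms(1)] rep_Lq[OF assms(2)]] Y_add[OF assms(3,4)]]
    by (simp add: J_add[OF assms(3,4)])
  also have "\<dots> = Lq_norm q \<mu> (\<lambda>t. (ae_rep A t - J y t) + (ae_rep B t - J z t))"
    by (simp add: algebra_simps)
  also have "\<dots> \<le> gap A y + gap B z"
    unfolding gap_def using assms by (intro Lq_norm_triangle Lq_fun_diff q rep_Lq J_Lq)
  finally show ?thesis .
qed

lemma gap_scale:
  assumes "A \<in> pts (Lq_space q \<mu>)" "y \<in> Y"
  shows "gap (vscale (Lq_space q \<mu>) c A) (\<lambda>v. c * y v) = cmod c * gap A y"
proof -
  have "gap (vscale (Lq_space q \<mu>) c A) (\<lambda>v. c * y v) = Lq_norm q \<mu> (\<lambda>t. c * ae_rep A t - c * J y t)"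
    unfolding vscale_Lq_space
    using gap_ae_class[OF Lq_fun_scale[OF rep_Lq[OF assms(1)]] Y_scale[OF assms(2)], of c c]
    by (simp add: J_scale[OF assms(2)])
  also have "\<dots> = Lq_norm q \<mu> (\<lambda>t. c * (ae_rep A t - J y t))" by (simp add: algebra_simps)
  finally show ?thesis by (simp add: Lq_norm_scale[OF q] gap_def)
qed

lemma gap_nonneg [simp]: "0 \<le> gap A y"
  by (simp add: gap_def)

lemma closed_subspace_image_closure: "closed_subspace image_closure (Lq_space q \<mu>)"
  unfolding closed_subspace_def
proof (intro conjI ballI allI impI)
  show "image_closure \<subseteq> pts (Lq_space q \<mu>)" by (auto simp: image_closure_def)
  show "image_closure \<noteq> {}"
  proof -
    obtain y where y: "y \<in> Y" using Y_nonempty by blast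
    then have "gap (ae_class \<mu> (J y)) y = 0" by (simp add: gap_ae_class J_Lq)
    then have "ae_class \<mu> (J y) \<in> image_closure"
      using y J_Lq[OF y] unfolding image_closure_def pts_Lq_space by (auto intro!: bexI[of _ y])
    then show ?thesis by blast
  qed
  show "vadd (Lq_space q \<mu>) A B \<in> image_closure" if AB: "A \<in> image_closure" "B \<in> image_closure" for A B
  proof -
    have "\<exists>y\<in>Y. gap (vadd (Lq_space q \<mu>) A B) y < e" if "0 < e" for e
    proof -
      have e2: "0 < e / 2" using \<open>0 < e\<close> by simp
      obtain y where y: "y \<in> Y" "gap A y < e / 2" using AB(1) e2 unfolding image_closure_def by blast
      obtain z where z: "z \<in> Y" "gap B z < e / 2" using AB(2) e2 unfolding image_closure_def by blast
      have "gap (vadd (Lq_space q \<mu>) A B) (\<lambda>v. y v + z v) < e"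
        using gap_add[OF image_closure_sub[OF AB(1)] image_closure_sub[OF AB(2)] y(1) z(1)] y z by linarith
      then show ?thesis using Y_add[OF y(1) z(1)] by blast
    qed
    then show ?thesis using vadd_in AB by (simp add: image_closure_def)
  qed
  show "vscale (Lq_space q \<mu>) c A \<in> image_closure" if A: "A \<in> image_closure" for c A
  proof -
    have "\<exists>y\<in>Y. gap (vscale (Lq_space q \<mu>) c A) y < e" if "0 < e" for e
    proof -
      have "0 < e / (cmod c + 1)" using that by (simp add: add_nonneg_pos)
      then obtain y where y: "y \<in> Y" "gap A y < e / (cmod c + 1)" using A unfolding image_closure_def by blast
      have "cmod c * gap A y \<le> (cmod c + 1) * gap A y" by (intro mult_right_mono) auto
      also have "\<dots> < e" using y(2) by (simp add: pos_less_divide_eq add_nonneg_pos mult.commute)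
      finally have "gap (vscale (Lq_space q \<mu>) c A) (\<lambda>v. c * y v) < e"
        by (simp only: gap_scale[OF image_closure_sub[OF A] y(1)])
      then show ?thesis using Y_scale[OF y(1)] by blast
    qed
    then show ?thesis using vscale_in A by (simp add: image_closure_def)
  qed
  show "A \<in> image_closure" if A: "A \<in> pts (Lq_space q \<mu>)"
    and lim: "\<forall>e>0. \<exists>B\<in>image_closure. vnorm (Lq_space q \<mu>) (vsub (Lq_space q \<mu>) A B) < e" for A
  proof -
    have "\<exists>y\<in>Y. gap A y < e" if "0 < e" for e
    proof -
      obtain B where B: "B \<in> image_closure" "vnorm (Lq_space q \<mu>) (vsub (Lq_space q \<mu>) A B) < e / 2"
        using lim \<open>0 < e\<close> half_gt_zero by blast
      obtain y where y: "y \<in> Y" "gap B y < e / 2"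
        using B(1) \<open>0 < e\<close> half_gt_zero unfolding image_closure_def by blast
      have "gap A y \<le> Lq_norm q \<mu> (\<lambda>t. ae_rep A t - ae_rep B t) + gap B y"
        unfolding gap_def using A image_closure_sub[OF B(1)] y(1) by (intro Lq_norm_diff_triangle q rep_Lq J_Lq)
      then have "gap A y < e"
        using B(2) y(2) unfolding vnorm_vsub_Lq_space[OF q A image_closure_sub[OF B(1)]] by linarith
      then show ?thesis using y(1) by blast
    qed
    then show ?thesis using A by (simp add: image_closure_def)
  qed
qed

lemma seminormed_space_image_closure: "seminormed_space (subspace_on (Lq_space q \<mu>) image_closure)"
  by (rule seminormed_space_Lq_subspace[OF q closed_subspace_image_closure])

lemma gap_image: "y \<in> Y \<Longrightarrow> gap (ae_class \<mu> (J y)) y = 0"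
  by (simp add: gap_ae_class J_Lq)

lemma image_in_closure: "y \<in> Y \<Longrightarrow> ae_class \<mu> (J y) \<in> image_closure"
  using J_Lq unfolding image_closure_def pts_Lq_space by (auto intro!: bexI[of _ y] simp: gap_image)

definition dominated :: "real \<Rightarrow> (('a \<Rightarrow> complex) \<Rightarrow> complex) \<Rightarrow> bool" where
  "dominated C \<phi> \<longleftrightarrow> 0 \<le> C \<and>
     (\<forall>y\<in>Y. \<forall>z\<in>Y. \<phi> (\<lambda>v. y v + z v) = \<phi> y + \<phi> z) \<and> (\<forall>c. \<forall>y\<in>Y. \<phi> (\<lambda>v. c * y v) = c * \<phi> y) \<and>
     (\<forall>y\<in>Y. cmod (\<phi> y) \<le> C * Lq_norm q \<mu> (J y))"

lemma dominatedD:
  assumes "dominated C \<phi>"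
  shows "0 \<le> C" "y \<in> Y \<Longrightarrow> z \<in> Y \<Longrightarrow> \<phi> (\<lambda>v. y v + z v) = \<phi> y + \<phi> z"
    "y \<in> Y \<Longrightarrow> \<phi> (\<lambda>v. c * y v) = c * \<phi> y" "y \<in> Y \<Longrightarrow> cmod (\<phi> y) \<le> C * Lq_norm q \<mu> (J y)"
  using assms unfolding dominated_def by blast+

text \<open>
The approximating sequence depends on the class \<open>A\<close> only and not on the functional, so that \<open>ext\<close>
is linear in the functional by continuity of the operations.
\<close>
definition approx :: "('k \<Rightarrow> complex) set \<Rightarrow> nat \<Rightarrow> 'a \<Rightarrow> complex" where
  "approx A n = (SOME y. y \<in> Y \<and> gap A y < inverse (real (Suc n)))"

definition ext :: "(('a \<Rightarrow> complex) \<Rightarrow> complex) \<Rightarrow> ('k \<Rightarrow> complex) set \<Rightarrow> complex" where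
  "ext \<phi> A = (if A \<in> image_closure then lim (\<lambda>n. \<phi> (approx A n)) else 0)"

lemma approx:
  assumes "A \<in> image_closure"
  shows "approx A n \<in> Y" "gap A (approx A n) < inverse (real (Suc n))"
proof -
  have "\<exists>y. y \<in> Y \<and> gap A y < inverse (real (Suc n))" using assms by (simp add: image_closure_def Bex_def)
  from someI_ex[OF this]
  show "approx A n \<in> Y" "gap A (approx A n) < inverse (real (Suc n))" by (auto simp: approx_def)
qed

lemma dominated_diff:
  assumes "dominated C \<phi>" "A \<in> pts (Lq_space q \<mu>)" "y \<in> Y" "z \<in> Y"
  shows "cmod (\<phi> y - \<phi> z) \<le> C * (gap A y + gap A z)"
proof -
  have C: "0 \<le> C" using assms(1) by (simp add: dominated_def)
  have "\<phi> (\<lambda>v. y v + (- 1) * z v) = \<phi> y + (- 1) * \<phi> z"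
    unfolding dominatedD(2)[OF assms(1,3) Y_scale[OF assms(4)]] dominatedD(3)[OF assms(1,4)] ..
  then have "cmod (\<phi> y - \<phi> z) = cmod (\<phi> (\<lambda>v. y v + (- 1) * z v))" by simp
  also have "\<dots> \<le> C * Lq_norm q \<mu> (J (\<lambda>v. y v + (- 1) * z v))"
    using assms(1) Y_add[OF assms(3) Y_scale[OF assms(4)]] unfolding dominated_def by blast
  also have "J (\<lambda>v. y v + (- 1) * z v) = (\<lambda>t. J y t + (- 1) * J z t)"
    unfolding J_add[OF assms(3) Y_scale[OF assms(4)]] J_scale[OF assms(4)] ..
  also have "Lq_norm q \<mu> \<dots> = Lq_norm q \<mu> (\<lambda>t. J y t - J z t)" by simp
  also have "C * \<dots> \<le> C * (Lq_norm q \<mu> (\<lambda>t. J y t - ae_rep A t) + gap A z)"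
    unfolding gap_def using assms C
    by (intro mult_left_mono Lq_norm_diff_triangle q J_Lq rep_Lq)
  finally show ?thesis by (simp add: gap_def Lq_norm_minus_commute[of q \<mu> "J y"])
qed

lemma approx_tendsto:
  assumes \<phi>: "dominated C \<phi>" and A: "A \<in> image_closure"
  shows "(\<lambda>n. \<phi> (approx A n)) \<longlonglongrightarrow> ext \<phi> A"
proof -
  have C: "0 \<le> C" using \<phi> by (simp add: dominated_def)
  have "Cauchy (\<lambda>n. \<phi> (approx A n))"
  proof (rule metric_CauchyI)
    fix e :: real assume e: "0 < e"
    have "0 < e / (2 * C + 1)" using e C by (simp add: add_nonneg_pos)
    then obtain N where N: "inverse (real (Suc N)) < e / (2 * C + 1)" using reals_Archimedean by blast
    have "dist (\<phi> (approx A m)) (\<phi> (approx A n)) < e" if mn: "N \<le> m" "N \<le> n" for m n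
    proof -
      have inv: "inverse (real (Suc k)) \<le> inverse (real (Suc N))" if "N \<le> k" for k
        using that by (intro le_imp_inverse_le) auto
      have "gap A (approx A m) + gap A (approx A n) \<le> 2 * inverse (real (Suc N))"
        using approx(2)[OF A, of m] approx(2)[OF A, of n] inv[OF mn(1)] inv[OF mn(2)] by linarith
      then have "C * (gap A (approx A m) + gap A (approx A n)) \<le> C * (2 * inverse (real (Suc N)))"
        using C by (rule mult_left_mono)
      also have "\<dots> \<le> (2 * C + 1) * inverse (real (Suc N))" by (simp add: algebra_simps)
      also have "\<dots> < e" using N C by (simp add: pos_less_divide_eq add_nonneg_pos mult.commute)
      finally show ?thesis
        using dominated_diff[OF \<phi> image_closure_sub[OF A] approx(1)[OF A] approx(1)[OF A], of m n]
        by (simp add: dist_norm)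
    qed
    then show "\<exists>M. \<forall>m\<ge>M. \<forall>n\<ge>M. dist (\<phi> (approx A m)) (\<phi> (approx A n)) < e" by blast
  qed
  then have "convergent (\<lambda>n. \<phi> (approx A n))" by (rule Cauchy_convergent)
  then show ?thesis using A by (simp add: ext_def convergent_LIMSEQ_iff)
qed

text \<open>
This inequality, for all \<open>y\<close>, determines the extension (\<open>ext_unique\<close>), and all its properties
follow from it.
\<close>
lemma ext_diff:
  assumes \<phi>: "dominated C \<phi>" and A: "A \<in> image_closure" and y: "y \<in> Y"
  shows "cmod (ext \<phi> A - \<phi> y) \<le> C * gap A y"
proof (rule LIMSEQ_le)
  have C: "0 \<le> C" using \<phi> by (simp add: dominated_def)
  show "(\<lambda>n. cmod (\<phi> (approx A n) - \<phi> y)) \<longlonglongrightarrow> cmod (ext \<phi> A - \<phi> y)"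
    by (intro tendsto_intros approx_tendsto[OF \<phi> A])
  have "(\<lambda>n. C * (inverse (real (Suc n)) + gap A y)) \<longlonglongrightarrow> C * (0 + gap A y)"
    by (intro tendsto_intros LIMSEQ_inverse_real_of_nat)
  then show "(\<lambda>n. C * (inverse (real (Suc n)) + gap A y)) \<longlonglongrightarrow> C * gap A y" by simp
  have "cmod (\<phi> (approx A n) - \<phi> y) \<le> C * (inverse (real (Suc n)) + gap A y)" for n
  proof -
    have "cmod (\<phi> (approx A n) - \<phi> y) \<le> C * (gap A (approx A n) + gap A y)"
      by (rule dominated_diff[OF \<phi> image_closure_sub[OF A] approx(1)[OF A] y])
    also have "\<dots> \<le> C * (inverse (real (Suc n)) + gap A y)"
      using C approx(2)[OF A, of n] by (intro mult_left_mono) auto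
    finally show ?thesis .
  qed
  then show "\<exists>N. \<forall>n\<ge>N. cmod (\<phi> (approx A n) - \<phi> y) \<le> C * (inverse (real (Suc n)) + gap A y)"
    by blast
qed

lemma ext_unique:
  assumes \<phi>: "dominated C \<phi>" and A: "A \<in> image_closure"
    and w: "\<And>e. 0 < e \<Longrightarrow> \<exists>y\<in>Y. gap A y < e \<and> cmod (w - \<phi> y) \<le> B * e"
  shows "ext \<phi> A = w"
proof -
  have C: "0 \<le> C" using \<phi> by (simp add: dominated_def)
  have "cmod (ext \<phi> A - w) \<le> 0 + e" if e: "0 < e" for e
  proof -
    define d where "d = e / (C + \<bar>B\<bar> + 1)"
    have d: "0 < d" using e C unfolding d_def by (intro divide_pos_pos) auto
    have ed: "(C + \<bar>B\<bar> + 1) * d = e" using C by (simp add: d_def add_nonneg_eq_0_iff)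
    obtain y where y: "y \<in> Y" "gap A y < d" "cmod (w - \<phi> y) \<le> B * d" using w[OF d] by blast
    have "cmod (ext \<phi> A - w) \<le> cmod (ext \<phi> A - \<phi> y) + cmod (w - \<phi> y)"
      using norm_triangle_ineq4[of "ext \<phi> A - \<phi> y" "w - \<phi> y"] by simp
    also have "\<dots> \<le> C * d + \<bar>B\<bar> * d"
    proof (rule add_mono)
      show "cmod (ext \<phi> A - \<phi> y) \<le> C * d"
        using ext_diff[OF \<phi> A y(1)] mult_left_mono[OF less_imp_le[OF y(2)] C] by linarith
      show "cmod (w - \<phi> y) \<le> \<bar>B\<bar> * d"
        using y(3) mult_right_mono[OF abs_ge_self[of B] less_imp_le[OF d]] by linarith
    qed
    also have "\<dots> \<le> e" using d by (simp add: algebra_simps flip: ed)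
    finally show ?thesis by simp
  qed
  then have "cmod (ext \<phi> A - w) \<le> 0" by (rule field_le_epsilon)
  then show ?thesis by simp
qed

lemma ext_image:
  assumes "dominated C \<phi>" "y \<in> Y" shows "ext \<phi> (ae_class \<mu> (J y)) = \<phi> y"
  using ext_diff[OF assms(1) image_in_closure[OF assms(2)] assms(2)] by (simp add: gap_image assms(2))

lemma ext_bound:
  assumes \<phi>: "dominated C \<phi>" and A: "A \<in> image_closure"
  shows "cmod (ext \<phi> A) \<le> C * vnorm (Lq_space q \<mu>) A"
proof -
  obtain y where y: "y \<in> Y" using Y_nonempty by blast
  have "gap A (\<lambda>v. 0 * y v) = vnorm (Lq_space q \<mu>) A"
    unfolding gap_def J_scale[OF y] vnorm_Lq_space by simp
  moreover have "\<phi> (\<lambda>v. 0 * y v) = 0 * \<phi> y" by (rule dominatedD(3)[OF \<phi> y])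
  ultimately show ?thesis using ext_diff[OF \<phi> A Y_scale[OF y, of 0]] by simp
qed

lemma ext_in_dual:
  assumes \<phi>: "dominated C \<phi>"
  shows "ext \<phi> \<in> pts (dual (subspace_on (Lq_space q \<mu>) image_closure))"
proof -
  have C: "0 \<le> C" using \<phi> by (simp add: dominated_def)
  have add: "ext \<phi> (vadd (Lq_space q \<mu>) A B) = ext \<phi> A + ext \<phi> B" if AB: "A \<in> image_closure" "B \<in> image_closure" for A B
  proof (rule ext_unique[OF \<phi>])
    show "vadd (Lq_space q \<mu>) A B \<in> image_closure" using closed_subspace_image_closure AB by (simp add: closed_subspace_def)
    fix e :: real assume "0 < e"
    then have e2: "0 < e / 2" by simp
    obtain y where y: "y \<in> Y" "gap A y < e / 2" using AB(1) e2 unfolding image_closure_def by blast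
    obtain z where z: "z \<in> Y" "gap B z < e / 2" using AB(2) e2 unfolding image_closure_def by blast
    have "gap (vadd (Lq_space q \<mu>) A B) (\<lambda>v. y v + z v) < e"
      using gap_add[OF image_closure_sub[OF AB(1)] image_closure_sub[OF AB(2)] y(1) z(1)] y z by linarith
    moreover have "cmod (ext \<phi> A + ext \<phi> B - \<phi> (\<lambda>v. y v + z v)) \<le> C * e"
    proof -
      have "ext \<phi> A + ext \<phi> B - \<phi> (\<lambda>v. y v + z v) = (ext \<phi> A - \<phi> y) + (ext \<phi> B - \<phi> z)"
        unfolding dominatedD(2)[OF \<phi> y(1) z(1)] by simp
      also have "cmod \<dots> \<le> C * gap A y + C * gap B z"
        using ext_diff[OF \<phi> AB(1) y(1)] ext_diff[OF \<phi> AB(2) z(1)]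
        by (intro order_trans[OF norm_triangle_ineq] add_mono)
      also have "\<dots> \<le> C * (e / 2) + C * (e / 2)"
        using y z C by (intro add_mono mult_left_mono) auto
      finally show ?thesis by simp
    qed
    ultimately show "\<exists>y\<in>Y. gap (vadd (Lq_space q \<mu>) A B) y < e \<and>
        cmod (ext \<phi> A + ext \<phi> B - \<phi> y) \<le> C * e"
      using Y_add[OF y(1) z(1)] by blast
  qed
  have scale: "ext \<phi> (vscale (Lq_space q \<mu>) c A) = c * ext \<phi> A" if A: "A \<in> image_closure" for c A
  proof (rule ext_unique[OF \<phi>])
    show "vscale (Lq_space q \<mu>) c A \<in> image_closure" using closed_subspace_image_closure A by (simp add: closed_subspace_def)
    fix e :: real assume "0 < e"
    then have "0 < e / (cmod c + 1)" by (simp add: add_nonneg_pos)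
    then obtain y where y: "y \<in> Y" "gap A y < e / (cmod c + 1)" using A unfolding image_closure_def by blast
    have "cmod c * gap A y \<le> (cmod c + 1) * gap A y" by (intro mult_right_mono) auto
    also have "\<dots> < e" using y(2) by (simp add: pos_less_divide_eq add_nonneg_pos mult.commute)
    finally have ce: "cmod c * gap A y < e" .
    have "cmod (c * ext \<phi> A - \<phi> (\<lambda>v. c * y v)) = cmod c * cmod (ext \<phi> A - \<phi> y)"
      unfolding dominatedD(3)[OF \<phi> y(1)] by (simp flip: right_diff_distrib norm_mult)
    also have "\<dots> \<le> cmod c * (C * gap A y)"
      using ext_diff[OF \<phi> A y(1)] by (intro mult_left_mono) auto
    also have "\<dots> = C * (cmod c * gap A y)" by simp
    also have "\<dots> \<le> C * e" using ce C by (intro mult_left_mono) auto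
    finally show "\<exists>y\<in>Y. gap (vscale (Lq_space q \<mu>) c A) y < e \<and> cmod (c * ext \<phi> A - \<phi> y) \<le> C * e"
      using ce Y_scale[OF y(1)] by (intro bexI[of _ "\<lambda>v. c * y v"]) (simp_all only: gap_scale[OF image_closure_sub[OF A] y(1)] simp_thms)
  qed
  have "ext \<phi> A = 0" if "A \<notin> image_closure" for A using that by (simp add: ext_def)
  moreover have "\<exists>C. \<forall>A\<in>image_closure. cmod (ext \<phi> A) \<le> C * vnorm (Lq_space q \<mu>) A"
    using ext_bound[OF \<phi>] by blast
  ultimately show ?thesis using add scale by (simp add: dual_def)
qed

lemma ext_norm_le:
  assumes \<phi>: "dominated C \<phi>"
  shows "vnorm (dual (subspace_on (Lq_space q \<mu>) image_closure)) (ext \<phi>) \<le> C"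
proof (rule dual_norm_le[OF seminormed_space_image_closure])
  show "0 \<le> C" using \<phi> by (simp add: dominated_def)
qed (simp add: ext_bound[OF \<phi>])

lemma dominated_linear:
  assumes "dominated B \<phi>" "dominated C \<psi>"
  shows "dominated (cmod b * B + cmod c * C) (\<lambda>y. b * \<phi> y + c * \<psi> y)"
  unfolding dominated_def
proof (intro conjI ballI allI)
  note D = dominatedD[OF assms(1)] dominatedD[OF assms(2)]
  show "0 \<le> cmod b * B + cmod c * C" using D(1,5) by simp
  show "b * \<phi> (\<lambda>v. y v + z v) + c * \<psi> (\<lambda>v. y v + z v) = b * \<phi> y + c * \<psi> y + (b * \<phi> z + c * \<psi> z)"
    if "y \<in> Y" "z \<in> Y" for y z
    unfolding D(2)[OF that] D(6)[OF that] by (simp add: algebra_simps)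
  show "b * \<phi> (\<lambda>v. a * y v) + c * \<psi> (\<lambda>v. a * y v) = a * (b * \<phi> y + c * \<psi> y)" if "y \<in> Y" for a y
    unfolding D(3)[OF that] D(7)[OF that] by (simp add: algebra_simps)
  show "cmod (b * \<phi> y + c * \<psi> y) \<le> (cmod b * B + cmod c * C) * Lq_norm q \<mu> (J y)" if "y \<in> Y" for y
  proof -
    have "cmod (b * \<phi> y + c * \<psi> y) \<le> cmod b * cmod (\<phi> y) + cmod c * cmod (\<psi> y)"
      using norm_triangle_ineq[of "b * \<phi> y" "c * \<psi> y"] by (simp add: norm_mult)
    also have "\<dots> \<le> cmod b * (B * Lq_norm q \<mu> (J y)) + cmod c * (C * Lq_norm q \<mu> (J y))"
      using D(4)[OF that] D(8)[OF that] by (intro add_mono mult_left_mono) auto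
    finally show ?thesis by (simp add: algebra_simps)
  qed
qed

lemma dominated_sharpen:
  assumes "dominated B \<phi>" "0 \<le> C" "\<And>y. y \<in> Y \<Longrightarrow> cmod (\<phi> y) \<le> C * Lq_norm q \<mu> (J y)"
  shows "dominated C \<phi>"
  using assms unfolding dominated_def by blast

lemma ext_cong:
  assumes "\<And>y. y \<in> Y \<Longrightarrow> \<phi> y = \<psi> y" shows "ext \<phi> = ext \<psi>"
  using assms approx(1) by (simp add: ext_def fun_eq_iff cong: if_cong)

lemma ext_linear:
  assumes "dominated B \<phi>" "dominated C \<psi>"
  shows "ext (\<lambda>y. b * \<phi> y + c * \<psi> y) = (\<lambda>A. b * ext \<phi> A + c * ext \<psi> A)"
proof
  fix A
  show "ext (\<lambda>y. b * \<phi> y + c * \<psi> y) A = b * ext \<phi> A + c * ext \<psi> A"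
  proof (cases "A \<in> image_closure")
    case True
    have "(\<lambda>n. b * \<phi> (approx A n) + c * \<psi> (approx A n)) \<longlonglongrightarrow> b * ext \<phi> A + c * ext \<psi> A"
      by (intro tendsto_intros approx_tendsto[OF assms(1) True] approx_tendsto[OF assms(2) True])
    with approx_tendsto[OF dominated_linear[OF assms] True] show ?thesis by (rule LIMSEQ_unique)
  qed (simp add: ext_def)
qed

end

section \<open>The dual unit ball in the weak* topology\<close>

lemma topspace_weak_star:
  assumes "pts V \<noteq> {}" shows "topspace (weak_star V) = pts (dual V)"
proof -
  obtain x where "x \<in> pts V" using assms by blast
  then have "pts (dual V) \<in> {{\<phi> \<in> pts (dual V). \<phi> x \<in> W} | x W. x \<in> pts V \<and> open W}"
    by (intro CollectI exI[of _ x] exI[of _ UNIV]) auto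
  then show ?thesis unfolding weak_star_def topology_generated_by_topspace by blast
qed

text \<open>
Functionals vanish off the carrier, so evaluation at points outside it is constant and evaluation
at all points of the type generates the same topology. This makes the product topology on the
function type available.
\<close>
lemma weak_star_eq_product:
  assumes ne: "pts V \<noteq> {}"
  shows "weak_star V = top_of_set (pts (dual V))"
proof -
  let ?D = "pts (dual V)"
  let ?B = "{{\<phi> \<in> pts (dual V). \<phi> x \<in> W} | x W. x \<in> pts V \<and> open W}"
  have 1: "openin (top_of_set ?D) s" if "generate_topology_on ?B s" for s
    using that
  proof (induction s rule: generate_topology_on.induct)
    case (Basis s)
    then obtain x W where s: "s = {\<phi> \<in> ?D. \<phi> x \<in> W}" "open W" by blast
    have "open ((\<lambda>\<phi>. \<phi> x) -` W)"
      using continuous_on_product_coordinates[of x] s(2) by (rule open_vimage[rotated])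
    moreover have "s = ?D \<inter> (\<lambda>\<phi>. \<phi> x) -` W" using s by auto
    ultimately show ?case by (auto simp: openin_open)
  qed auto
  have coord: "continuous_map (weak_star V) euclidean (\<lambda>\<phi>. \<phi> x)" for x
  proof (cases "x \<in> pts V")
    case True
    show ?thesis
      unfolding continuous_map_def topspace_weak_star[OF ne]
    proof (intro conjI allI impI)
      fix W :: "complex set" assume "openin euclidean W"
      then have "{\<phi> \<in> ?D. \<phi> x \<in> W} \<in> ?B" using True by auto
      then show "openin (weak_star V) {\<phi> \<in> ?D. \<phi> x \<in> W}"
        unfolding weak_star_def by (rule topology_generated_by_Basis)
    qed auto
  next
    case False
    have "continuous_map (weak_star V) euclidean (\<lambda>_. 0 :: complex)" by simp
    then show ?thesis
      by (rule continuous_map_eq) (use False in \<open>auto simp: topspace_weak_star[OF ne] dualD(4)\<close>)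
  qed
  have "continuous_map (weak_star V) (product_topology (\<lambda>_. euclidean) UNIV) (\<lambda>\<phi>. \<phi>)"
    using coord by (simp add: continuous_map_componentwise_UNIV)
  then have cont: "continuous_map (weak_star V) euclidean (\<lambda>\<phi>. \<phi>)"
    by (simp add: euclidean_product_topology)
  have 2: "openin (weak_star V) s" if s: "openin (top_of_set ?D) s" for s
  proof -
    obtain G where G: "open G" "s = ?D \<inter> G" using s unfolding openin_open by blast
    have "openin (weak_star V) {\<phi> \<in> topspace (weak_star V). \<phi> \<in> G}"
      using openin_continuous_map_preimage[OF cont, of G] G(1) by simp
    moreover have "{\<phi> \<in> topspace (weak_star V). \<phi> \<in> G} = s" using G(2) by (auto simp: topspace_weak_star[OF ne])
    ultimately show ?thesis by simp
  qed
  show ?thesis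
    unfolding topology_eq using 1 2 by (auto simp: weak_star_def openin_topology_generated_by_iff)
qed

lemma ball_wstar_eq_product:
  assumes "pts V \<noteq> {}"
  shows "ball_wstar V = top_of_set (unit_ball (dual V))"
proof -
  have "pts (dual V) \<inter> unit_ball (dual V) = unit_ball (dual V)" by (auto simp: unit_ball_def)
  then show ?thesis unfolding ball_wstar_def weak_star_eq_product[OF assms] subtopology_subtopology by simp
qed

text \<open>
The dual unit ball is cut out of a product of discs by the equations of linearity, which are closed
conditions in the product topology.
\<close>
theorem Banach_Alaoglu:
  assumes V: "seminormed_space V"
  shows "compact (unit_ball (dual V))"
proof -
  define r where "r x = (if x \<in> pts V then vnorm V x else 0)" for x
  define P where "P = PiE UNIV (\<lambda>x. cball (0::complex) (r x))"
  have "compactin (product_topology (\<lambda>_. euclidean) UNIV) P"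
    unfolding P_def compactin_PiE by simp
  then have P: "compact P" by (simp add: euclidean_product_topology)
  let ?A = "\<Inter>x\<in>pts V. \<Inter>y\<in>pts V. {\<phi> :: 'a \<Rightarrow> complex. \<phi> (vadd V x y) = \<phi> x + \<phi> y}"
  let ?M = "\<Inter>c. \<Inter>x\<in>pts V. {\<phi> :: 'a \<Rightarrow> complex. \<phi> (vscale V c x) = c * \<phi> x}"
  have "closed (?A \<inter> ?M)"
    by (intro closed_Int closed_INT ballI closed_Collect_eq continuous_intros continuous_on_product_coordinates)
  moreover have "unit_ball (dual V) = P \<inter> (?A \<inter> ?M)"
  proof (rule set_eqI)
    fix \<phi>
    have "\<phi> \<in> P \<longleftrightarrow> (\<forall>x\<in>pts V. cmod (\<phi> x) \<le> vnorm V x) \<and> (\<forall>x. x \<notin> pts V \<longrightarrow> \<phi> x = 0)"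
      by (auto simp: P_def r_def PiE_UNIV_domain Pi_iff)
    moreover have "\<exists>C. \<forall>x\<in>pts V. cmod (\<phi> x) \<le> C * vnorm V x" if "\<forall>x\<in>pts V. cmod (\<phi> x) \<le> vnorm V x"
      using that by (intro exI[of _ 1]) simp
    ultimately show "\<phi> \<in> unit_ball (dual V) \<longleftrightarrow> \<phi> \<in> P \<inter> (?A \<inter> ?M)"
      unfolding unit_ball_dual_iff[OF V] by (auto simp: dual_def)
  qed
  ultimately show ?thesis using compact_Int_closed[OF P] by simp
qed

lemma ball_wstar_compact_Hausdorff:
  assumes V: "seminormed_space V"
  shows "compact_space (ball_wstar V)" "Hausdorff_space (ball_wstar V)"
    "topspace (ball_wstar V) = unit_ball (dual V)"
proof -
  note eq = ball_wstar_eq_product[OF seminormed_spaceD(1)[OF V]]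
  show "compact_space (ball_wstar V)"
    using Banach_Alaoglu[OF V] unfolding eq by (simp add: compact_space_subtopology)
  have "Hausdorff_space (euclidean :: ('a \<Rightarrow> complex) topology)"
    unfolding euclidean_product_topology[symmetric] Hausdorff_space_product_topology by simp
  then show "Hausdorff_space (ball_wstar V)" unfolding eq by (rule Hausdorff_space_subtopology)
  show "topspace (ball_wstar V) = unit_ball (dual V)" unfolding eq by simp
qed

section \<open>Cauchy estimates along complex lines\<close>

text \<open>
By Cauchy's inequality the Taylor coefficients at \<open>0\<close> are at most \<open>M / R ^ n\<close>; the terms of order
at least two, at the point \<open>1\<close>, form a series dominated by a geometric one with ratio \<open>1 / 2\<close>.
\<close>
lemma second_order_remainder:
  assumes hol: "\<phi> holomorphic_on ball 0 R" and cont: "continuous_on (cball 0 R) \<phi>" and R: "2 \<le> R"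
    and M: "\<And>z. cmod z = R \<Longrightarrow> cmod (\<phi> z) \<le> M"
  shows "cmod (\<phi> 1 - \<phi> 0 - deriv \<phi> 0) \<le> 2 * M / R\<^sup>2"
proof -
  define a where "a n = (deriv ^^ n) \<phi> 0 / fact n" for n
  have a_le: "cmod (a n) \<le> M / R ^ n" for n
  proof -
    have "cmod ((deriv ^^ n) \<phi> 0) \<le> fact n * M / R ^ n"
      using R M by (intro Cauchy_inequality[OF hol cont]) auto
    then show ?thesis by (simp add: a_def norm_divide field_simps)
  qed
  have M0: "0 \<le> M" using order_trans[OF norm_ge_zero M[of "of_real R"]] R by simp
  have "(\<lambda>n. a n * (1 - 0) ^ n) sums \<phi> 1"
    unfolding a_def using R by (intro holomorphic_power_series[OF hol]) auto
  then have "(\<lambda>n. a (n + 2)) sums (\<phi> 1 - (\<Sum>i<2. a i))"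
    using sums_split_initial_segment[of a "\<phi> 1" 2] by simp
  moreover have "(\<Sum>i<2. a i) = \<phi> 0 + deriv \<phi> 0" by (simp add: a_def numeral_2_eq_2)
  ultimately have s: "(\<lambda>n. a (n + 2)) sums (\<phi> 1 - \<phi> 0 - deriv \<phi> 0)" by (simp add: algebra_simps)
  have t: "(\<lambda>n. M / R\<^sup>2 * (1/2) ^ n) sums (M / R\<^sup>2 * 2)"
    using geometric_sums[of "1/2 :: real"] by (intro sums_mult) simp
  have "cmod (a (n + 2)) \<le> M / R\<^sup>2 * (1/2) ^ n" for n
  proof -
    have "cmod (a (n + 2)) \<le> M / R\<^sup>2 * (1 / R) ^ n"
      using a_le[of "n + 2"] by (simp add: power_add power_divide mult.commute[of "R ^ n"] del: add_2_eq_Suc')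
    also have "\<dots> \<le> M / R\<^sup>2 * (1 / 2) ^ n"
      using M0 R by (intro mult_left_mono power_mono) (auto simp: field_simps)
    finally show ?thesis .
  qed
  from norm_sums_le[OF s t this] show ?thesis by (simp add: mult.commute)
qed

lemma line_derivative:
  fixes f :: "'e::complex_banach \<Rightarrow> 'f::complex_banach"
  assumes y: "y \<in> pts Fstar" and f: "(f has_derivative D) (at (x + t *\<^sub>C h))"
    and D: "\<And>c h. D (c *\<^sub>C h) = c *\<^sub>C D h"
  shows "((\<lambda>t. y (f (x + t *\<^sub>C h))) has_field_derivative y (D h)) (at t)"
proof -
  have yb: "bounded_linear y" and yc: "\<And>c v. y (c *\<^sub>C v) = c * y v"
    using y by (auto simp: pts_dual_tspace)
  have "bounded_linear (\<lambda>s. s *\<^sub>C h)"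
    by (rule bounded_linear_intro[where K = "norm h"])
      (auto simp: scaleC_add_left scaleR_scaleC scaleC_scaleC scaleR_conv_of_real norm_scaleC)
  then have "((\<lambda>s. s *\<^sub>C h) has_derivative (\<lambda>s. s *\<^sub>C h)) (at t)"
    by (rule bounded_linear_imp_has_derivative)
  then have l: "((\<lambda>s. x + s *\<^sub>C h) has_derivative (\<lambda>s. s *\<^sub>C h)) (at t)"
    using has_derivative_add[OF has_derivative_const] by fastforce
  have "((\<lambda>t. y (f (x + t *\<^sub>C h))) has_derivative (\<lambda>s. y (D (s *\<^sub>C h)))) (at t)"
    by (intro bounded_linear.has_derivative[OF yb] has_derivative_compose[OF l f])
  moreover have "(\<lambda>s. y (D (s *\<^sub>C h))) = (*) (y (D h))" by (auto simp: D yc)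
  ultimately show ?thesis unfolding has_field_derivative_def by simp
qed

text \<open>
Apply the one variable estimates to \<open>\<lambda>t. y (f (x + t *\<^sub>C h))\<close> on the disc of radius \<open>\<rho> / norm h\<close>.
The bounds are multiples of \<open>M\<close>, whatever the norm of \<open>y\<close>.
\<close>
lemma weak_cauchy_estimates:
  fixes f :: "'e::complex_banach \<Rightarrow> 'f::complex_banach"
  assumes U: "open U" and f: "holomorphic_into U tspace f" and x: "cball x \<rho> \<subseteq> U" and \<rho>: "0 < \<rho>"
    and y: "y \<in> pts Fstar" and M: "\<And>z. z \<in> U \<Longrightarrow> cmod (y (f z)) \<le> M"
    and Dx: "(f has_derivative D) (at x)" and D: "\<And>c h. D (c *\<^sub>C h) = c *\<^sub>C D h"
  shows "cmod (y (D h)) \<le> M / \<rho> * norm h"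
    and "norm h \<le> \<rho> / 2 \<Longrightarrow> cmod (y (f (x + h)) - y (f x) - y (D h)) \<le> 2 * M / \<rho>\<^sup>2 * (norm h)\<^sup>2"
proof -
  have "cmod (y (D h)) \<le> M / \<rho> * norm h \<and>
    (norm h \<le> \<rho> / 2 \<longrightarrow> cmod (y (f (x + h)) - y (f x) - y (D h)) \<le> 2 * M / \<rho>\<^sup>2 * (norm h)\<^sup>2)"
  proof (cases "h = 0")
    case True
    have "D 0 = 0" by (rule linear_0[OF has_derivative_linear[OF Dx]])
    have "bounded_linear y" using y by (simp add: pts_dual_tspace)
    then have "y 0 = 0" by (rule linear_0[OF bounded_linear.linear])
    with \<open>D 0 = 0\<close> show ?thesis using True by simp
  next
    case False
    define R where "R = \<rho> / norm h"
    define \<phi> where "\<phi> t = y (f (x + t *\<^sub>C h))" for t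
    have R: "0 < R" using False \<rho> by (simp add: R_def)
    have inU: "x + t *\<^sub>C h \<in> U" if "t \<in> cball 0 R" for t
    proof -
      have "norm (t *\<^sub>C h) \<le> \<rho>" using that False by (simp add: norm_scaleC R_def field_simps)
      then show ?thesis using x by (auto simp: dist_norm)
    qed
    have diff: "\<exists>d. (\<phi> has_field_derivative d) (at t)" if t: "t \<in> cball 0 R" for t
    proof -
      obtain D' where "(f has_derivative D') (at (x + t *\<^sub>C h))" "\<forall>c h. D' (c *\<^sub>C h) = c *\<^sub>C D' h"
        using f inU[OF t] unfolding holomorphic_into_tspace[OF U] by blast
      then show ?thesis unfolding \<phi>_def using line_derivative[OF y] by blast
    qed
    have hol: "\<phi> holomorphic_on ball 0 R"
      unfolding holomorphic_on_def field_differentiable_def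
    proof
      fix t :: complex assume "t \<in> ball 0 R"
      then obtain d where "(\<phi> has_field_derivative d) (at t)" using diff[of t] by auto
      then show "\<exists>d. (\<phi> has_field_derivative d) (at t within ball 0 R)"
        using has_field_derivative_at_within by blast
    qed
    have cont: "continuous_on (cball 0 R) \<phi>"
      using diff by (meson DERIV_isCont continuous_at_imp_continuous_on)
    have M': "cmod (\<phi> z) \<le> M" if "cmod z = R" for z
      using M[OF inU[of z]] that by (simp add: \<phi>_def)
    have zero: "0 *\<^sub>C h = 0" "1 *\<^sub>C h = h" using scaleR_scaleC[of 0 h] by (simp_all add: scaleC_one)
    have d0: "deriv \<phi> 0 = y (D h)"
      unfolding \<phi>_def by (intro DERIV_imp_deriv line_derivative[OF y _ D]) (simp add: zero Dx)
    have "cmod ((deriv ^^ 1) \<phi> 0) \<le> fact 1 * M / R ^ 1"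
      using R M' by (intro Cauchy_inequality[OF hol cont]) auto
    then have 1: "cmod (y (D h)) \<le> M / \<rho> * norm h" by (simp add: d0 R_def)
    have "cmod (y (f (x + h)) - y (f x) - y (D h)) \<le> 2 * M / \<rho>\<^sup>2 * (norm h)\<^sup>2" if "norm h \<le> \<rho> / 2"
    proof -
      have "2 \<le> R" using that False by (simp add: R_def field_simps)
      from second_order_remainder[OF hol cont this M'] show ?thesis
        unfolding d0 by (simp add: \<phi>_def zero R_def power_divide)
    qed
    with 1 show ?thesis by blast
  qed
  then show "cmod (y (D h)) \<le> M / \<rho> * norm h"
    "norm h \<le> \<rho> / 2 \<Longrightarrow> cmod (y (f (x + h)) - y (f x) - y (D h)) \<le> 2 * M / \<rho>\<^sup>2 * (norm h)\<^sup>2"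
    by blast+
qed

section \<open>The conjugate index and finite sequences\<close>

lemma conj_index_ge_1:
  assumes "1 < p" shows "1 \<le> conj_index p"
proof (cases p)
  case (real r)
  then have "1 < r" using assms by simp
  then show ?thesis using real by (simp add: conj_index_def field_simps)
qed (use assms in \<open>simp_all add: conj_index_def\<close>)

lemma conj_index_finite:
  assumes "1 < p" "p \<noteq> \<infinity>"
  defines "r \<equiv> real_of_ereal p" and "q \<equiv> conj_index p"
  shows "1 < r" "1 < q" "1 / r + 1 / q = 1" "(q - 1) * r = q"
proof -
  show r: "1 < r" using assms by (cases p) auto
  have q: "q = r / (r - 1)" using assms by (simp add: conj_index_def)
  show "1 < q" "1 / r + 1 / q = 1" "(q - 1) * r = q"
    unfolding q using r by (auto simp: field_simps)
qed

lemma lp_norm_nonneg: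
  assumes "1 \<le> n" shows "0 \<le> lp_norm p n \<alpha>"
proof -
  have "0 \<le> Max ((\<lambda>i. cmod (\<alpha> i)) ` {1..n})"
    using assms by (intro order_trans[OF norm_ge_zero Max_ge]) auto
  then show ?thesis by (simp add: lp_norm_def)
qed

lemma Holder_inequality_sum:
  fixes a b :: "'i \<Rightarrow> real"
  assumes p: "1 < p" "1 < q" "1 / p + 1 / q = 1" and "finite I"
    and a: "\<And>i. i \<in> I \<Longrightarrow> 0 \<le> a i" and b: "\<And>i. i \<in> I \<Longrightarrow> 0 \<le> b i"
  shows "(\<Sum>i\<in>I. a i * b i) \<le> (\<Sum>i\<in>I. a i powr p) powr (1 / p) * (\<Sum>i\<in>I. b i powr q) powr (1 / q)"
proof -
  define A where "A = (\<Sum>i\<in>I. a i powr p)"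
  define B where "B = (\<Sum>i\<in>I. b i powr q)"
  have nn: "0 \<le> A" "0 \<le> B" by (auto simp: A_def B_def intro: sum_nonneg)
  consider "A = 0" | "B = 0" | "0 < A" "0 < B" using nn by linarith
  then have "(\<Sum>i\<in>I. a i * b i) \<le> A powr (1 / p) * B powr (1 / q)"
  proof cases
    case 1
    then have "\<forall>i\<in>I. a i powr p = 0" using \<open>finite I\<close> unfolding A_def by (subst (asm) sum_nonneg_eq_0_iff) auto
    then show ?thesis using 1 by simp
  next
    case 2
    then have "\<forall>i\<in>I. b i powr q = 0" using \<open>finite I\<close> unfolding B_def by (subst (asm) sum_nonneg_eq_0_iff) auto
    then show ?thesis using 2 by simp
  next
    case 3
    define u where "u = A powr (1 / p)"
    define v where "v = B powr (1 / q)"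
    have uv: "0 < u" "0 < v" "u powr p = A" "v powr q = B"
      using 3 p by (auto simp: u_def v_def powr_powr)
    have "(\<Sum>i\<in>I. a i / u * (b i / v)) \<le> (\<Sum>i\<in>I. (a i / u) powr p / p + (b i / v) powr q / q)"
      using uv a b by (intro sum_mono Youngs_inequality p) auto
    also have "\<dots> = (\<Sum>i\<in>I. a i powr p / A / p + b i powr q / B / q)"
      using uv a b by (intro sum.cong) (auto simp: powr_divide)
    also have "\<dots> = A / A / p + B / B / q"
      by (simp add: sum.distrib A_def B_def flip: sum_divide_distrib)
    also have "\<dots> = 1" using 3 p by simp
    finally have "(\<Sum>i\<in>I. a i * b i) / (u * v) \<le> 1" by (simp add: sum_divide_distrib)
    then show ?thesis using uv by (simp add: u_def v_def)
  qed
  then show ?thesis by (simp add: A_def B_def)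
qed

text \<open>
For infinite \<open>p\<close> this is the trivial estimate with the maximum, and the conjugate index is \<open>1\<close>.
\<close>
lemma lp_norm_Holder:
  assumes p: "1 < p" and n: "1 \<le> n" and b: "\<And>i. i \<in> {1..n} \<Longrightarrow> 0 \<le> b i"
  shows "(\<Sum>i=1..n. cmod (\<alpha> i) * b i) \<le>
    lp_norm p n \<alpha> * (\<Sum>i=1..n. b i powr conj_index p) powr (1 / conj_index p)"
proof (cases "p = \<infinity>")
  case True
  have "(\<Sum>i=1..n. cmod (\<alpha> i) * b i) \<le> (\<Sum>i=1..n. Max ((\<lambda>i. cmod (\<alpha> i)) ` {1..n}) * b i)"
    using b by (intro sum_mono mult_right_mono Max_ge) auto
  also have "\<dots> = lp_norm p n \<alpha> * (\<Sum>i=1..n. b i)" by (simp add: lp_norm_def True sum_distrib_left)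
  also have "(\<Sum>i=1..n. b i) = (\<Sum>i=1..n. b i powr 1) powr 1"
    using b sum_nonneg[of "{1..n}" b] by simp
  finally show ?thesis by (simp add: True conj_index_def)
next
  case False
  then show ?thesis
    using Holder_inequality_sum[OF conj_index_finite(1-3)[OF p False], of "{1..n}" "\<lambda>i. cmod (\<alpha> i)" b] b
    by (simp add: lp_norm_def)
qed

text \<open>
The weak \<open>\<ell>\<^sub>q\<close>-norm of a finite sequence in the dual of \<open>F\<close>.
\<close>
definition weak_norm :: "real \<Rightarrow> nat \<Rightarrow> (nat \<Rightarrow> 'f::complex_banach \<Rightarrow> complex) \<Rightarrow> real" where
  "weak_norm q n y = (SUP \<Phi>\<in>unit_ball (dual Fstar). (\<Sum>i=1..n. cmod (\<Phi> (y i)) powr q) powr (1 / q))"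

lemma seminormed_space_Fstar: "seminormed_space Fstar"
  by (rule seminormed_space_dual[OF seminormed_space_tspace])

lemma bidual_ball_nonempty: "unit_ball (dual Fstar) \<noteq> {}"
  by (rule unit_ball_nonempty[OF seminormed_space_dual[OF seminormed_space_Fstar]])

lemma bidual_ball_le:
  assumes "\<Phi> \<in> unit_ball (dual Fstar)" "y \<in> pts Fstar" shows "cmod (\<Phi> y) \<le> vnorm Fstar y"
  using assms unfolding unit_ball_dual_iff[OF seminormed_space_Fstar] by blast

lemma weak_norm_upper:
  assumes q: "1 \<le> q" and y: "\<And>i. i \<in> {1..n} \<Longrightarrow> y i \<in> pts Fstar" and \<Phi>: "\<Phi> \<in> unit_ball (dual Fstar)"
  shows "(\<Sum>i=1..n. cmod (\<Phi> (y i)) powr q) powr (1 / q) \<le> weak_norm q n y"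
  unfolding weak_norm_def
proof (rule cSUP_upper[OF \<Phi>])
  have "(\<Sum>i=1..n. cmod (\<Psi> (y i)) powr q) powr (1 / q) \<le> (\<Sum>i=1..n. vnorm Fstar (y i) powr q) powr (1 / q)"
    if "\<Psi> \<in> unit_ball (dual Fstar)" for \<Psi>
    using q by (intro powr_mono2 sum_mono bidual_ball_le[OF that] y sum_nonneg) auto
  then show "bdd_above ((\<lambda>\<Phi>. (\<Sum>i=1..n. cmod (\<Phi> (y i)) powr q) powr (1 / q)) ` unit_ball (dual Fstar))"
    by (auto simp: bdd_above_def)
qed

lemma weak_norm_nonneg:
  assumes "1 \<le> q" "\<And>i. i \<in> {1..n} \<Longrightarrow> y i \<in> pts Fstar"
  shows "0 \<le> weak_norm q n y"
proof -
  obtain \<Phi> where \<Phi>: "\<Phi> \<in> unit_ball (dual (Fstar :: ('a \<Rightarrow> complex) cnspace))"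
    using bidual_ball_nonempty by blast
  from weak_norm_upper[OF assms this] show ?thesis by (rule order_trans[OF powr_ge_zero])
qed

lemma cohen_const_iff:
  "cohen_const p U f C \<longleftrightarrow> 0 \<le> C \<and>
    (\<forall>n\<ge>1. \<forall>\<alpha> x y. (\<forall>i\<in>{1..n}. x i \<in> U \<and> y i \<in> pts Fstar) \<longrightarrow>
      (\<Sum>i=1..n. cmod (\<alpha> i) * cmod (y i (f (x i)))) \<le> C * lp_norm p n \<alpha> * weak_norm (conj_index p) n y)"
  unfolding cohen_const_def weak_norm_def ..

text \<open>
The scalars are eliminated from the Cohen inequality by choosing them for equality in Hoelder's
inequality. For infinite \<open>p\<close> they are all \<open>1\<close>.
\<close>
lemma cohen_const_lq:
  fixes f :: "'e::complex_banach \<Rightarrow> 'f::complex_banach"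
  assumes C: "cohen_const p U f C" and p: "1 < p" and n: "1 \<le> n"
    and xy: "\<forall>i\<in>{1..n}. x i \<in> U \<and> y i \<in> pts Fstar"
  shows "(\<Sum>i=1..n. cmod (y i (f (x i))) powr conj_index p) powr (1 / conj_index p)
    \<le> C * weak_norm (conj_index p) n y"
proof -
  let ?q = "conj_index p"
  define b where "b i = cmod (y i (f (x i)))" for i
  have W: "0 \<le> weak_norm ?q n y"
    using xy by (intro weak_norm_nonneg conj_index_ge_1 p) auto
  have C0: "0 \<le> C" using C by (simp add: cohen_const_iff)
  have main: "(\<Sum>i=1..n. cmod (\<alpha> i) * b i) \<le> C * lp_norm p n \<alpha> * weak_norm ?q n y" for \<alpha>
    using C n xy unfolding cohen_const_iff b_def by blast
  have "(\<Sum>i=1..n. b i powr ?q) powr (1 / ?q) \<le> C * weak_norm ?q n y"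
  proof (cases "p = \<infinity>")
    case True
    have "(\<lambda>i. cmod 1) ` {1..n} = {1}" using n by auto
    then have "lp_norm p n (\<lambda>_. 1) = 1" by (simp add: lp_norm_def True)
    then have "(\<Sum>i=1..n. b i) \<le> C * weak_norm ?q n y" using main[of "\<lambda>_. 1"] by simp
    moreover have "(\<Sum>i=1..n. b i powr 1) powr 1 = (\<Sum>i=1..n. b i)"
      by (simp add: b_def sum_nonneg)
    ultimately show ?thesis by (simp add: True conj_index_def b_def sum_nonneg)
  next
    case False
    define r where "r = real_of_ereal p"
    define q where "q = conj_index p"
    note rq = conj_index_finite[OF p False, folded r_def q_def]
    define B where "B = (\<Sum>i=1..n. b i powr q)"
    have B0: "0 \<le> B" by (auto simp: B_def intro: sum_nonneg)
    show ?thesis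
    proof (cases "B = 0")
      case True
      then show ?thesis using C0 W by (simp add: B_def q_def)
    next
      case False
      then have B: "0 < B" using B0 by simp
      \<comment> \<open>Since \<open>(q - 1) * r = q\<close>, both sides of the Cohen inequality become powers of \<open>B\<close>.\<close>
      define \<alpha> where "\<alpha> i = complex_of_real (b i powr (q - 1))" for i
      have "cmod (\<alpha> i) powr r = b i powr q" for i
        using rq by (simp add: \<alpha>_def powr_powr)
      then have "lp_norm p n \<alpha> = B powr (1 / r)"
        using \<open>p \<noteq> \<infinity>\<close> by (simp add: lp_norm_def B_def flip: r_def)
      moreover have "cmod (\<alpha> i) * b i = b i powr q" for i
      proof (cases "b i = 0")
        case False
        then have "0 < b i" by (simp add: b_def)
        then show ?thesis using powr_add[of "b i" "q - 1" 1] by (simp add: \<alpha>_def)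
      qed simp
      ultimately have "B \<le> C * B powr (1 / r) * weak_norm q n y"
        using main[of \<alpha>] by (simp add: B_def q_def)
      moreover have "B = B powr (1 / r) * B powr (1 / q)"
        using B rq(3) by (simp flip: powr_add)
      ultimately have "B powr (1 / r) * B powr (1 / q) \<le> B powr (1 / r) * (C * weak_norm q n y)"
        by (simp add: mult_ac)
      then have "B powr (1 / q) \<le> C * weak_norm q n y" using B by simp
      then show ?thesis by (simp add: B_def q_def)
    qed
  qed
  then show ?thesis by (simp add: b_def)
qed

section \<open>Pietsch domination\<close>

lemma iota_apply: "\<Phi> \<in> unit_ball (dual V) \<Longrightarrow> iota V x \<Phi> = \<Phi> x"
  by (simp add: iota_def)

lemma continuous_map_iota:
  assumes V: "seminormed_space V"
  shows "continuous_map (ball_wstar V) euclidean (iota V x)"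
proof -
  note eq = ball_wstar_eq_product[OF seminormed_spaceD(1)[OF V]]
  have "continuous_on (unit_ball (dual V)) (\<lambda>\<Phi>. \<Phi> x)"
    by (rule continuous_on_subset[OF continuous_on_product_coordinates]) simp
  then have "continuous_map (ball_wstar V) euclidean (\<lambda>\<Phi>. \<Phi> x)" unfolding eq by simp
  then show ?thesis
    by (rule continuous_map_eq) (simp add: ball_wstar_compact_Hausdorff(3)[OF V] iota_apply)
qed

lemma Lq_embedding_iota:
  fixes \<mu> :: "(('f::complex_banach \<Rightarrow> complex) \<Rightarrow> complex) measure"
  assumes \<mu>: "regular_borel_prob (ball_wstar Fstar) \<mu>" and q: "1 \<le> q"
  shows "Lq_embedding q \<mu> (pts Fstar) (iota Fstar)"
proof
  note F = seminormed_space_Fstar[where 'a = 'f]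
  interpret prob_space \<mu> by (rule regular_borel_probD(1)[OF \<mu>])
  show "1 \<le> q" by (rule q)
  show "pts (Fstar :: ('f \<Rightarrow> complex) cnspace) \<noteq> {}" by (rule seminormed_spaceD(1)[OF F])
  show "(\<lambda>v. c * y v) \<in> pts Fstar" if "y \<in> pts Fstar" for y :: "'f \<Rightarrow> complex" and c
    using seminormed_spaceD(3)[OF F that, of c] by simp
  show "(\<lambda>v. y v + z v) \<in> pts Fstar" if "y \<in> pts Fstar" "z \<in> pts Fstar" for y z :: "'f \<Rightarrow> complex"
    using that by (auto simp: pts_dual_tspace distrib_left intro: bounded_linear_add)
  show "iota Fstar y \<in> Lq_fun q \<mu>" if y: "y \<in> pts Fstar" for y :: "'f \<Rightarrow> complex"
  proof -
    have m: "iota Fstar y \<in> borel_measurable \<mu>"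
      by (rule continuous_map_borel_measurable[OF \<mu> continuous_map_iota[OF F]])
    have "norm (cmod (iota Fstar y \<Phi>) powr q) \<le> vnorm Fstar y powr q" for \<Phi>
      using bidual_ball_le[OF _ y, of \<Phi>] q by (auto simp: iota_def intro!: powr_mono2)
    then have "integrable \<mu> (\<lambda>\<Phi>. cmod (iota Fstar y \<Phi>) powr q)"
      using m by (intro integrable_const_bound[where B = "vnorm Fstar y powr q"]) auto
    then show ?thesis using m by (simp add: Lq_fun_def)
  qed
  have B: "\<Phi> \<in> pts (dual Fstar)" if "\<Phi> \<in> unit_ball (dual Fstar)" for \<Phi> :: "('f \<Rightarrow> complex) \<Rightarrow> complex"
    using that by (simp add: unit_ball_def)
  show "iota Fstar (\<lambda>v. y v + z v) = (\<lambda>t. iota Fstar y t + iota Fstar z t)"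
    if "y \<in> pts Fstar" "z \<in> pts Fstar" for y z :: "'f \<Rightarrow> complex"
    using dualD(1)[OF B that] by (auto simp: iota_def)
  show "iota Fstar (\<lambda>v. c * y v) = (\<lambda>t. c * iota Fstar y t)"
    if "y \<in> pts Fstar" for y :: "'f \<Rightarrow> complex" and c
    using dualD(2)[OF B that, of _ c] by (auto simp: iota_def)
qed

text \<open>
The functions \<open>u (x, y)\<close> below generate the cone to which \<open>positive_functional_on_cone\<close> is applied.
Their finite sums already form a cone: multiplying \<open>y\<close> by a \<open>q\<close>-th root of \<open>c\<close> multiplies
\<open>u (x, y)\<close> by \<open>c\<close> on the unit ball. By the Cohen inequality these sums have nonnegative
suprema.
\<close>
theorem Pietsch_domination:
  fixes f :: "'e::complex_banach \<Rightarrow> 'f::complex_banach"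
  assumes C: "cohen_const p U f C" and p: "1 < p"
  shows "\<exists>\<mu>. regular_borel_prob (ball_wstar Fstar) \<mu> \<and>
    (\<forall>x\<in>U. \<forall>y\<in>pts Fstar. cmod (y (f x)) \<le> C * Lq_norm (conj_index p) \<mu> (iota Fstar y))"
proof -
  define q where "q = conj_index p"
  have q: "1 \<le> q" unfolding q_def by (rule conj_index_ge_1[OF p])
  have C0: "0 \<le> C" using C by (simp add: cohen_const_def)
  define K where "K = unit_ball (dual (Fstar :: ('f \<Rightarrow> complex) cnspace))"
  note F = seminormed_space_Fstar[where 'a = 'f]
  note T = ball_wstar_compact_Hausdorff[OF F, folded K_def]
  define u where "u = (\<lambda>(x, y) \<Phi>. C powr q * cmod (\<Phi> y) powr q - cmod (y (f x)) powr q)"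
  let ?P = "U \<times> pts (Fstar :: ('f \<Rightarrow> complex) cnspace)"
  define Q where "Q = {h. \<exists>ps. set ps \<subseteq> ?P \<and> (\<forall>\<Phi>\<in>K. h \<Phi> = (\<Sum>s\<leftarrow>ps. u s \<Phi>))}"
  have bK: "bounded_fun_on K (\<lambda>\<Phi>. cmod (\<Phi> y) powr q)" if "y \<in> pts Fstar" for y
    using bidual_ball_le[OF _ that] q
    by (intro bounded_fun_onI[where M = "vnorm Fstar y powr q"]) (auto simp: K_def intro!: powr_mono2)
  have bu: "bounded_fun_on K (u s)" if "s \<in> ?P" for s
    using that bounded_fun_on_minus_const[OF bounded_fun_on_cmult[OF bK]] by (auto simp: u_def)
  have bl: "bounded_fun_on K (\<lambda>\<Phi>. \<Sum>s\<leftarrow>ps. u s \<Phi>)" if "set ps \<subseteq> ?P" for ps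
    using that by (induction ps) (auto intro!: bounded_fun_on_add bu)
  have "sup_nonneg_cone K Q"
    unfolding sup_nonneg_cone_def
  proof (intro conjI ballI allI impI)
    show "(\<lambda>_. 0) \<in> Q" unfolding Q_def by (intro CollectI exI[of _ "[]"]) simp
    show "bounded_fun_on K h" if "h \<in> Q" for h
    proof -
      obtain ps where "set ps \<subseteq> ?P" "\<forall>\<Phi>\<in>K. h \<Phi> = (\<Sum>s\<leftarrow>ps. u s \<Phi>)" using \<open>h \<in> Q\<close> unfolding Q_def by blast
      then show ?thesis using bl[of ps] by (simp add: bounded_fun_on_def)
    qed
    show "(\<lambda>t. h t + k t) \<in> Q" if hk: "h \<in> Q" "k \<in> Q" for h k
    proof -
      obtain ps where "set ps \<subseteq> ?P" "\<forall>\<Phi>\<in>K. h \<Phi> = (\<Sum>s\<leftarrow>ps. u s \<Phi>)" using hk(1) unfolding Q_def by blast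
      moreover obtain qs where "set qs \<subseteq> ?P" "\<forall>\<Phi>\<in>K. k \<Phi> = (\<Sum>s\<leftarrow>qs. u s \<Phi>)" using hk(2) unfolding Q_def by blast
      ultimately show ?thesis unfolding Q_def by (intro CollectI exI[of _ "ps @ qs"]) simp
    qed
    show "(\<lambda>t. c * h t) \<in> Q" if c: "0 < c" and h: "h \<in> Q" for c h
    proof -
      obtain ps where ps: "set ps \<subseteq> ?P" "\<forall>\<Phi>\<in>K. h \<Phi> = (\<Sum>s\<leftarrow>ps. u s \<Phi>)" using h unfolding Q_def by blast
      define d where "d = complex_of_real (c powr (1 / q))"
      define m where "m = (\<lambda>(x :: 'e, y :: 'f \<Rightarrow> complex). (x, \<lambda>v. d * y v))"
      have dq: "cmod d powr q = c" using c q by (simp add: d_def powr_powr)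
      have mP: "m s \<in> ?P" if "s \<in> ?P" for s
        using that seminormed_spaceD(3)[OF F, of _ d] by (auto simp: m_def)
      have um: "u (m s) \<Phi> = c * u s \<Phi>" if s: "s \<in> ?P" and \<Phi>: "\<Phi> \<in> K" for s \<Phi>
      proof -
        obtain x y where xy: "s = (x, y)" "y \<in> pts Fstar" using s by auto
        have "\<Phi> \<in> pts (dual Fstar)" using \<Phi> by (simp add: K_def unit_ball_def)
        then have "\<Phi> (\<lambda>v. d * y v) = d * \<Phi> y" using dualD(2)[of \<Phi> Fstar y d] xy by simp
        then show ?thesis
          by (simp add: u_def m_def xy norm_mult powr_mult dq algebra_simps)
      qed
      have "c * h \<Phi> = (\<Sum>s\<leftarrow>map m ps. u s \<Phi>)" if \<Phi>: "\<Phi> \<in> K" for \<Phi>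
      proof -
        have "map (\<lambda>s. c * u s \<Phi>) ps = map (\<lambda>s. u (m s) \<Phi>) ps"
          using ps(1) um[OF _ \<Phi>] by (intro map_cong) auto
        then have "(\<Sum>s\<leftarrow>ps. c * u s \<Phi>) = (\<Sum>s\<leftarrow>ps. u (m s) \<Phi>)" by (simp only:)
        then show ?thesis using ps(2) \<Phi> by (simp add: o_def sum_list_const_mult)
      qed
      moreover have "set (map m ps) \<subseteq> ?P" using ps(1) mP unfolding set_map by blast
      ultimately show ?thesis unfolding Q_def by blast
    qed
    show "\<exists>\<Phi>\<in>K. - e < h \<Phi>" if h: "h \<in> Q" and e: "0 < e" for h e
    proof (rule ccontr)
      assume "\<not> ?thesis"
      then have le: "\<And>\<Phi>. \<Phi> \<in> K \<Longrightarrow> h \<Phi> \<le> - e" by force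
      obtain ps where ps: "\<forall>\<Phi>\<in>K. h \<Phi> = (\<Sum>s\<leftarrow>ps. u s \<Phi>)" "set ps \<subseteq> ?P" using h unfolding Q_def by blast
      define n where "n = length ps"
      define x where "x i = fst (ps ! (i - 1))" for i
      define y where "y i = snd (ps ! (i - 1))" for i
      define B where "B = (\<Sum>i=1..n. cmod (y i (f (x i))) powr q)"
      have xy: "\<forall>i\<in>{1..n}. x i \<in> U \<and> y i \<in> pts Fstar"
      proof
        fix i assume "i \<in> {1..n}"
        then have "ps ! (i - 1) \<in> set ps" by (auto simp: n_def)
        then show "x i \<in> U \<and> y i \<in> pts Fstar" using ps(2) by (auto simp: x_def y_def mem_Times_iff)
      qed
      have hs: "h \<Phi> = C powr q * (\<Sum>i=1..n. cmod (\<Phi> (y i)) powr q) - B" if "\<Phi> \<in> K" for \<Phi>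
      proof -
        have "h \<Phi> = (\<Sum>i<n. u (ps ! i) \<Phi>)"
          using ps(1) that by (simp add: n_def sum_list_sum_nth atLeast0LessThan)
        also have "\<dots> = (\<Sum>i=1..n. u (ps ! (i - 1)) \<Phi>)"
          by (rule sum.reindex_bij_witness[where i = "\<lambda>i. i - 1" and j = Suc]) auto
        also have "\<dots> = (\<Sum>i=1..n. C powr q * cmod (\<Phi> (y i)) powr q - cmod (y i (f (x i))) powr q)"
          by (simp add: u_def x_def y_def case_prod_beta)
        finally show ?thesis by (simp add: B_def sum_subtractf sum_distrib_left)
      qed
      \<comment> \<open>The Cohen inequality speaks of nonempty sequences only; the empty sum is \<open>0\<close> and is excluded first.\<close>
      obtain \<Phi>0 where \<Phi>0: "\<Phi>0 \<in> K" using bidual_ball_nonempty unfolding K_def by blast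
      have n: "1 \<le> n"
      proof (rule ccontr)
        assume "\<not> 1 \<le> n"
        then have "ps = []" by (simp add: n_def not_le)
        then have "h \<Phi>0 = 0" using ps(1) \<Phi>0 by simp
        then show False using le[OF \<Phi>0] e by simp
      qed
      have Cs: "C * (\<Sum>i=1..n. cmod (\<Phi> (y i)) powr q) powr (1 / q) \<le> (B - e) powr (1 / q)" if "\<Phi> \<in> K" for \<Phi>
      proof -
        have "C * (\<Sum>i=1..n. cmod (\<Phi> (y i)) powr q) powr (1 / q) =
            (C powr q * (\<Sum>i=1..n. cmod (\<Phi> (y i)) powr q)) powr (1 / q)"
          using C0 q by (simp add: powr_mult powr_powr sum_nonneg)
        also have "\<dots> \<le> (B - e) powr (1 / q)"
          using le[OF that] hs[OF that] q by (intro powr_mono2) (auto intro!: mult_nonneg_nonneg sum_nonneg)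
        finally show ?thesis .
      qed
      have Be: "0 \<le> B - e"
      proof -
        have "0 \<le> C powr q * (\<Sum>i=1..n. cmod (\<Phi>0 (y i)) powr q)" by (intro mult_nonneg_nonneg sum_nonneg) auto
        then show ?thesis using le[OF \<Phi>0] hs[OF \<Phi>0] by linarith
      qed
      have "B powr (1 / q) \<le> C * weak_norm q n y"
        using cohen_const_lq[OF C p n xy] by (simp add: B_def q_def)
      also have "\<dots> \<le> (B - e) powr (1 / q)"
      proof (cases "C = 0")
        case False
        then have "0 < C" using C0 by simp
        have "weak_norm q n y \<le> (B - e) powr (1 / q) / C"
          unfolding weak_norm_def
          using Cs \<open>0 < C\<close> by (intro cSUP_least bidual_ball_nonempty) (simp add: K_def pos_le_divide_eq mult.commute)
        then show ?thesis using \<open>0 < C\<close> by (simp add: pos_le_divide_eq mult.commute)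
      qed simp
      also have "\<dots> < B powr (1 / q)" using Be e q by (intro powr_less_mono2) auto
      finally show False by simp
    qed
  qed
  from positive_functional_on_cone[OF this] obtain L :: "((('f \<Rightarrow> complex) \<Rightarrow> complex) \<Rightarrow> real) \<Rightarrow> real" where
    L: "\<And>h k. bounded_fun_on K h \<Longrightarrow> bounded_fun_on K k \<Longrightarrow> L (\<lambda>t. h t + k t) = L h + L k"
      "\<And>c h. 0 \<le> c \<Longrightarrow> bounded_fun_on K h \<Longrightarrow> L (\<lambda>t. c * h t) = c * L h"
      "\<And>h k. bounded_fun_on K h \<Longrightarrow> bounded_fun_on K k \<Longrightarrow> (\<And>t. t \<in> K \<Longrightarrow> h t \<le> k t) \<Longrightarrow> L h \<le> L k"
      "L (\<lambda>_. 1) = 1"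
    and LQ: "\<And>h. h \<in> Q \<Longrightarrow> 0 \<le> L h" by blast
  obtain \<mu> where \<mu>: "regular_borel_prob (ball_wstar Fstar) \<mu>"
    and int: "\<And>h. continuous_map (ball_wstar Fstar) euclidean h \<Longrightarrow> \<forall>t\<in>K. 0 \<le> h t \<Longrightarrow>
       bounded_fun_on K h \<Longrightarrow> L h \<le> (\<integral>t. h t \<partial>\<mu>)"
    using positive_functional_le_integral[OF T(1,2), where L = L, unfolded T(3), OF L] by blast
  have "cmod (y (f x)) \<le> C * Lq_norm q \<mu> (iota Fstar y)" if x: "x \<in> U" and y: "y \<in> pts Fstar" for x y
  proof -
    define h where "h \<Phi> = cmod (iota Fstar y \<Phi>) powr q" for \<Phi>
    have hK: "h \<Phi> = cmod (\<Phi> y) powr q" if "\<Phi> \<in> K" for \<Phi> using that by (simp add: h_def K_def iota_apply)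
    have bh: "bounded_fun_on K h" using bK[OF y] hK by (simp add: bounded_fun_on_def)
    have "continuous_map (ball_wstar Fstar) euclidean h"
    proof -
      have "continuous_on UNIV (\<lambda>z::complex. cmod z powr q)"
        using q by (intro continuous_on_powr' continuous_intros) auto
      then have "continuous_map (ball_wstar Fstar) euclidean ((\<lambda>z. cmod z powr q) \<circ> iota Fstar y)"
        by (intro continuous_map_compose[OF continuous_map_iota[OF F]]) simp
      moreover have "(\<lambda>z. cmod z powr q) \<circ> iota Fstar y = h" by (simp add: fun_eq_iff h_def)
      ultimately show ?thesis by simp
    qed
    then have Lh: "L h \<le> (\<integral>t. h t \<partial>\<mu>)" by (rule int[OF _ _ bh]) (simp add: h_def)
    let ?b = "cmod (y (f x)) powr q"
    have "u (x, y) \<in> Q" using x y unfolding Q_def by (intro CollectI exI[of _ "[(x, y)]"]) auto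
    then have "0 \<le> L (u (x, y))" by (rule LQ)
    moreover have "L (\<lambda>\<Phi>. u (x, y) \<Phi> + ?b) = L (u (x, y)) + ?b"
      using L(1)[OF bu bounded_fun_on_const, of "(x, y)" ?b] L(2)[of ?b "\<lambda>_. 1"] L(4) x y by simp
    moreover have "L (\<lambda>\<Phi>. u (x, y) \<Phi> + ?b) \<le> L (\<lambda>\<Phi>. C powr q * h \<Phi>)"
      using x y by (intro L(3) bounded_fun_on_add bu bounded_fun_on_const bounded_fun_on_cmult bh)
        (auto simp: u_def hK)
    moreover have "L (\<lambda>\<Phi>. C powr q * h \<Phi>) = C powr q * L h" by (rule L(2)[OF _ bh]) simp
    moreover have "C powr q * L h \<le> C powr q * (\<integral>t. h t \<partial>\<mu>)" using Lh by (rule mult_left_mono) simp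
    ultimately have "?b \<le> C powr q * Lq_norm q \<mu> (iota Fstar y) powr q"
      unfolding Lq_norm_powr[OF q] h_def by linarith
    also have "\<dots> = (C * Lq_norm q \<mu> (iota Fstar y)) powr q" using C0 by (simp add: powr_mult)
    finally have le: "?b \<le> (C * Lq_norm q \<mu> (iota Fstar y)) powr q" .
    show ?thesis
    proof (rule ccontr)
      assume "\<not> ?thesis"
      then have "(C * Lq_norm q \<mu> (iota Fstar y)) powr q < ?b"
        using C0 q by (intro powr_less_mono2) auto
      with le show False by simp
    qed
  qed
  with \<mu> show ?thesis unfolding q_def by blast
qed

section \<open>The factorization\<close>

lemma sup_norm_bdd:
  assumes "g \<in> Hinf U V" shows "bdd_above (insert 0 ((\<lambda>x. vnorm V (g x)) ` U))"
proof -
  obtain M where "\<forall>x\<in>U. vnorm V (g x) \<le> M" using assms by (auto simp: Hinf_def)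
  then show ?thesis by (intro bdd_aboveI[of _ "max 0 M"]) (auto simp: le_max_iff_disj)
qed

lemma sup_norm_upper:
  assumes "g \<in> Hinf U V" "x \<in> U" shows "vnorm V (g x) \<le> sup_norm U V g"
  unfolding sup_norm_def using assms(2) by (intro cSup_upper sup_norm_bdd[OF assms(1)]) auto

lemma sup_norm_nonneg:
  assumes "g \<in> Hinf U V" shows "0 \<le> sup_norm U V g"
  unfolding sup_norm_def by (intro cSup_upper sup_norm_bdd[OF assms]) auto

lemma sup_norm_le:
  assumes "0 \<le> C" "\<And>x. x \<in> U \<Longrightarrow> vnorm V (g x) \<le> C" shows "sup_norm U V g \<le> C"
  unfolding sup_norm_def using assms by (intro cSup_least) auto

text \<open>
The functional \<open>g x\<close> extends evaluation at \<open>f x\<close>, and its derivative in direction \<open>h\<close> extends evaluation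
at the derivative of \<open>f\<close>. The Cauchy estimates, with bound \<open>C * Lq_norm\<close> of \<open>\<iota> y\<close>, show that the
derivatives and the remainders are dominated functionals with the constants that differentiability
of \<open>g\<close> requires.
\<close>
theorem cohen_const_imp_factorization:
  fixes f :: "'e::complex_banach \<Rightarrow> 'f::complex_banach"
  assumes U: "open U" and p: "1 < p" and hol: "holomorphic_into U tspace f" and C: "cohen_const p U f C"
  obtains \<mu> S g where "cohen_factorization p U f \<mu> S g"
    "sup_norm U (dual (subspace_on (Lq_space (conj_index p) \<mu>) S)) g \<le> C"
proof -
  let ?q = "conj_index p"
  have q: "1 \<le> ?q" by (rule conj_index_ge_1[OF p])
  have C0: "0 \<le> C" using C by (simp add: cohen_const_def)
  obtain \<mu> :: "(('f \<Rightarrow> complex) \<Rightarrow> complex) measure" where \<mu>: "regular_borel_prob (ball_wstar Fstar) \<mu>"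
    and dom: "\<And>x y. x \<in> U \<Longrightarrow> y \<in> pts Fstar \<Longrightarrow> cmod (y (f x)) \<le> C * Lq_norm ?q \<mu> (iota Fstar y)"
    using Pietsch_domination[OF C p] by blast
  interpret E: Lq_embedding ?q \<mu> "pts Fstar" "iota Fstar :: ('f \<Rightarrow> complex) \<Rightarrow> _"
    by (rule Lq_embedding_iota[OF \<mu> q])
  let ?V = "subspace_on (Lq_space ?q \<mu>) E.image_closure"
  define ev where "ev v y = y v" for v :: 'f and y :: "'f \<Rightarrow> complex"
  define g where "g x = E.ext (ev (f x))" for x
  have dom_ev: "E.dominated B (ev v)"
    if "0 \<le> B" "\<And>y. y \<in> pts Fstar \<Longrightarrow> cmod (y v) \<le> B * Lq_norm ?q \<mu> (iota Fstar y)" for B v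
    using that by (simp add: E.dominated_def ev_def)
  have dom_f: "E.dominated C (ev (f x))" if "x \<in> U" for x
    using dom[OF that] C0 by (intro dom_ev)
  have hol_g: "holomorphic_into U (dual ?V) g"
    unfolding holomorphic_into_def
  proof (intro conjI ballI)
    show "g x \<in> pts (dual ?V)" if "x \<in> U" for x
      unfolding g_def by (rule E.ext_in_dual[OF dom_f[OF that]])
    fix x assume x: "x \<in> U"
    obtain D where D: "(f has_derivative D) (at x)" "\<And>c h. D (c *\<^sub>C h) = c *\<^sub>C D h"
      using hol x unfolding holomorphic_into_tspace[OF U] by blast
    obtain \<rho> where \<rho>: "0 < \<rho>" "cball x \<rho> \<subseteq> U" using U x open_contains_cball by blast
    note cauchy = weak_cauchy_estimates[OF U hol \<rho>(2,1) _ dom D]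
    have dom_D: "E.dominated (C / \<rho> * norm h) (ev (D h))" for h
    proof (rule dom_ev)
      show "0 \<le> C / \<rho> * norm h" using C0 \<rho> by simp
      show "cmod (y (D h)) \<le> C / \<rho> * norm h * Lq_norm ?q \<mu> (iota Fstar y)" if "y \<in> pts Fstar" for y
        using cauchy(1)[OF that _ that, of h] by (simp add: field_simps)
    qed
    define G where "G h = E.ext (ev (D h))" for h
    have lin: "linear D" by (rule has_derivative_linear[OF D(1)])
    have y_lin: "y (a + b) = y a + y b" "y (c *\<^sub>C a) = c * y a" if "y \<in> pts Fstar" for y a b c
      using that by (auto simp: pts_dual_tspace bounded_linear.linear linear_add)
    show "\<exists>D. (\<forall>h. D h \<in> pts (dual ?V)) \<and>
        (\<forall>h k. D (h + k) = vadd (dual ?V) (D h) (D k)) \<and>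
        (\<forall>c h. D (c *\<^sub>C h) = vscale (dual ?V) c (D h)) \<and>
        (\<exists>C. \<forall>h. vnorm (dual ?V) (D h) \<le> C * norm h) \<and>
        (\<forall>\<epsilon>>0. \<exists>\<delta>>0. \<forall>y\<in>U. norm (y - x) < \<delta> \<longrightarrow>
           vnorm (dual ?V) (vsub (dual ?V) (vsub (dual ?V) (g y) (g x)) (D (y - x))) \<le> \<epsilon> * norm (y - x))"
    proof (intro exI[of _ G] conjI allI impI)
      show "G h \<in> pts (dual ?V)" for h unfolding G_def by (rule E.ext_in_dual[OF dom_D])
      show "G (h + k) = vadd (dual ?V) (G h) (G k)" for h k
      proof -
        have "G (h + k) = E.ext (\<lambda>y. 1 * ev (D h) y + 1 * ev (D k) y)"
          unfolding G_def by (rule E.ext_cong) (simp add: ev_def y_lin linear_add[OF lin])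
        then show ?thesis unfolding E.ext_linear[OF dom_D dom_D] by (simp add: G_def)
      qed
      show "G (c *\<^sub>C h) = vscale (dual ?V) c (G h)" for c h
      proof -
        have "G (c *\<^sub>C h) = E.ext (\<lambda>y. c * ev (D h) y + 0 * ev (D h) y)"
          unfolding G_def by (rule E.ext_cong) (simp add: ev_def y_lin D(2))
        then show ?thesis unfolding E.ext_linear[OF dom_D dom_D] by (simp add: G_def)
      qed
      show "\<exists>C. \<forall>h. vnorm (dual ?V) (G h) \<le> C * norm h"
        unfolding G_def using E.ext_norm_le[OF dom_D] by blast
      fix \<epsilon> :: real assume \<epsilon>: "0 < \<epsilon>"
      \<comment> \<open>The remainder is at most \<open>2 * C / \<rho>\<^sup>2\<close> times the squared length of the increment; adding \<open>1\<close> covers \<open>C = 0\<close>.\<close>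
      define \<delta> where "\<delta> = min (\<rho> / 2) (\<epsilon> * \<rho>\<^sup>2 / (2 * C + 1))"
      have "0 < \<delta>" using \<rho> \<epsilon> C0 by (simp add: \<delta>_def)
      moreover have "vnorm (dual ?V) (vsub (dual ?V) (vsub (dual ?V) (g z) (g x)) (G (z - x))) \<le> \<epsilon> * norm (z - x)"
        if z: "z \<in> U" "norm (z - x) < \<delta>" for z
      proof -
        let ?h = "z - x"
        let ?\<psi> = "\<lambda>y. 1 * (1 * ev (f z) y + (- 1) * ev (f x) y) + (- 1) * ev (D ?h) y"
        note d1 = E.dominated_linear[OF dom_f[OF z(1)] dom_f[OF x], of 1 "-1"]
        note d2 = E.dominated_linear[OF d1 dom_D[of ?h], of 1 "-1"]
        have "2 * C * norm ?h \<le> (2 * C + 1) * norm ?h" by (intro mult_right_mono) auto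
        also have "\<dots> \<le> \<epsilon> * \<rho>\<^sup>2"
          using z(2) C0 by (simp add: \<delta>_def pos_less_divide_eq mult.commute)
        finally have small: "2 * C / \<rho>\<^sup>2 * norm ?h \<le> \<epsilon>" using \<rho> by (simp add: pos_divide_le_eq)
        have "E.dominated (\<epsilon> * norm ?h) ?\<psi>"
        proof (rule E.dominated_sharpen[OF d2])
          show "0 \<le> \<epsilon> * norm ?h" using \<epsilon> by simp
          fix y :: "'f \<Rightarrow> complex" assume y: "y \<in> pts Fstar"
          let ?N = "Lq_norm ?q \<mu> (iota Fstar y)"
          have "cmod (?\<psi> y) = cmod (y (f (x + ?h)) - y (f x) - y (D ?h))" by (simp add: ev_def)
          also have "\<dots> \<le> 2 * (C * ?N) / \<rho>\<^sup>2 * (norm ?h)\<^sup>2"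
            using z(2) by (intro cauchy(2)[OF y _ y]) (auto simp: \<delta>_def)
          also have "\<dots> = (2 * C / \<rho>\<^sup>2 * norm ?h) * (norm ?h * ?N)" by (simp add: power2_eq_square)
          also have "\<dots> \<le> \<epsilon> * (norm ?h * ?N)" using small by (intro mult_right_mono) auto
          finally show "cmod (?\<psi> y) \<le> \<epsilon> * norm ?h * ?N" by (simp add: mult.assoc)
        qed
        from E.ext_norm_le[OF this] have "vnorm (dual ?V) (E.ext ?\<psi>) \<le> \<epsilon> * norm ?h" .
        moreover have "E.ext ?\<psi> = vsub (dual ?V) (vsub (dual ?V) (g z) (g x)) (G ?h)"
          unfolding E.ext_linear[OF d1 dom_D] E.ext_linear[OF dom_f[OF z(1)] dom_f[OF x]]
          by (simp add: g_def G_def)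
        ultimately show ?thesis by simp
      qed
      ultimately show "\<exists>\<delta>>0. \<forall>y\<in>U. norm (y - x) < \<delta> \<longrightarrow>
          vnorm (dual ?V) (vsub (dual ?V) (vsub (dual ?V) (g y) (g x)) (G (y - x))) \<le> \<epsilon> * norm (y - x)"
        by blast
    qed
  qed
  have norm_g: "vnorm (dual ?V) (g x) \<le> C" if "x \<in> U" for x
    unfolding g_def by (rule E.ext_norm_le[OF dom_f[OF that]])
  have comm: "kappa tspace (f x) = adjoint_op Fstar (iota Fstar)
      (adjoint_op (subspace_on (C_space (ball_wstar Fstar)) (iota Fstar ` pts Fstar)) (ae_class \<mu>) (g x))"
    if x: "x \<in> U" for x
  proof
    fix y
    show "kappa tspace (f x) y = adjoint_op Fstar (iota Fstar)
      (adjoint_op (subspace_on (C_space (ball_wstar Fstar)) (iota Fstar ` pts Fstar)) (ae_class \<mu>) (g x)) y"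
      using E.ext_image[OF dom_f[OF x], of y] by (simp add: kappa_def adjoint_op_def g_def ev_def)
  qed
  have "cohen_factorization p U f \<mu> E.image_closure g"
    unfolding cohen_factorization_def Hinf_def
    using \<mu> E.closed_subspace_image_closure E.image_in_closure hol_g norm_g comm by auto
  then show ?thesis using sup_norm_le[OF C0 norm_g] by (rule that)
qed

text \<open>
Commutativity of the diagram gives the domination property with constant \<open>\<parallel>g\<parallel>\<close>. Hoelder's inequality
reduces the claim to the bound of the sum of the \<open>q\<close>-th powers of the norms of \<open>\<iota> (y i)\<close>, which is
the integral of a function that is at most the \<open>q\<close>-th power of the weak norm.
\<close>
theorem factorization_imp_cohen_const:
  fixes f :: "'e::complex_banach \<Rightarrow> 'f::complex_banach"
  assumes p: "1 < p" and fac: "cohen_factorization p U f \<mu> S g"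
  shows "cohen_const p U f (sup_norm U (dual (subspace_on (Lq_space (conj_index p) \<mu>) S)) g)"
proof -
  define q where "q = conj_index p"
  have q: "1 \<le> q" unfolding q_def by (rule conj_index_ge_1[OF p])
  let ?V = "subspace_on (Lq_space q \<mu>) S"
  define G where "G = sup_norm U (dual ?V) g"
  have \<mu>: "regular_borel_prob (ball_wstar Fstar) \<mu>" and S: "closed_subspace S (Lq_space q \<mu>)"
    and sub: "ae_class \<mu> ` iota Fstar ` pts Fstar \<subseteq> S" and g: "g \<in> Hinf U (dual ?V)"
    and comm: "\<And>x. x \<in> U \<Longrightarrow> kappa tspace (f x) = adjoint_op Fstar (iota Fstar)
      (adjoint_op (subspace_on (C_space (ball_wstar Fstar)) (iota Fstar ` pts Fstar)) (ae_class \<mu>) (g x))"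
    using fac unfolding cohen_factorization_def q_def by blast+
  interpret E: Lq_embedding q \<mu> "pts Fstar" "iota Fstar :: ('f \<Rightarrow> complex) \<Rightarrow> _"
    by (rule Lq_embedding_iota[OF \<mu> q])
  interpret prob_space \<mu> by (rule regular_borel_probD(1)[OF \<mu>])
  have G0: "0 \<le> G" unfolding G_def by (rule sup_norm_nonneg[OF g])
  have le: "cmod (y (f x)) \<le> G * Lq_norm q \<mu> (iota Fstar y)" if x: "x \<in> U" and y: "y \<in> pts Fstar" for x y
  proof -
    have "y (f x) = g x (ae_class \<mu> (iota Fstar y))"
      using fun_cong[OF comm[OF x], of y] y by (simp add: kappa_def adjoint_op_def)
    also have "cmod \<dots> \<le> vnorm (dual ?V) (g x) * vnorm ?V (ae_class \<mu> (iota Fstar y))"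
      using g x y sub
      by (intro dual_norm_bound seminormed_space_Lq_subspace q S) (auto simp: Hinf_def holomorphic_into_def)
    also have "vnorm ?V (ae_class \<mu> (iota Fstar y)) = Lq_norm q \<mu> (iota Fstar y)"
      using Lq_fun_measurable[OF E.J_Lq[OF y]] by (simp add: vnorm_ae_class)
    also have "vnorm (dual ?V) (g x) * \<dots> \<le> G * \<dots>"
      unfolding G_def by (intro mult_right_mono sup_norm_upper[OF g x]) simp
    finally show ?thesis .
  qed
  have "cohen_const p U f G"
    unfolding cohen_const_iff
  proof (intro conjI allI impI G0)
    fix n :: nat and \<alpha> x and y :: "nat \<Rightarrow> 'f \<Rightarrow> complex"
    assume n: "1 \<le> n" and xy: "\<forall>i\<in>{1..n}. x i \<in> U \<and> y i \<in> pts Fstar"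
    define b where "b i = Lq_norm q \<mu> (iota Fstar (y i))" for i
    define W where "W = weak_norm q n y"
    have W0: "0 \<le> W" unfolding W_def using xy by (intro weak_norm_nonneg q) auto
    have int: "integrable \<mu> (\<lambda>\<Phi>. cmod (iota Fstar (y i) \<Phi>) powr q)" if "i \<in> {1..n}" for i
      using E.J_Lq xy that by (auto simp: Lq_fun_def)
    have "(\<Sum>i=1..n. b i powr q) = (\<integral>\<Phi>. (\<Sum>i=1..n. cmod (iota Fstar (y i) \<Phi>) powr q) \<partial>\<mu>)"
      unfolding b_def Lq_norm_powr[OF q] using int by (rule Bochner_Integration.integral_sum[symmetric])
    also have "\<dots> \<le> (\<integral>\<Phi>. W powr q \<partial>\<mu>)"
    proof (rule integral_mono[OF Bochner_Integration.integrable_sum[OF int]])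
      fix \<Phi> assume "\<Phi> \<in> space \<mu>"
      then have \<Phi>: "\<Phi> \<in> unit_ball (dual Fstar)"
        using regular_borel_probD(2)[OF \<mu>] ball_wstar_compact_Hausdorff(3)[OF seminormed_space_Fstar] by blast
      let ?s = "\<Sum>i=1..n. cmod (\<Phi> (y i)) powr q"
      have "?s = (?s powr (1 / q)) powr q" using q by (simp add: powr_powr sum_nonneg)
      also have "\<dots> \<le> W powr q"
        unfolding W_def using q xy by (intro powr_mono2 weak_norm_upper \<Phi>) auto
      finally show "(\<Sum>i=1..n. cmod (iota Fstar (y i) \<Phi>) powr q) \<le> W powr q"
        by (simp add: iota_apply[OF \<Phi>])
    qed auto
    also have "\<dots> = W powr q" by (simp add: prob_space)
    finally have "(\<Sum>i=1..n. b i powr q) powr (1 / q) \<le> (W powr q) powr (1 / q)"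
      using q by (intro powr_mono2) (auto intro: sum_nonneg)
    also have "\<dots> = W" using q W0 by (simp add: powr_powr)
    finally have bW: "(\<Sum>i=1..n. b i powr q) powr (1 / q) \<le> W" .
    have "(\<Sum>i=1..n. cmod (\<alpha> i) * cmod (y i (f (x i)))) \<le> (\<Sum>i=1..n. cmod (\<alpha> i) * (G * b i))"
      unfolding b_def using xy by (intro sum_mono mult_left_mono le) auto
    also have "\<dots> = G * (\<Sum>i=1..n. cmod (\<alpha> i) * b i)" by (simp add: sum_distrib_left mult_ac)
    also have "\<dots> \<le> G * (lp_norm p n \<alpha> * (\<Sum>i=1..n. b i powr q) powr (1 / q))"
      unfolding q_def by (intro mult_left_mono lp_norm_Holder p n G0) (simp add: b_def)
    also have "\<dots> \<le> G * (lp_norm p n \<alpha> * W)"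
      by (intro mult_left_mono bW lp_norm_nonneg n G0)
    finally show "(\<Sum>i=1..n. cmod (\<alpha> i) * cmod (y i (f (x i)))) \<le> G * lp_norm p n \<alpha> * weak_norm (conj_index p) n y"
      by (simp add: W_def q_def mult.assoc)
  qed
  then show ?thesis by (simp add: G_def q_def)
qed

lemma cohen_norm_attained:
  assumes p: "1 < p" and f: "cohen_summing p U f"
  shows "cohen_const p U f (cohen_norm p U f)"
proof -
  let ?A = "{C. cohen_const p U f C}"
  have ne: "?A \<noteq> {}" using f by (auto simp: cohen_summing_def)
  show ?thesis
    unfolding cohen_const_iff
  proof (intro conjI allI impI)
    show "0 \<le> cohen_norm p U f"
      unfolding cohen_norm_def by (rule cInf_greatest[OF ne]) (simp add: cohen_const_def)
    fix n :: nat and \<alpha> x and y :: "nat \<Rightarrow> 'b \<Rightarrow> complex"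
    assume n: "1 \<le> n" and xy: "\<forall>i\<in>{1..n}. x i \<in> U \<and> y i \<in> pts Fstar"
    let ?s = "\<Sum>i=1..n. cmod (\<alpha> i) * cmod (y i (f (x i)))"
    let ?R = "lp_norm p n \<alpha> * weak_norm (conj_index p) n y"
    have R0: "0 \<le> ?R"
      using xy by (intro mult_nonneg_nonneg lp_norm_nonneg n weak_norm_nonneg conj_index_ge_1 p) auto
    have le: "?s \<le> C * ?R" if "C \<in> ?A" for C
      using that n xy unfolding cohen_const_iff mult.assoc by blast
    have "?s \<le> cohen_norm p U f * ?R"
    proof (cases "?R = 0")
      case True
      then show ?thesis using le ne by auto
    next
      case False
      then have "0 < ?R" using R0 by linarith
      then have "?s / ?R \<le> cohen_norm p U f"
        unfolding cohen_norm_def using le by (intro cInf_greatest[OF ne]) (simp add: pos_divide_le_eq)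
      then show ?thesis using \<open>0 < ?R\<close> by (simp add: pos_divide_le_eq)
    qed
    then show "?s \<le> cohen_norm p U f * lp_norm p n \<alpha> * weak_norm (conj_index p) n y"
      by (simp only: mult.assoc)
  qed
qed

lemma cohen_norm_le: "cohen_const p U f C \<Longrightarrow> cohen_norm p U f \<le> C"
  unfolding cohen_norm_def by (intro cInf_lower) (auto simp: bdd_below_def cohen_const_def)

theorem theorem6p1:
  fixes U :: "'e::complex_banach set"
    and f :: "'e \<Rightarrow> 'f::complex_banach"
    and p :: ereal
  assumes "open U"
    and "1 < p"
    and "f \<in> Hinf U tspace"
  shows "(cohen_summing p U f \<longleftrightarrow> (\<exists>\<mu> S g. cohen_factorization p U f \<mu> S g)) \<and>
    (cohen_summing p U f \<longrightarrow>
       (\<exists>\<mu> S g. cohen_factorization p U f \<mu> S g \<and>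
          cohen_norm p U f =
            sup_norm U (dual (subspace_on (Lq_space (conj_index p) \<mu>) S)) g) \<and>
       (\<forall>\<mu> S g. cohen_factorization p U f \<mu> S g \<longrightarrow>
          cohen_norm p U f \<le>
            sup_norm U (dual (subspace_on (Lq_space (conj_index p) \<mu>) S)) g))"
proof -
  have hol: "holomorphic_into U tspace f" using assms(3) by (simp add: Hinf_def)
  have lower: "cohen_norm p U f \<le> sup_norm U (dual (subspace_on (Lq_space (conj_index p) \<mu>) S)) g"
    if "cohen_factorization p U f \<mu> S g" for \<mu> S g
    by (rule cohen_norm_le[OF factorization_imp_cohen_const[OF assms(2) that]])
  have sufficient: "cohen_summing p U f" if "cohen_factorization p U f \<mu> S g" for \<mu> S g
    using factorization_imp_cohen_const[OF assms(2) that] hol unfolding cohen_summing_def by blast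
  have necessary: "\<exists>\<mu> S g. cohen_factorization p U f \<mu> S g \<and>
      cohen_norm p U f = sup_norm U (dual (subspace_on (Lq_space (conj_index p) \<mu>) S)) g"
    if f: "cohen_summing p U f"
  proof -
    obtain \<mu> S g where fac: "cohen_factorization p U f \<mu> S g"
      and le: "sup_norm U (dual (subspace_on (Lq_space (conj_index p) \<mu>) S)) g \<le> cohen_norm p U f"
      by (rule cohen_const_imp_factorization[OF assms(1,2) hol cohen_norm_attained[OF assms(2) f]])
    then show ?thesis using antisym[OF lower[OF fac] le] by blast
  qed
  show ?thesis using necessary sufficient lower by blast
qed

end
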